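(* Let $p$ and the neighborhood $V$ of $0\in\mathbf{C}$ satisfy assumptions (A1)--(A5) listed in the context. Let $\omega$ be the spectral density function and $w$ the Weyl density of $p$ on $V$, as defined in the context. Then generically $w\not\equiv\omega$ on $V$, in the following sense: if $w\equiv\omega$ on $V$, then there are arbitrarily small perturbations of the operator $P=p^w(x,hD_x)$ within the class of operators satisfying the same assumptions for which the corresponding densities are different. That is, there is an $r>0$ such that for every $\varepsilon>0$ there is a symbol $\tilde p$, bounded and holomorphic in $\{\rho\in\mathbf{C}^4:\ |\mathrm{Im}\,\rho|<r\}$ with $\sup_{|\mathrm{Im}\,\rho|<r}|\tilde p(\rho)-p(\rho)|<\varepsilon$, which satisfies (A1)--(A5) on $V$ and whose densities $\tilde\omega$ and $\tilde w$ satisfy $\tilde w\not\equiv\tilde\omega$ on $V$.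
   Context: Write points of $\mathbf{R}^4=\mathbf{R}^2_x\times\mathbf{R}^2_\xi$ and $\mathbf{C}^4=\mathbf{C}^2_x\times\mathbf{C}^2_\xi$ as $\rho=(x,\xi)$. The function $p(x,\xi)$ is bounded and holomorphic in a tubular neighborhood $\{|\mathrm{Im}\,\rho|<1/C\}$ of $\mathbf{R}^4$ in $\mathbf{C}^4$. $P=p^w(x,hD_x)$ denotes the Weyl quantization of the symbol $p(x,h\xi)$, where $h>0$ is the semiclassical parameter. $\{f,g\}=\sum_j(\partial_{\xi_j}f\,\partial_{x_j}g-\partial_{x_j}f\,\partial_{\xi_j}g)$ is the Poisson bracket. $L(dz)=d\,\mathrm{Re}\,z\,d\,\mathrm{Im}\,z$ is Lebesgue measure on $\mathbf{C}$. Assumptions: (A1) $\mathbf{R}^4\cap p^{-1}(0)$ is nonempty and connected. (A2) On $\mathbf{R}^4$, $|p(x,\xi)|\ge 1/C$ for $|(x,\xi)|\ge C$, for some $C>0$. (A3) $d\,\mathrm{Re}\,p(x,\xi)$ and $d\,\mathrm{Im}\,p(x,\xi)$ are linearly independent for all $(x,\xi)\in p^{-1}(0)\cap\mathbf{R}^4$. (A4) $|\{\mathrm{Re}\,p,\mathrm{Im}\,p\}|$ is sufficiently small on $p^{-1}(0)\cap\mathbf{R}^4$. This means that it is $<\delta$ there, where $\delta=\delta(C)>0$ is a sufficiently small number depending only on a constant $C$ that expresses the other conditions uniformly: $p$ is holomorphic with $|p|\le C$ in $\{|\mathrm{Im}\,\rho|<1/C\}$, (A2) holds with this $C$, and $|d\,\mathrm{Re}\,p\wedge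 d\,\mathrm{Im}\,p|\ge 1/C$ on $p^{-1}(0)\cap\mathbf{R}^4$. (The function $C\mapsto\delta(C)$ may be taken continuous and decreasing, and is fixed once and for all.) Known consequence of (A1)--(A4) (Melin--Sjöstrand): for $z$ in a neighborhood of $0$ in $\mathbf{C}$, $p^{-1}(z)\cap\mathbf{R}^4$ is a torus, and there is a smooth $2$-dimensional torus $\Gamma(z)\subset p^{-1}(z)\cap\mathbf{C}^4$ close to $p^{-1}(z)\cap\mathbf{R}^4$ such that $\sigma|_{\Gamma(z)}=0$ and $I_j(z)\in\mathbf{R}$, $j=1,2$. Here $\sigma=\sum_{j=1}^2d\xi_j\wedge dx_j$ is the complex symplectic $(2,0)$-form, and $I_j(z)=\int_{\gamma_j(z)}\xi\cdot dx$ are the actions along two fundamental cycles $\gamma_1(z),\gamma_2(z)\subset\Gamma(z)$. Moreover $\Gamma(z)$ and $I_j(z)$ depend smoothly on $z$. (A5) $V$ is a (sufficiently small) neighborhood of $0$ in $\mathbf{C}$ on which the preceding objects are defined, and $z\mapsto I(z)=(I_1(z),I_2(z))$ is a diffeomorphism from $V$ onto $I(V)$. Spectral density $\omega$: the function $0<\omega\in C^\infty(V)$ defined by $dI_1(z)\wedge dI_2(z)=\pm\omega(z)\,d\,\mathrm{Re}\,z\wedge d\,\mathrm{Im}\,z$, with the sign chosen so that $\omega>0$. Weyl density $w$: the function on $V$ defined by $$\int f(z)w(z)\,L(dz)=\iint_{\mathbf{R}^4}f(p(x,\xi))\,dx\,d\xi,\qquad f\in C_0^\infty(V).$$ For another symbol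 $\tilde p$ satisfying the assumptions, $\tilde\omega$ and $\tilde w$ are defined in the same way from $\tilde p$. *)

theory Defs
  imports "HOL-Analysis.Analysis"
begin

text \<open>Points are pairs \<open>(x, \<xi>)\<close>; the library norms on these types are the Euclidean ones.\<close>

type_synonym R4 = "(real^2) \<times> (real^2)"
type_synonym C4 = "(complex^2) \<times> (complex^2)"

definition cplx :: "R4 \<Rightarrow> C4" where
  "cplx \<rho> = ((\<chi> j. of_real (fst \<rho> $ j)), (\<chi> j. of_real (snd \<rho> $ j)))"

definition Im4 :: "C4 \<Rightarrow> R4" where
  "Im4 \<rho> = ((\<chi> j. Im (fst \<rho> $ j)), (\<chi> j. Im (snd \<rho> $ j)))"

definition tube :: "real \<Rightarrow> C4 set" where
  "tube r = {\<rho>. norm (Im4 \<rho>) < r}"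

definition cscale :: "complex \<Rightarrow> C4 \<Rightarrow> C4" where
  "cscale c v = (c *s fst v, c *s snd v)"

text \<open>Holomorphy in several variables on an open set: the real Frechet derivative exists and is
  complex linear at every point.\<close>

definition holomorphic4_on :: "(C4 \<Rightarrow> complex) \<Rightarrow> C4 set \<Rightarrow> bool" where
  "holomorphic4_on f S \<longleftrightarrow>
     (\<forall>\<rho>\<in>S. \<exists>L. (f has_derivative L) (at \<rho>) \<and> (\<forall>c v. L (cscale c v) = c * L v))"

definition real_fibre :: "(C4 \<Rightarrow> complex) \<Rightarrow> complex \<Rightarrow> R4 set" where
  "real_fibre p z = {\<rho>. p (cplx \<rho>) = z}"

definition re_part :: "(C4 \<Rightarrow> complex) \<Rightarrow> R4 \<Rightarrow> real" where
  "re_part p \<rho> = Re (p (cplx \<rho>))"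

definition im_part :: "(C4 \<Rightarrow> complex) \<Rightarrow> R4 \<Rightarrow> real" where
  "im_part p \<rho> = Im (p (cplx \<rho>))"

text \<open>\<open>C_diff n f S\<close> is membership in the class of \<open>n\<close> times continuously differentiable maps;
  it is meant for open \<open>S\<close> only.\<close>

primrec C_diff :: "nat \<Rightarrow> ('a::euclidean_space \<Rightarrow> 'b::real_normed_vector) \<Rightarrow> 'a set \<Rightarrow> bool" where
  "C_diff 0 f S \<longleftrightarrow> continuous_on S f"
| "C_diff (Suc n) f S \<longleftrightarrow>
     f differentiable_on S \<and> (\<forall>b\<in>Basis. C_diff n (\<lambda>x. frechet_derivative f (at x) b) S)"

definition smooth_on :: "('a::euclidean_space \<Rightarrow> 'b::real_normed_vector) \<Rightarrow> 'a set \<Rightarrow> bool" where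
  "smooth_on f S \<longleftrightarrow> (\<forall>n. C_diff n f S)"

definition diffeomorphism_onto_image ::
    "('a::euclidean_space \<Rightarrow> 'b::euclidean_space) \<Rightarrow> 'a set \<Rightarrow> bool" where
  "diffeomorphism_onto_image F V \<longleftrightarrow>
     inj_on F V \<and> smooth_on F V \<and> open (F ` V) \<and> smooth_on (inv_into V F) (F ` V)"

definition test_functions :: "complex set \<Rightarrow> (complex \<Rightarrow> complex) set" where
  "test_functions V =
     {f. smooth_on f UNIV \<and> compact (closure {z. f z \<noteq> 0}) \<and> closure {z. f z \<noteq> 0} \<subseteq> V}"

abbreviation differential :: "('a::real_normed_vector \<Rightarrow> 'b::real_normed_vector) \<Rightarrow> 'a \<Rightarrow> 'a \<Rightarrow> 'b" where
  "differential f x \<equiv> frechet_derivative f (at x)"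

definition wedge :: "('a \<Rightarrow> real) \<Rightarrow> ('a \<Rightarrow> real) \<Rightarrow> 'a \<Rightarrow> 'a \<Rightarrow> real" where
  "wedge \<alpha> \<beta> u v = \<alpha> u * \<beta> v - \<alpha> v * \<beta> u"

text \<open>Euclidean norm of a 2-form. The factor 1/2 is there because each pair of basis vectors is
  counted twice.\<close>

definition norm_2form :: "('a::euclidean_space \<Rightarrow> 'a \<Rightarrow> real) \<Rightarrow> real" where
  "norm_2form \<tau> = sqrt ((\<Sum>b\<in>Basis. \<Sum>c\<in>Basis. (\<tau> b c)\<^sup>2) / 2)"

definition lin_indep2 :: "('a \<Rightarrow> real) \<Rightarrow> ('a \<Rightarrow> real) \<Rightarrow> bool" where
  "lin_indep2 \<alpha> \<beta> \<longleftrightarrow> (\<forall>a b. (\<forall>v. a * \<alpha> v + b * \<beta> v = 0) \<longrightarrow> a = 0 \<and> b = 0)"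

definition poisson :: "(R4 \<Rightarrow> real) \<Rightarrow> (R4 \<Rightarrow> real) \<Rightarrow> R4 \<Rightarrow> real" where
  "poisson f g \<rho> = (\<Sum>j\<in>UNIV.
       differential f \<rho> (0, axis j 1) * differential g \<rho> (axis j 1, 0)
     - differential f \<rho> (axis j 1, 0) * differential g \<rho> (0, axis j 1))"

text \<open>The complex symplectic form, the sum of \<open>d\<xi>\<^sub>j \<and> dx\<^sub>j\<close>.\<close>

definition sigma :: "C4 \<Rightarrow> C4 \<Rightarrow> complex" where
  "sigma u v = (\<Sum>j\<in>UNIV. snd u $ j * fst v $ j - fst u $ j * snd v $ j)"

definition condA1 :: "(C4 \<Rightarrow> complex) \<Rightarrow> bool" where
  "condA1 p \<longleftrightarrow> real_fibre p 0 \<noteq> {} \<and> connected (real_fibre p 0)"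

definition elliptic_at_infinity :: "real \<Rightarrow> (C4 \<Rightarrow> complex) \<Rightarrow> bool" where
  "elliptic_at_infinity C p \<longleftrightarrow> (\<forall>\<rho>::R4. norm \<rho> \<ge> C \<longrightarrow> cmod (p (cplx \<rho>)) \<ge> 1 / C)"

definition condA2 :: "(C4 \<Rightarrow> complex) \<Rightarrow> bool" where
  "condA2 p \<longleftrightarrow> (\<exists>C>0. elliptic_at_infinity C p)"

definition condA3 :: "(C4 \<Rightarrow> complex) \<Rightarrow> bool" where
  "condA3 p \<longleftrightarrow>
     (\<forall>\<rho>\<in>real_fibre p 0. lin_indep2 (differential (re_part p) \<rho>) (differential (im_part p) \<rho>))"

text \<open>A constant \<open>C\<close> controlling all conditions except the smallness of the bracket. It contains
  the standing requirement that \<open>p\<close> be bounded and holomorphic in a tube.\<close>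

definition uniform_constant :: "real \<Rightarrow> (C4 \<Rightarrow> complex) \<Rightarrow> bool" where
  "uniform_constant C p \<longleftrightarrow>
     C > 0 \<and>
     holomorphic4_on p (tube (1 / C)) \<and>
     (\<forall>\<rho>\<in>tube (1 / C). cmod (p \<rho>) \<le> C) \<and>
     elliptic_at_infinity C p \<and>
     (\<forall>\<rho>\<in>real_fibre p 0.
        norm_2form (wedge (differential (re_part p) \<rho>) (differential (im_part p) \<rho>)) \<ge> 1 / C)"

definition condA4 :: "(real \<Rightarrow> real) \<Rightarrow> real \<Rightarrow> (C4 \<Rightarrow> complex) \<Rightarrow> bool" where
  "condA4 \<delta> C p \<longleftrightarrow>
     uniform_constant C p \<and>
     (\<forall>\<rho>\<in>real_fibre p 0. \<bar>poisson (re_part p) (im_part p) \<rho>\<bar> < \<delta> C)"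

definition threshold :: "(real \<Rightarrow> real) \<Rightarrow> bool" where
  "threshold \<delta> \<longleftrightarrow>
     (\<forall>C>0. \<delta> C > 0) \<and> continuous_on {0<..} \<delta> \<and> antimono_on {0<..} \<delta>"

text \<open>A smooth embedding of the torus (the plane modulo integer vectors), given as a periodic map.\<close>

definition torus_embedding :: "(real^2 \<Rightarrow> 'b::real_normed_vector) \<Rightarrow> bool" where
  "torus_embedding \<phi> \<longleftrightarrow>
     smooth_on \<phi> UNIV \<and>
     (\<forall>\<theta> \<theta>'. \<phi> \<theta> = \<phi> \<theta>' \<longleftrightarrow> (\<forall>j. \<theta> $ j - \<theta>' $ j \<in> \<int>)) \<and>
     (\<forall>\<theta>. inj (differential \<phi> \<theta>))"

text \<open>The integral of \<open>\<xi> \<cdot> dx\<close> along a curve parametrized by the unit interval.\<close>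

definition xi_dx_integral :: "(real \<Rightarrow> C4) \<Rightarrow> complex" where
  "xi_dx_integral \<gamma> =
     integral {0..1} (\<lambda>t. \<Sum>k\<in>UNIV. snd (\<gamma> t) $ k * vector_derivative (\<lambda>s. fst (\<gamma> s) $ k) (at t))"

text \<open>The fundamental cycles on the torus parametrized by \<open>\<Phi> z\<close> are the images of the coordinate
  circles. Every other pair of generators arises in this way after an integral linear change of
  the parameter.\<close>

definition cycle :: "(complex \<Rightarrow> real^2 \<Rightarrow> C4) \<Rightarrow> 2 \<Rightarrow> complex \<Rightarrow> real \<Rightarrow> C4" where
  "cycle \<Phi> j z t = \<Phi> z (t *\<^sub>R axis j 1)"

text \<open>The real part only serves to obtain a real type: the actions are required to be real below.\<close>

definition actions :: "(complex \<Rightarrow> real^2 \<Rightarrow> C4) \<Rightarrow> complex \<Rightarrow> real^2" where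
  "actions \<Phi> z = (\<chi> j. Re (xi_dx_integral (cycle \<Phi> j z)))"

text \<open>A smooth family of isotropic tori \<open>\<Gamma>(z) = range (\<Phi> z)\<close> in the complex fibres with real actions,
  uniformly closer than \<open>\<eta> C\<close> to the real fibres, which are tori themselves. Closeness is measured in
  matching parametrizations, so that the cycles of the two tori correspond to each other.\<close>

definition torus_family ::
    "(real \<Rightarrow> real) \<Rightarrow> real \<Rightarrow> complex set \<Rightarrow> (C4 \<Rightarrow> complex) \<Rightarrow> (complex \<Rightarrow> real^2 \<Rightarrow> C4) \<Rightarrow> bool" where
  "torus_family \<eta> C V p \<Phi> \<longleftrightarrow>
     smooth_on (\<lambda>(z, \<theta>). \<Phi> z \<theta>) (V \<times> UNIV) \<and>
     (\<forall>z\<in>V.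
        torus_embedding (\<Phi> z) \<and>
        range (\<Phi> z) \<subseteq> {\<rho> \<in> tube (1 / C). p \<rho> = z} \<and>
        (\<forall>\<theta> u v. sigma (differential (\<Phi> z) \<theta> u) (differential (\<Phi> z) \<theta> v) = 0) \<and>
        (\<forall>j. xi_dx_integral (cycle \<Phi> j z) \<in> \<real>)) \<and>
     (\<exists>e<\<eta> C. \<forall>z\<in>V. \<exists>\<phi> :: real^2 \<Rightarrow> R4.
        torus_embedding \<phi> \<and> range \<phi> = real_fibre p z \<and>
        (\<forall>\<theta>. norm (\<Phi> z \<theta> - cplx (\<phi> \<theta>)) \<le> e))"

definition condA5 ::
    "(real \<Rightarrow> real) \<Rightarrow> real \<Rightarrow> complex set \<Rightarrow> (C4 \<Rightarrow> complex) \<Rightarrow> (complex \<Rightarrow> real^2 \<Rightarrow> C4) \<Rightarrow> bool" where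
  "condA5 \<eta> C V p \<Phi> \<longleftrightarrow>
     open V \<and> 0 \<in> V \<and> torus_family \<eta> C V p \<Phi> \<and> diffeomorphism_onto_image (actions \<Phi>) V"

text \<open>The 2-form \<open>dI\<^sub>1 \<and> dI\<^sub>2\<close> is compared with \<open>d Re z \<and> d Im z\<close> by evaluating both on the
  oriented basis \<open>1, \<i>\<close>.\<close>

definition spectral_density ::
    "complex set \<Rightarrow> (complex \<Rightarrow> real^2 \<Rightarrow> C4) \<Rightarrow> (complex \<Rightarrow> real) \<Rightarrow> bool" where
  "spectral_density V \<Phi> \<omega> \<longleftrightarrow>
     smooth_on \<omega> V \<and>
     (\<forall>z\<in>V. \<omega> z > 0 \<and>
        (let dI = (\<lambda>j. differential (\<lambda>z. actions \<Phi> z $ j) z)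
         in wedge (dI 1) (dI 2) 1 \<i> = \<omega> z \<or> wedge (dI 1) (dI 2) 1 \<i> = - \<omega> z))"

text \<open>The defining identity determines \<open>w\<close> only almost everywhere; continuity singles out the
  representative for which pointwise comparison with \<open>\<omega>\<close> makes sense.\<close>

definition weyl_density ::
    "complex set \<Rightarrow> (C4 \<Rightarrow> complex) \<Rightarrow> (complex \<Rightarrow> real) \<Rightarrow> bool" where
  "weyl_density V p w \<longleftrightarrow>
     continuous_on V w \<and>
     (\<forall>f\<in>test_functions V.
        integrable lborel (\<lambda>z. f z * of_real (w z)) \<and>
        integrable lborel (\<lambda>\<rho>. f (p (cplx \<rho>))) \<and>
        (\<integral>z. f z * of_real (w z) \<partial>lborel) = (\<integral>\<rho>. f (p (cplx \<rho>)) \<partial>lborel))"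

end

theory Submission
  imports Defs "HOL-Complex_Analysis.Complex_Analysis" "HOL-Real_Asymp.Real_Asymp"
begin

text \<open>The perturbations are \<open>p \<circ> \<kappa>\<close> with the complex symplectic shears
  \<open>\<kappa>(x, \<xi>) = (x, \<xi> + \<zeta> \<phi>(x\<^sub>1) e\<^sub>1)\<close>, \<open>\<zeta>\<close> a small complex number and \<open>\<phi>\<close> a Gaussian. The tori are transported by
  \<open>\<kappa>\<^sup>-\<^sup>1\<close>, which preserves their actions, so the spectral density does not change. The real fibres move by small smooth maps
  obtained from a contraction, and the push-forward of Lebesgue measure keeps a continuous density by integration
  by parts.

  The Weyl density does change: since \<open>p \<circ> \<kappa>\<close> is holomorphic in \<open>\<zeta>\<close>, the Laplacian in \<open>\<zeta>\<close> at \<open>0\<close> of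
  \<open>\<integral> f(p \<circ> \<kappa>)\<close> is \<open>\<integral> (\<Delta>f)(p) |\<phi>(x\<^sub>1) \<partial>p/\<partial>\<xi>\<^sub>1|\<^sup>2\<close>. Take a radial bump function \<open>f\<close> that is
  subharmonic outside a small disc around \<open>0\<close>, and concentrate \<open>\<phi>\<close> where \<open>x\<^sub>1\<close> is larger than on the fibres over this disc;
  such points exist in nearby fibres because the linear function \<open>x\<^sub>1\<close> has no interior maximum. Then the integral is positive.\<close>

section \<open>Smooth maps\<close>

text \<open>For real \<zeta> a shear is a real canonical transformation, which changes neither
  density; the effect comes from complex \<zeta>. The first variation need not help: it vanishes
  whenever \<open>Re p\<close> and \<open>Im p\<close> Poisson-commute. Hence the second variation,
  in which holomorphy in \<zeta> turns the sum of the second derivatives along 1 and \<i> into a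
  Laplacian of \<open>f\<close>. A nonzero compactly supported \<open>f\<close> is never subharmonic
  everywhere, so a disc with the wrong sign is unavoidable, and the weight \<phi> must suppress it.
  If the densities still agreed for every small \<zeta>, the integrals of
  \<open>f (p \<circ> \<kappa>)\<close> would be constant near \<zeta> = 0 and their Laplacian zero.
  Gaussians are entire and bounded in horizontal strips; \<open>N\<close> and \<open>b\<close> are
  fixed before \<epsilon>, and only \<zeta> shrinks with \<epsilon>. The conditions with constant
  \<open>C\<close> are closed and may hold with equality, so a perturbation can violate them. The
  constant is therefore raised to some \<open>C' > C\<close>; the strict inequalities against
  \<delta> and \<eta> survive because these functions are continuous.\<close>

lemma linear_Basis_expansion:
  fixes L :: "'a::euclidean_space \<Rightarrow> 'b::real_vector"
  assumes "linear L"
  shows "L w = (\<Sum>c\<in>Basis. (w \<bullet> c) *\<^sub>R L c)"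
proof -
  have "L w = L (\<Sum>c\<in>Basis. (w \<bullet> c) *\<^sub>R c)" by (simp add: euclidean_representation)
  also have "\<dots> = (\<Sum>c\<in>Basis. (w \<bullet> c) *\<^sub>R L c)"
    by (simp only: linear_sum[OF assms] linear_cmul[OF assms])
  finally show ?thesis .
qed

lemma C_diff_cong:
  assumes "open S" "\<And>x. x \<in> S \<Longrightarrow> f x = g x"
  shows "C_diff n f S \<longleftrightarrow> C_diff n g S"
  using assms(2)
proof (induction n arbitrary: f g)
  case 0
  then show ?case by (simp cong: continuous_on_cong)
next
  case (Suc n)
  have hd: "(f has_derivative F) (at x) \<longleftrightarrow> (g has_derivative F) (at x)" if "x \<in> S" for x F
    using has_derivative_transform_within_open[of f F x UNIV S g] has_derivative_transform_within_open[of g F x UNIV S f]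
      assms(1) that Suc.prems by auto
  have "f differentiable_on S \<longleftrightarrow> g differentiable_on S"
    unfolding differentiable_on_eq_differentiable_at[OF assms(1)] differentiable_def
    using hd by blast
  moreover have "frechet_derivative f (at x) = frechet_derivative g (at x)" if "x \<in> S" for x
    unfolding frechet_derivative_def using hd[OF that] by simp
  ultimately show ?case
    using Suc.IH[of "\<lambda>x. frechet_derivative f (at x) b" "\<lambda>x. frechet_derivative g (at x) b" for b]
    by auto
qed

text \<open>\<open>C_diff\<close> is phrased with the choice made by
  \<open>frechet_derivative\<close>. Derivatives at interior points are unique, so any explicitly
  given derivative may take its place.\<close>

lemma C_diff_SucI:
  assumes "open S" "\<And>x. x \<in> S \<Longrightarrow> (f has_derivative f' x) (at x)"
    and "\<And>b. b \<in> Basis \<Longrightarrow> C_diff n (\<lambda>x. f' x b) S"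
  shows "C_diff (Suc n) f S"
proof -
  have "f differentiable_on S"
    unfolding differentiable_on_eq_differentiable_at[OF assms(1)] differentiable_def
    using assms(2) by blast
  moreover have "frechet_derivative f (at x) = f' x" if "x \<in> S" for x
    using frechet_derivative_at[OF assms(2)[OF that]] by simp
  ultimately show ?thesis
    using assms(3) C_diff_cong[OF assms(1), of "\<lambda>x. frechet_derivative f (at x) b" "\<lambda>x. f' x b" for b]
    by auto
qed

lemma C_diff_has_derivative:
  assumes "open S" "C_diff (Suc n) f S" "x \<in> S"
  shows "(f has_derivative frechet_derivative f (at x)) (at x)"
proof -
  have "f differentiable at x"
    using assms(2,3) differentiable_on_eq_differentiable_at[OF assms(1), of f] by auto
  then show ?thesis using frechet_derivative_works by blast
qed

lemma C_diff_mono_Suc: "C_diff (Suc n) f S \<Longrightarrow> C_diff n f S"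
proof (induction n arbitrary: f)
  case 0
  then show ?case using differentiable_imp_continuous_on by auto
next
  case (Suc n)
  then show ?case by simp
qed

lemma C_diff_mono: "C_diff n f S \<Longrightarrow> m \<le> n \<Longrightarrow> C_diff m f S"
  by (induction n) (metis le_zero_eq, metis C_diff_mono_Suc le_Suc_eq)

lemma C_diff_subset: "C_diff n f S \<Longrightarrow> T \<subseteq> S \<Longrightarrow> C_diff n f T"
  by (induction n arbitrary: f) (auto intro: continuous_on_subset differentiable_on_subset)

lemma C_diff_const: "open S \<Longrightarrow> C_diff n (\<lambda>x. c) S"
proof (induction n arbitrary: c)
  case (Suc n)
  show ?case
    by (rule C_diff_SucI[where f' = "\<lambda>x v. 0"]) (use Suc in auto)
qed simp

lemma C_diff_bounded_linear:
  assumes "open S" "bounded_linear L" "C_diff n f S"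
  shows "C_diff n (\<lambda>x. L (f x)) S"
  using assms(3)
proof (induction n arbitrary: f)
  case 0
  then show ?case by (simp add: bounded_linear.continuous_on[OF assms(2)])
next
  case (Suc n)
  show ?case
    by (rule C_diff_SucI[where f' = "\<lambda>x v. L (frechet_derivative f (at x) v)"])
       (use Suc assms in \<open>auto intro!: bounded_linear.has_derivative[OF assms(2)] C_diff_has_derivative[OF assms(1)]\<close>)
qed

lemma C_diff_ident: "open S \<Longrightarrow> C_diff n (\<lambda>x. x) S"
proof (cases n)
  case (Suc m)
  assume "open S"
  then show ?thesis unfolding Suc
    by (intro C_diff_SucI[where f' = "\<lambda>x v. v"]) (auto intro: C_diff_const)
qed simp

lemma C_diff_linear: "open S \<Longrightarrow> bounded_linear L \<Longrightarrow> C_diff n L S"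
  using C_diff_bounded_linear[OF _ _ C_diff_ident] .

lemma C_diff_add:
  assumes "open S" "C_diff n f S" "C_diff n g S"
  shows "C_diff n (\<lambda>x. f x + g x) S"
  using assms(2,3)
proof (induction n arbitrary: f g)
  case 0
  then show ?case by (simp add: continuous_on_add)
next
  case (Suc n)
  show ?case
    by (rule C_diff_SucI[where f' = "\<lambda>x v. frechet_derivative f (at x) v + frechet_derivative g (at x) v"])
       (use Suc assms(1) in \<open>auto intro!: has_derivative_add C_diff_has_derivative[OF assms(1)]\<close>)
qed

lemma C_diff_sum:
  assumes "open S" "\<And>i. i \<in> I \<Longrightarrow> C_diff n (f i) S"
  shows "C_diff n (\<lambda>x. \<Sum>i\<in>I. f i x) S"
  using assms(2)
  by (induction I rule: infinite_finite_induct) (simp_all add: assms(1) C_diff_const C_diff_add)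

lemma C_diff_bilinear:
  assumes "open S" "bounded_bilinear B" "C_diff n f S" "C_diff n g S"
  shows "C_diff n (\<lambda>x. B (f x) (g x)) S"
  using assms(3,4)
proof (induction n arbitrary: f g)
  case 0
  then show ?case by (simp add: bounded_bilinear.continuous_on[OF assms(2)])
next
  case (Suc n)
  have "C_diff n f S" "C_diff n g S"
    using Suc.prems C_diff_mono_Suc by blast+
  with Suc show ?case
    by (intro C_diff_SucI[where f' = "\<lambda>x v. B (f x) (frechet_derivative g (at x) v) + B (frechet_derivative f (at x) v) (g x)"])
      (auto intro!: bounded_bilinear.FDERIV[OF assms(2)] C_diff_add[OF assms(1)] assms(1)
         C_diff_has_derivative[OF assms(1)])
qed

lemmas C_diff_scaleR = C_diff_bilinear[OF _ bounded_bilinear_scaleR]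
lemmas C_diff_mult = C_diff_bilinear[OF _ bounded_bilinear_mult]
lemmas C_diff_inner = C_diff_bilinear[OF _ bounded_bilinear_inner]

lemma C_diff_Pair:
  assumes "open S" "C_diff n f S" "C_diff n g S"
  shows "C_diff n (\<lambda>x. (f x, g x)) S"
proof -
  have L: "bounded_linear (\<lambda>x::'b. (x, 0::'c))" "bounded_linear (\<lambda>x::'c. (0::'b, x))"
    by (auto intro!: bounded_linear_Pair bounded_linear_ident bounded_linear_zero)
  have "C_diff n (\<lambda>x. (f x, 0) + (0, g x)) S"
    by (rule C_diff_add[OF assms(1) C_diff_bounded_linear[OF assms(1) L(1) assms(2)]
          C_diff_bounded_linear[OF assms(1) L(2) assms(3)]])
  then show ?thesis by simp
qed

lemma C_diff_compose:
  fixes f :: "'a::euclidean_space \<Rightarrow> 'b::euclidean_space" and g :: "'b \<Rightarrow> 'c::real_normed_vector"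
  assumes "open S" "open T" "f ` S \<subseteq> T" "C_diff n f S" "C_diff n g T"
  shows "C_diff n (\<lambda>x. g (f x)) S"
  using assms(4,5)
proof (induction n arbitrary: g)
  case 0
  then show ?case using assms(3) by (auto intro: continuous_on_compose2)
next
  case (Suc n)
  \<comment> \<open>\<open>C_diff\<close> controls derivatives along fixed basis vectors only,
    whereas the chain rule differentiates \<open>g\<close> along a vector that moves with
    \<open>x\<close>. Expanding that vector in the basis of the middle space gives a sum of products
    to which the induction hypothesis applies.\<close>
  let ?D = "\<lambda>x v. \<Sum>c\<in>Basis. (frechet_derivative f (at x) v \<bullet> c) *\<^sub>R frechet_derivative g (at (f x)) c"
  have gd: "(g has_derivative frechet_derivative g (at y)) (at y)" if "y \<in> T" for y
    using C_diff_has_derivative[OF assms(2) Suc.prems(2) that] .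
  have fd: "(f has_derivative frechet_derivative f (at x)) (at x)" if "x \<in> S" for x
    using C_diff_has_derivative[OF assms(1) Suc.prems(1) that] .
  show ?case
  proof (rule C_diff_SucI[where f' = ?D])
    fix x assume x: "x \<in> S"
    then have fx: "f x \<in> T" using assms(3) by blast
    have "linear (frechet_derivative g (at (f x)))"
      using gd[OF fx] has_derivative_linear by blast
    then have exp: "frechet_derivative g (at (f x)) w = (\<Sum>c\<in>Basis. (w \<bullet> c) *\<^sub>R frechet_derivative g (at (f x)) c)" for w
      by (rule linear_Basis_expansion)
    have "?D x = frechet_derivative g (at (f x)) \<circ> frechet_derivative f (at x)"
      by (rule ext) (simp only: o_def exp[symmetric])
    then show "((\<lambda>x. g (f x)) has_derivative ?D x) (at x)"
      using diff_chain_at[OF fd[OF x] gd[OF fx]] by (simp add: o_def)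
  next
    fix b :: 'a assume b: "b \<in> Basis"
    have "C_diff n f S" using Suc.prems(1) C_diff_mono_Suc by blast
    then show "C_diff n (\<lambda>x. ?D x b) S"
      using Suc.prems b assms(1)
      by (intro C_diff_sum C_diff_scaleR C_diff_inner Suc.IH C_diff_const) auto
  qed (fact assms(1))
qed

lemma C_diff_inverse:
  fixes f :: "'a::euclidean_space \<Rightarrow> 'b::real_normed_field"
  assumes "open S" "C_diff n f S" "\<And>x. x \<in> S \<Longrightarrow> f x \<noteq> 0"
  shows "C_diff n (\<lambda>x. inverse (f x)) S"
  using assms(2)
proof (induction n)
  case 0
  then show ?case using assms(3) by (auto intro: continuous_on_inverse)
next
  case (Suc n)
  have inv: "C_diff n (\<lambda>x. inverse (f x)) S"
    using Suc C_diff_mono_Suc by blast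
  show ?case
  proof (rule C_diff_SucI[where f' = "\<lambda>x v. - (inverse (f x) * frechet_derivative f (at x) v * inverse (f x))"])
    fix x assume x: "x \<in> S"
    show "((\<lambda>x. inverse (f x)) has_derivative (\<lambda>v. - (inverse (f x) * frechet_derivative f (at x) v * inverse (f x)))) (at x)"
      using Deriv.has_derivative_inverse[OF assms(3)[OF x] C_diff_has_derivative[OF assms(1) Suc.prems x]] .
  next
    fix b :: 'a assume b: "b \<in> Basis"
    have "C_diff n (\<lambda>x. frechet_derivative f (at x) b) S" using Suc.prems b by auto
    then show "C_diff n (\<lambda>x. - (inverse (f x) * frechet_derivative f (at x) b * inverse (f x))) S"
      using inv assms(1)
      by (intro C_diff_bounded_linear[OF assms(1) bounded_linear_minus[OF bounded_linear_ident]] C_diff_mult) auto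
  qed (fact assms(1))
qed

lemma C_diff_Union:
  assumes "\<And>x. x \<in> S \<Longrightarrow> \<exists>T. open T \<and> x \<in> T \<and> C_diff n f T" "open S"
  shows "C_diff n f S"
  using assms(1)
proof (induction n arbitrary: f)
  case 0
  then have "continuous (at x) f" if "x \<in> S" for x
    using that C_diff.simps(1) continuous_on_eq_continuous_at by blast
  then show ?case by (simp add: continuous_at_imp_continuous_on)
next
  case (Suc n)
  have "f differentiable at x" if "x \<in> S" for x
    using Suc.prems[OF that] differentiable_on_eq_differentiable_at by auto
  then have "f differentiable_on S"
    using assms(2) differentiable_on_eq_differentiable_at by blast
  moreover have "C_diff n (\<lambda>x. frechet_derivative f (at x) b) S" if "b \<in> Basis" for b
  proof (rule Suc.IH)
    fix x assume "x \<in> S"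
    then obtain T where "open T" "x \<in> T" "C_diff (Suc n) f T" using Suc.prems by blast
    with that show "\<exists>T. open T \<and> x \<in> T \<and> C_diff n (\<lambda>x. frechet_derivative f (at x) b) T" by auto
  qed
  ultimately show ?case by simp
qed

lemma smooth_on_has_derivative:
  assumes "open S" "smooth_on f S" "x \<in> S"
  shows "(f has_derivative frechet_derivative f (at x)) (at x)"
  using assms C_diff_has_derivative unfolding smooth_on_def by blast

lemma smooth_on_continuous: "smooth_on f S \<Longrightarrow> continuous_on S f"
  unfolding smooth_on_def using C_diff.simps(1) by blast

lemma smooth_on_subset: "smooth_on f S \<Longrightarrow> T \<subseteq> S \<Longrightarrow> smooth_on f T"
  unfolding smooth_on_def using C_diff_subset by blast

lemma smooth_on_cong:
  assumes "open S" "\<And>x. x \<in> S \<Longrightarrow> f x = g x"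
  shows "smooth_on f S \<longleftrightarrow> smooth_on g S"
  unfolding smooth_on_def using C_diff_cong[of S f g] assms by blast

lemma smooth_on_Union:
  assumes "open S" "\<And>x. x \<in> S \<Longrightarrow> \<exists>T. open T \<and> x \<in> T \<and> smooth_on f T"
  shows "smooth_on f S"
  unfolding smooth_on_def
proof
  fix n show "C_diff n f S"
    by (rule C_diff_Union[OF _ assms(1)]) (use assms(2) smooth_on_def in blast)
qed

lemma
  fixes f g :: "'a::euclidean_space \<Rightarrow> 'b::real_normed_vector" and F :: "'i \<Rightarrow> 'a \<Rightarrow> 'b"
    and h :: "'a \<Rightarrow> 'd::real_normed_field"
  assumes "open S"
  shows smooth_on_const: "smooth_on (\<lambda>x. c) S"
    and smooth_on_linear: "bounded_linear L \<Longrightarrow> smooth_on L S"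
    and smooth_on_bounded_linear: "bounded_linear L' \<Longrightarrow> smooth_on f S \<Longrightarrow> smooth_on (\<lambda>x. L' (f x)) S"
    and smooth_on_add: "smooth_on f S \<Longrightarrow> smooth_on g S \<Longrightarrow> smooth_on (\<lambda>x. f x + g x) S"
    and smooth_on_diff: "smooth_on f S \<Longrightarrow> smooth_on g S \<Longrightarrow> smooth_on (\<lambda>x. f x - g x) S"
    and smooth_on_minus: "smooth_on f S \<Longrightarrow> smooth_on (\<lambda>x. - f x) S"
    and smooth_on_sum: "(\<And>i. i \<in> I \<Longrightarrow> smooth_on (F i) S) \<Longrightarrow> smooth_on (\<lambda>x. \<Sum>i\<in>I. F i x) S"
    and smooth_on_bilinear: "bounded_bilinear B \<Longrightarrow> smooth_on u S \<Longrightarrow> smooth_on v S \<Longrightarrow> smooth_on (\<lambda>x. B (u x) (v x)) S"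
    and smooth_on_Pair: "smooth_on u S \<Longrightarrow> smooth_on v S \<Longrightarrow> smooth_on (\<lambda>x. (u x, v x)) S"
    and smooth_on_inverse: "smooth_on h S \<Longrightarrow> (\<And>x. x \<in> S \<Longrightarrow> h x \<noteq> 0) \<Longrightarrow> smooth_on (\<lambda>x. inverse (h x)) S"
proof -
  show "smooth_on f S \<Longrightarrow> smooth_on (\<lambda>x. - f x) S" for f :: "'a \<Rightarrow> 'b"
    using C_diff_bounded_linear[OF assms bounded_linear_minus[OF bounded_linear_ident]] 
    by (auto simp: smooth_on_def)
  then show "smooth_on f S \<Longrightarrow> smooth_on g S \<Longrightarrow> smooth_on (\<lambda>x. f x - g x) S"
    using C_diff_add[OF assms, of _ f "\<lambda>x. - g x"] by (auto simp: smooth_on_def)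
qed (simp_all add: smooth_on_def assms C_diff_const C_diff_linear C_diff_bounded_linear C_diff_add C_diff_sum
    C_diff_bilinear C_diff_Pair C_diff_inverse)

lemmas smooth_on_scaleR = smooth_on_bilinear[OF _ bounded_bilinear_scaleR]
lemmas smooth_on_mult = smooth_on_bilinear[OF _ bounded_bilinear_mult]
lemmas smooth_on_inner = smooth_on_bilinear[OF _ bounded_bilinear_inner]
lemmas smooth_on_ident = smooth_on_linear[OF _ bounded_linear_ident]

lemma smooth_on_compose:
  assumes "open S" "open T" "f ` S \<subseteq> T" "smooth_on f S" "smooth_on g T"
  shows "smooth_on (\<lambda>x. g (f x)) S"
  using assms C_diff_compose unfolding smooth_on_def by blast

lemma smooth_on_frechet_derivative:
  assumes "open S" "smooth_on f S"
  shows "smooth_on (\<lambda>x. frechet_derivative f (at x) v) S"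
proof -
  have 1: "smooth_on (\<lambda>x. frechet_derivative f (at x) b) S" if "b \<in> Basis" for b
    unfolding smooth_on_def
  proof
    fix n
    have "C_diff (Suc n) f S" using assms(2) unfolding smooth_on_def by blast
    then show "C_diff n (\<lambda>x. frechet_derivative f (at x) b) S" using that by simp
  qed
  have "frechet_derivative f (at x) v = (\<Sum>b\<in>Basis. (v \<bullet> b) *\<^sub>R frechet_derivative f (at x) b)" if "x \<in> S" for x
  proof -
    have "linear (frechet_derivative f (at x))"
      using smooth_on_has_derivative[OF assms that] has_derivative_linear by blast
    then show ?thesis
      by (rule linear_Basis_expansion)
  qed
  then have eq: "smooth_on (\<lambda>x. frechet_derivative f (at x) v) S \<longleftrightarrow>
     smooth_on (\<lambda>x. \<Sum>b\<in>Basis. (v \<bullet> b) *\<^sub>R frechet_derivative f (at x) b) S"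
    by (rule smooth_on_cong[OF assms(1)])
  show ?thesis
    unfolding eq by (intro smooth_on_sum smooth_on_scaleR smooth_on_const 1 assms(1))
qed

lemma smooth_on_frechet_derivative_compose:
  assumes "open S" "smooth_on f S" "open T" "g ` T \<subseteq> S" "smooth_on g T" "smooth_on v T"
  shows "smooth_on (\<lambda>x. frechet_derivative f (at (g x)) (v x)) T"
proof -
  have eq: "frechet_derivative f (at (g x)) (v x) = (\<Sum>b\<in>Basis. (v x \<bullet> b) *\<^sub>R frechet_derivative f (at (g x)) b)" if "x \<in> T" for x
  proof -
    have "linear (frechet_derivative f (at (g x)))"
      using smooth_on_has_derivative[OF assms(1,2)] has_derivative_linear that assms(4) by blast
    then show ?thesis
      by (rule linear_Basis_expansion)
  qed
  have "smooth_on (\<lambda>x. frechet_derivative f (at (g x)) b) T" for b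
    by (rule smooth_on_compose[OF assms(3,1,4,5) smooth_on_frechet_derivative[OF assms(1,2)]])
  then have "smooth_on (\<lambda>x. \<Sum>b\<in>Basis. (v x \<bullet> b) *\<^sub>R frechet_derivative f (at (g x)) b) T"
    by (intro smooth_on_sum smooth_on_scaleR smooth_on_inner smooth_on_const assms)
  then show ?thesis
    by (subst smooth_on_cong[OF assms(3) eq])
qed

text \<open>A coinduction principle: in a family closed under directional derivatives every member
  can be differentiated forever. It serves for holomorphic functions of several variables, entire
  functions and iterated antiderivatives.\<close>

lemma smooth_onI:
  assumes "open S" "\<And>f. f \<in> F \<Longrightarrow> \<exists>f'. (\<forall>x\<in>S. (f has_derivative f' x) (at x)) \<and> (\<forall>b\<in>Basis. (\<lambda>x. f' x b) \<in> F)"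
    and "f \<in> F"
  shows "smooth_on f S"
proof -
  have "C_diff n f S" if "f \<in> F" for n f
    using that
  proof (induction n arbitrary: f)
    case 0
    then obtain f' where "\<forall>x\<in>S. (f has_derivative f' x) (at x)"
      using assms(2) by blast
    then show ?case
      by (auto intro!: continuous_at_imp_continuous_on dest: has_derivative_continuous)
  next
    case (Suc n)
    then obtain f' where "\<forall>x\<in>S. (f has_derivative f' x) (at x)" "\<forall>b\<in>Basis. (\<lambda>x. f' x b) \<in> F"
      using assms(2) by blast
    then show ?case using Suc.IH assms(1) by (intro C_diff_SucI) auto
  qed
  then show ?thesis using assms(3) unfolding smooth_on_def by blast
qed

section \<open>Holomorphic functions of several variables\<close>

lemma norm_cscale: "norm (cscale c v) = cmod c * norm v"
proof -
  have "norm (c *s x) = cmod c * norm x" for x :: "complex^2"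
    unfolding norm_vec_def L2_set_def
    by (simp add: norm_mult power_mult_distrib sum_distrib_left[symmetric] real_sqrt_mult)
  then show ?thesis
    by (simp add: cscale_def norm_prod_def power_mult_distrib distrib_left[symmetric] real_sqrt_mult)
qed

lemma bounded_bilinear_cscale: "bounded_bilinear cscale"
proof
  show "\<exists>K. \<forall>a b. norm (cscale a b) \<le> norm a * norm b * K"
    by (rule exI[of _ 1]) (simp add: norm_cscale)
qed (auto simp: cscale_def vector_scalar_mult_def vec_eq_iff distrib_right distrib_left scaleR_conv_of_real[where 'a=complex])

lemmas cscale_simps = bounded_bilinear.zero_left[OF bounded_bilinear_cscale] bounded_bilinear.zero_right[OF bounded_bilinear_cscale]
  bounded_bilinear.add_left[OF bounded_bilinear_cscale] bounded_bilinear.add_right[OF bounded_bilinear_cscale]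

lemma cscale_cscale: "cscale a (cscale b v) = cscale (a * b) v"
  by (simp add: cscale_def vec_eq_iff)

lemma holomorphic4_on_has_derivative:
  assumes "holomorphic4_on f S" "\<rho> \<in> S"
  shows "(f has_derivative frechet_derivative f (at \<rho>)) (at \<rho>)"
    and "frechet_derivative f (at \<rho>) (cscale c v) = c * frechet_derivative f (at \<rho>) v"
proof -
  obtain L where L: "(f has_derivative L) (at \<rho>)" "\<And>c v. L (cscale c v) = c * L v"
    using assms unfolding holomorphic4_on_def by blast
  have "L = frechet_derivative f (at \<rho>)"
    using frechet_derivative_at[OF L(1)] .
  with L show "(f has_derivative frechet_derivative f (at \<rho>)) (at \<rho>)"
    and "frechet_derivative f (at \<rho>) (cscale c v) = c * frechet_derivative f (at \<rho>) v"
    by auto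
qed

text \<open>Complex linearity of the derivative makes the restriction to a complex line holomorphic
  in the classical sense, which opens the way to one-variable Cauchy theory.\<close>

lemma holomorphic4_on_line:
  assumes "holomorphic4_on f S" "\<rho> + cscale w v \<in> S"
  shows "((\<lambda>w. f (\<rho> + cscale w v)) has_field_derivative frechet_derivative f (at (\<rho> + cscale w v)) v) (at w)"
proof -
  have lin: "bounded_linear (\<lambda>w. cscale w v)"
    using bounded_bilinear.bounded_linear_left[OF bounded_bilinear_cscale] .
  have 1: "((\<lambda>w. \<rho> + cscale w v) has_derivative (\<lambda>h. cscale h v)) (at w)"
    by (auto intro!: derivative_eq_intros bounded_linear.has_derivative[OF lin])
  have "((\<lambda>w. f (\<rho> + cscale w v)) has_derivative (\<lambda>h. frechet_derivative f (at (\<rho> + cscale w v)) (cscale h v))) (at w)"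
    using diff_chain_at[OF 1 holomorphic4_on_has_derivative(1)[OF assms]] by (simp add: o_def)
  then show ?thesis
    unfolding has_field_derivative_def holomorphic4_on_has_derivative(2)[OF assms] by (simp add: mult_commute_abs)
qed

text \<open>Parametrizing the circle cancels \<open>2 * pi * \<i>\<close> and one of the two powers
  in the denominator of Cauchy's formula. What remains is an ordinary integral over a fixed
  interval, ready for continuity and differentiation in parameters.\<close>

lemma Cauchy_derivative_circle:
  assumes "continuous_on (cball 0 t) g" "g holomorphic_on ball 0 t" "t > 0"
    and "(g has_field_derivative g') (at 0)"
  shows "((\<lambda>x. g (of_real t * exp (2 * of_real pi * \<i> * of_real x)) / (of_real t * exp (2 * of_real pi * \<i> * of_real x)))
    has_integral g') {0..1}"
proof -
  define I where "I = contour_integral (circlepath 0 t) (\<lambda>u. g u / (u - 0)\<^sup>2)"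
  have z: "0 \<in> ball (0::complex) t" using assms(3) by simp
  have "((\<lambda>u. g u / (u - 0)\<^sup>2) has_contour_integral I) (circlepath 0 t)"
    unfolding I_def by (rule has_contour_integral_integral[OF Cauchy_derivative_integral_circlepath(1)[OF assms(1,2) z]])
  then have 1: "((\<lambda>x. g (circlepath 0 t x) / (circlepath 0 t x - 0)\<^sup>2 * vector_derivative (circlepath 0 t) (at x within {0..1}))
            has_integral I) {0..1}"
    unfolding has_contour_integral_def .
  have "(g has_field_derivative 1 / (2 * of_real pi * \<i>) * I) (at 0)"
    unfolding I_def by (rule Cauchy_derivative_integral_circlepath(2)[OF assms(1,2) z])
  then have g': "g' = 1 / (2 * of_real pi * \<i>) * I"
    using DERIV_unique assms(4) by blast
  have 2: "((\<lambda>x. 1 / (2 * of_real pi * \<i>) * (g (circlepath 0 t x) / (circlepath 0 t x - 0)\<^sup>2 * vector_derivative (circlepath 0 t) (at x within {0..1})))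
            has_integral g') {0..1}"
    unfolding g' by (rule has_integral_mult_right[OF 1])
  show ?thesis
  proof (rule has_integral_eq[OF _ 2])
    fix x :: real assume "x \<in> {0..1}"
    then have "vector_derivative (circlepath 0 t) (at x within {0..1}) = 2 * pi * \<i> * t * exp(2 * of_real pi * \<i> * x)"
      by (intro vector_derivative_circlepath01) auto
    then show "1 / (2 * of_real pi * \<i>) * (g (circlepath 0 t x) / (circlepath 0 t x - 0)\<^sup>2 * vector_derivative (circlepath 0 t) (at x within {0..1})) =
       g (of_real t * exp (2 * of_real pi * \<i> * of_real x)) / (of_real t * exp (2 * of_real pi * \<i> * of_real x))"
      using assms(3) by (simp add: circlepath power2_eq_square)
  qed
qed

lemma holomorphic4_on_continuous: "holomorphic4_on f S \<Longrightarrow> continuous_on S f"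
  by (auto intro!: continuous_at_imp_continuous_on dest: has_derivative_continuous[OF holomorphic4_on_has_derivative(1)])

text \<open>Cauchy's formula on small complex circles expresses the derivative by an integral of values, so that
  differentiation under the integral sign shows the derivative to be holomorphic again.\<close>

lemma holomorphic4_on_frechet_derivative:
  assumes "open S" "holomorphic4_on f S"
  shows "holomorphic4_on (\<lambda>\<rho>. frechet_derivative f (at \<rho>) v) S"
proof -
  let ?D = "\<lambda>\<rho>. frechet_derivative f (at \<rho>)"
  define e :: "real \<Rightarrow> complex" where "e x = exp (2 * of_real pi * \<i> * of_real x)" for x
  have e: "continuous_on A e" "cmod (e x) = 1" "e x \<noteq> 0" for A x
    unfolding e_def by (auto intro!: continuous_intros)
  \<comment> \<open>One radius \<open>t\<close> for all base points in a ball around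
    \<open>\<rho>0\<close>: the integral formula must hold on a neighbourhood before it can be
    differentiated in \<rho>.\<close>
  have loc: "\<exists>d>0. \<exists>t>0. ball \<rho>0 d \<subseteq> S \<and> (\<forall>\<rho>\<in>ball \<rho>0 d. \<forall>x. \<rho> + cscale (of_real t * e x) v \<in> S) \<and>
       (\<forall>\<rho>\<in>ball \<rho>0 d. ((\<lambda>x. f (\<rho> + cscale (of_real t * e x) v) / (of_real t * e x)) has_integral ?D \<rho> v) {0..1})"
    if "\<rho>0 \<in> S" for \<rho>0 v
  proof -
    obtain d' where "d' > 0" "ball \<rho>0 d' \<subseteq> S"
      using openE[OF assms(1) \<open>\<rho>0 \<in> S\<close>] .
    then obtain d where d: "d > 0" "ball \<rho>0 (2 * d) \<subseteq> S"
      by (rule_tac that[of "d' / 2"]) auto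
    define t where "t = d / (norm v + 1)"
    have t: "t > 0" "t * norm v < d"
      using d(1) by (auto simp: t_def divide_simps add_nonneg_pos add_pos_nonneg intro!: mult_strict_left_mono)
    have inS: "\<rho> + cscale w v \<in> S" if "\<rho> \<in> ball \<rho>0 d" "cmod w \<le> t" for \<rho> w
    proof -
      have "norm (cscale w v) \<le> t * norm v"
        unfolding norm_cscale using that(2) by (simp add: mult_right_mono)
      then have "dist \<rho>0 (\<rho> + cscale w v) < 2 * d"
        using that(1) t(2) dist_triangle[of \<rho>0 "\<rho> + cscale w v" \<rho>] by (simp add: dist_norm)
      then show ?thesis using d(2) by auto
    qed
    have "((\<lambda>x. f (\<rho> + cscale (of_real t * e x) v) / (of_real t * e x)) has_integral ?D \<rho> v) {0..1}" if \<rho>: "\<rho> \<in> ball \<rho>0 d" for \<rho>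
    proof -
      have der: "((\<lambda>w. f (\<rho> + cscale w v)) has_field_derivative ?D (\<rho> + cscale w v) v) (at w)" if "cmod w \<le> t" for w
        using holomorphic4_on_line[OF assms(2) inS[OF \<rho> that]] .
      have "continuous_on (cball 0 t) (\<lambda>w. f (\<rho> + cscale w v))"
        by (auto intro!: continuous_at_imp_continuous_on DERIV_isCont[OF der])
      moreover have "(\<lambda>w. f (\<rho> + cscale w v)) holomorphic_on ball 0 t"
        unfolding holomorphic_on_def field_differentiable_def
      proof
        fix w :: complex assume "w \<in> ball 0 t"
        then have "cmod w \<le> t" by simp
        from has_field_derivative_at_within[OF der[OF this]]
        show "\<exists>f'. ((\<lambda>w. f (\<rho> + cscale w v)) has_field_derivative f') (at w within ball 0 t)" by blast
      qed
      moreover have "((\<lambda>w. f (\<rho> + cscale w v)) has_field_derivative ?D \<rho> v) (at 0)"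
        using der[of 0] t(1) by (simp add: cscale_simps)
      ultimately show ?thesis
        using Cauchy_derivative_circle[of t "\<lambda>w. f (\<rho> + cscale w v)"] t(1) unfolding e_def by simp
    qed
    moreover have "ball \<rho>0 d \<subseteq> S" using d by auto
    moreover have "\<rho> + cscale (of_real t * e x) v \<in> S" if "\<rho> \<in> ball \<rho>0 d" for \<rho> x
      using inS[OF that, of "of_real t * e x"] e(2) t(1) by (simp add: norm_mult)
    ultimately show ?thesis using d(1) t(1) by blast
  qed
  have shift: "continuous_on (B \<times> A) (\<lambda>(\<rho>, x). \<rho> + cscale (of_real t * e x) v)" for A B t v
    unfolding split_beta
    by (intro continuous_intros bounded_bilinear.continuous_on[OF bounded_bilinear_cscale] 
        continuous_on_compose2[OF e(1)[of UNIV]]) auto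
  have comp: "continuous_on (B \<times> A) (\<lambda>x. G (fst x + cscale (of_real t * e (snd x)) v))"
    if "continuous_on S G" "\<And>\<rho> x. \<rho> \<in> B \<Longrightarrow> \<rho> + cscale (of_real t * e x) v \<in> S" for G :: "C4 \<Rightarrow> 'z::topological_space" and A B t v
    by (rule continuous_on_compose2[OF that(1) shift[of B A t v, unfolded split_beta]]) (use that(2) in auto)
  have circ: "continuous_on (B \<times> A) (\<lambda>x. of_real t * e (snd x))" for t and A :: "real set" and B :: "C4 set"
    by (intro continuous_intros continuous_on_compose2[OF e(1)[of UNIV]]) auto
  note fcont = holomorphic4_on_continuous[OF assms(2)]
  \<comment> \<open>Continuity of the partial derivatives comes before their differentiability,
    because the Leibniz rule below requires the derivative of the integrand to be jointly
    continuous.\<close>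
  have cont: "continuous_on S (\<lambda>\<rho>. ?D \<rho> u)" for u
  proof (rule continuous_at_imp_continuous_on, rule ballI)
    fix \<rho>0 assume "\<rho>0 \<in> S"
    then obtain d t where d: "d > 0" "t > 0" "ball \<rho>0 d \<subseteq> S" 
      and inS: "\<And>\<rho> x. \<rho> \<in> ball \<rho>0 d \<Longrightarrow> \<rho> + cscale (of_real t * e x) u \<in> S"
      and int: "\<And>\<rho>. \<rho> \<in> ball \<rho>0 d \<Longrightarrow> ((\<lambda>x. f (\<rho> + cscale (of_real t * e x) u) / (of_real t * e x)) has_integral ?D \<rho> u) {0..1}"
      using loc[of \<rho>0 u] by blast
    have "continuous_on (ball \<rho>0 d \<times> cbox 0 1) (\<lambda>(\<rho>, x). f (\<rho> + cscale (of_real t * e x) u) / (of_real t * e x))"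
      using d(2) e(3) unfolding split_beta
      by (intro continuous_on_divide comp[OF fcont inS] circ) auto
    then have "continuous_on (ball \<rho>0 d) (\<lambda>\<rho>. integral (cbox 0 1) (\<lambda>x. f (\<rho> + cscale (of_real t * e x) u) / (of_real t * e x)))"
      by (rule integral_continuous_on_param)
    moreover have "integral (cbox 0 1) (\<lambda>x. f (\<rho> + cscale (of_real t * e x) u) / (of_real t * e x)) = ?D \<rho> u" if "\<rho> \<in> ball \<rho>0 d" for \<rho>
      using int[OF that] by (simp add: integral_unique)
    ultimately have "continuous_on (ball \<rho>0 d) (\<lambda>\<rho>. ?D \<rho> u)"
      by (rule continuous_on_eq)
    then show "isCont (\<lambda>\<rho>. ?D \<rho> u) \<rho>0"
      using d(1) by (simp add: continuous_on_eq_continuous_at)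
  qed
  \<comment> \<open>The Leibniz rule wants the derivative as a continuous map into the bounded
    linear functions; in finite dimensions continuity of each component is enough.\<close>
  define DD where "DD \<rho> = Blinfun (?D \<rho>)" for \<rho>
  have DD: "blinfun_apply (DD \<rho>) = ?D \<rho>" if "\<rho> \<in> S" for \<rho>
    unfolding DD_def
    using holomorphic4_on_has_derivative(1)[OF assms(2) that] has_derivative_bounded_linear bounded_linear_Blinfun_apply by blast
  have contDD: "continuous_on S DD"
    by (rule continuous_on_blinfun_componentwise) (use cont DD in \<open>simp cong: continuous_on_cong\<close>)
  show ?thesis
    unfolding holomorphic4_on_def
  proof
    fix \<rho>0 assume \<rho>0: "\<rho>0 \<in> S"
    then obtain d t where d: "d > 0" "t > 0" "ball \<rho>0 d \<subseteq> S" 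
      and inS: "\<And>\<rho> x. \<rho> \<in> ball \<rho>0 d \<Longrightarrow> \<rho> + cscale (of_real t * e x) v \<in> S"
      and int: "\<And>\<rho>. \<rho> \<in> ball \<rho>0 d \<Longrightarrow> ((\<lambda>x. f (\<rho> + cscale (of_real t * e x) v) / (of_real t * e x)) has_integral ?D \<rho> v) {0..1}"
      using loc[of \<rho>0 v] by blast
    define F where "F \<rho> x = f (\<rho> + cscale (of_real t * e x) v) / (of_real t * e x)" for \<rho> x
    define F' where "F' \<rho> x = blinfun_mult_right (1 / (of_real t * e x)) o\<^sub>L DD (\<rho> + cscale (of_real t * e x) v)" for \<rho> x
    have F': "blinfun_apply (F' \<rho> x) u = ?D (\<rho> + cscale (of_real t * e x) v) u / (of_real t * e x)" if "\<rho> \<in> ball \<rho>0 d" for \<rho> x u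
      unfolding F'_def by (simp add: DD[OF inS[OF that]])
    have contF: "continuous_on (ball \<rho>0 d \<times> cbox 0 1) (\<lambda>(\<rho>, x). F \<rho> x)"
      using d(2) e(3) unfolding split_beta F_def
      by (intro continuous_on_divide comp[OF fcont inS] circ) auto
    have contF': "continuous_on (ball \<rho>0 d \<times> cbox 0 1) (\<lambda>(\<rho>, x). F' \<rho> x)"
      using d(2) e(3) unfolding split_beta F'_def
      by (intro bounded_bilinear.continuous_on[OF bounded_bilinear_blinfun_compose] comp[OF contDD inS]
          bounded_linear.continuous_on[OF bounded_linear_blinfun_mult_right] continuous_on_divide circ continuous_on_const) auto
    have slice: "continuous_on (cbox 0 1) (F \<rho>)" "continuous_on (cbox 0 1) (F' \<rho>)" if "\<rho> \<in> ball \<rho>0 d" for \<rho>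
    proof -
      have P: "continuous_on (cbox 0 1) (Pair \<rho>)" "Pair \<rho> ` cbox 0 1 \<subseteq> ball \<rho>0 d \<times> cbox 0 1"
        using that by (auto intro!: continuous_intros)
      show "continuous_on (cbox 0 1) (F \<rho>)" using continuous_on_compose2[OF contF P] by simp
      show "continuous_on (cbox 0 1) (F' \<rho>)" using continuous_on_compose2[OF contF' P] by simp
    qed
    have "((\<lambda>\<rho>. integral (cbox 0 1) (F \<rho>)) has_derivative integral (cbox 0 1) (F' \<rho>0)) (at \<rho>0 within ball \<rho>0 d)"
    proof (rule leibniz_rule[OF _ _ contF'])
      fix \<rho> x assume \<rho>: "\<rho> \<in> ball \<rho>0 d"
      have "((\<lambda>\<rho>. f (\<rho> + cscale (of_real t * e x) v)) has_derivative ?D (\<rho> + cscale (of_real t * e x) v)) (at \<rho>)"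
        by (rule has_derivative_compose[of "\<lambda>\<rho>. \<rho> + cscale (of_real t * e x) v" "\<lambda>h. h" \<rho> UNIV f,
            OF _ holomorphic4_on_has_derivative(1)[OF assms(2) inS[OF \<rho>]]])
          (auto intro!: derivative_eq_intros)
      then have "((\<lambda>\<rho>. F \<rho> x) has_derivative (\<lambda>h. ?D (\<rho> + cscale (of_real t * e x) v) h / (of_real t * e x))) (at \<rho>)"
        unfolding F_def divide_inverse by (rule has_derivative_mult_left)
      moreover have "blinfun_apply (F' \<rho> x) = (\<lambda>h. ?D (\<rho> + cscale (of_real t * e x) v) h / (of_real t * e x))"
        by (rule ext) (rule F'[OF \<rho>])
      ultimately show "((\<lambda>\<rho>. F \<rho> x) has_derivative blinfun_apply (F' \<rho> x)) (at \<rho> within ball \<rho>0 d)"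
        by (simp add: has_derivative_at_withinI)
    next
      fix \<rho> assume "\<rho> \<in> ball \<rho>0 d"
      then show "F \<rho> integrable_on cbox 0 1" using integrable_continuous[OF slice(1)] by blast
    qed (use d(1) in auto)
    note der = this
    have "integral (cbox 0 1) (F \<rho>) = ?D \<rho> v" if "\<rho> \<in> ball \<rho>0 d" for \<rho>
      using int[OF that] unfolding F_def by (simp add: integral_unique)
    then have "((\<lambda>\<rho>. ?D \<rho> v) has_derivative integral (cbox 0 1) (F' \<rho>0)) (at \<rho>0 within ball \<rho>0 d)"
      by (intro has_derivative_transform[OF _ _ der]) (use d(1) in simp_all)
    moreover have "at \<rho>0 within ball \<rho>0 d = at \<rho>0"
      using d(1) by (intro at_within_open) auto
    ultimately have "((\<lambda>\<rho>. ?D \<rho> v) has_derivative integral (cbox 0 1) (F' \<rho>0)) (at \<rho>0)"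
      by simp
    moreover have "blinfun_apply (integral (cbox 0 1) (F' \<rho>0)) (cscale c u) = c * blinfun_apply (integral (cbox 0 1) (F' \<rho>0)) u" for c u
    proof -
      have \<rho>0': "\<rho>0 \<in> ball \<rho>0 d" using d(1) by simp
      have int: "F' \<rho>0 integrable_on cbox 0 1"
        using slice(2)[OF \<rho>0'] by (rule integrable_continuous)
      show ?thesis
        unfolding blinfun_apply_integral[OF int] F'[OF \<rho>0'] holomorphic4_on_has_derivative(2)[OF assms(2) inS[OF \<rho>0']]
        by (simp add: integral_mult_right[symmetric])
    qed
    ultimately show "\<exists>L. ((\<lambda>\<rho>. ?D \<rho> v) has_derivative L) (at \<rho>0) \<and> (\<forall>c u. L (cscale c u) = c * L u)"
      by blast
  qed
qed

lemma holomorphic4_on_smooth: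
  assumes "open S" "holomorphic4_on f S"
  shows "smooth_on f S"
proof (rule smooth_onI[where F = "{f. holomorphic4_on f S}"])
  fix f assume "f \<in> {f. holomorphic4_on f S}"
  then show "\<exists>f'. (\<forall>x\<in>S. (f has_derivative f' x) (at x)) \<and> (\<forall>b\<in>Basis. (\<lambda>x. f' x b) \<in> {f. holomorphic4_on f S})"
    using holomorphic4_on_has_derivative(1) holomorphic4_on_frechet_derivative[OF assms(1)]
    by (intro exI[of _ "\<lambda>x. frechet_derivative f (at x)"]) auto
qed (use assms in auto)

section \<open>Smooth dependence of fixed points\<close>

text \<open>Implicit differentiation. The partial derivative of \<open>T\<close> in the second slot
  has norm at most 1/2, so the identity minus it is bounded below by 1/2, hence invertible, and
  \<open>u'\<close> is found by solving the differentiated equation. Continuity of \<open>u\<close>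
  is assumed at the one point only; differentiability is a conclusion.\<close>

lemma fixed_point_has_derivative:
  fixes T :: "'a::euclidean_space \<times> 'b::euclidean_space \<Rightarrow> 'b"
  assumes T: "(T has_derivative T') (at (x0, u x0))" and "isCont u x0" "open S" "x0 \<in> S"
    and fp: "\<And>x. x \<in> S \<Longrightarrow> u x = T (x, u x)" and contr: "\<And>w. norm (T' (0, w)) \<le> 1 / 2 * norm w"
  shows "\<exists>u'. (u has_derivative u') (at x0) \<and> (\<forall>v. u' v = T' (v, u' v))"
proof -
  define L where "L w = w - T' (0, w)" for w
  have linT: "linear T'" using T has_derivative_linear by blast
  have split: "T' (v, w) = T' (v, 0) + T' (0, w)" for v w
    using linear_add[OF linT, of "(v, 0)" "(0, w)"] by simp
  have "linear (\<lambda>w. T' (0, w))"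
    using linear_compose[OF _ linT, of "\<lambda>w. (0, w)"] by (simp add: o_def linear_iff)
  then have linL: "linear L"
    unfolding L_def[abs_def] by (intro linear_compose_sub linear_id[unfolded id_def]) auto
  have L_ge: "norm (L w) \<ge> norm w / 2" for w
    using norm_triangle_ineq2[of w "T' (0, w)"] contr[of w] unfolding L_def by simp
  have "inj L"
    unfolding linear_injective_0[OF linL]
  proof (intro allI impI)
    fix w assume "L w = 0"
    then show "w = 0" using L_ge[of w] by simp
  qed
  then have "surj L" using linL linear_injective_imp_surjective by blast
  then obtain M where M: "linear M" "L \<circ> M = id"
    using linear_surjective_right_inverse[OF linL] by blast
  define u' where "u' v = M (T' (v, 0))" for v
  have "linear (\<lambda>v. T' (v, 0))"
    using linear_compose[OF _ linT, of "\<lambda>w. (w, 0)"] by (simp add: o_def linear_iff)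
  then have linu': "linear u'"
    unfolding u'_def[abs_def] using linear_compose[OF _ M(1)] by (simp add: o_def)
  have u'fp: "L (u' v) = T' (v, 0)" for v
    using M(2) unfolding u'_def by (metis comp_apply id_apply)
  then have u'eq: "u' v = T' (v, u' v)" for v
    using split[of v "u' v"] unfolding L_def by (metis add.commute diff_eq_eq)
  obtain k where k: "k > 0" "\<And>v. norm (u' v) \<le> k * norm v"
    using linear_bounded_pos[OF linu'] by (metis mult.commute)
  have "(u has_derivative u') (at x0)"
    unfolding has_derivative_at_alt
  proof (intro conjI allI impI)
    show "bounded_linear u'" using linu' linear_conv_bounded_linear by blast
    fix e :: real assume e: "e > 0"
    \<comment> \<open>The bound 1/4 lets the term \<open>e1 * norm r\<close> be absorbed into
      \<open>norm r / 2\<close> on the left. This costs a factor 4, which the second bound provides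
      for.\<close>
    define e1 where "e1 = min (1 / 4) (e / (4 * (1 + k)))"
    have e1: "e1 > 0" "e1 \<le> 1 / 4" "4 * e1 * (1 + k) \<le> e"
    proof -
      show "e1 > 0" using e k(1) by (simp add: e1_def)
      show "e1 \<le> 1 / 4" unfolding e1_def by (rule min.cobounded1)
      have "e1 \<le> e / (4 * (1 + k))" by (simp add: e1_def)
      then show "4 * e1 * (1 + k) \<le> e" using k(1) by (simp add: pos_le_divide_eq algebra_simps)
    qed
    obtain d1 where d1: "d1 > 0" "\<And>y. norm (y - (x0, u x0)) < d1 \<Longrightarrow>
        norm (T y - T (x0, u x0) - T' (y - (x0, u x0))) \<le> e1 * norm (y - (x0, u x0))"
      using T e1(1) unfolding has_derivative_at_alt by blast
    obtain d2 where d2: "d2 > 0" "\<And>x. dist x x0 < d2 \<Longrightarrow> dist (u x) (u x0) < d1 / 2"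
      using \<open>isCont u x0\<close> d1(1) unfolding continuous_at_eps_delta by (meson half_gt_zero dist_norm)
    obtain d3 where d3: "d3 > 0" "ball x0 d3 \<subseteq> S"
      using openE[OF assms(3,4)] by blast
    show "\<exists>d>0. \<forall>y. norm (y - x0) < d \<longrightarrow> norm (u y - u x0 - u' (y - x0)) \<le> e * norm (y - x0)"
    proof (intro exI conjI allI impI)
      show "0 < min (d1 / 2) (min d2 d3)" using d1 d2 d3 by simp
      fix y assume y: "norm (y - x0) < min (d1 / 2) (min d2 d3)"
      define h where "h = y - x0"
      define \<delta> where "\<delta> = u y - u x0"
      define r where "r = \<delta> - u' h"
      have yS: "y \<in> S" using y d3(2) by (auto simp: dist_norm norm_minus_commute)
      have "norm \<delta> < d1 / 2" using d2(2)[of y] y by (simp add: \<delta>_def dist_norm)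
      then have "norm ((y, u y) - (x0, u x0)) < d1"
        using y norm_Pair_le[of h \<delta>] by (simp add: h_def \<delta>_def)
      from d1(2)[OF this] have 1: "norm (\<delta> - T' (h, \<delta>)) \<le> e1 * norm (h, \<delta>)"
        using fp[OF yS] fp[OF assms(4)] by (simp add: h_def \<delta>_def)
      \<comment> \<open>By the choice of \<open>u'\<close> the linear terms cancel, so
        \<open>L r\<close> is exactly the remainder in the linearization of
        \<open>T\<close>.\<close>
      have "L r = L \<delta> - T' (h, 0)"
        unfolding r_def linear_diff[OF linL] u'fp ..
      then have "L r = \<delta> - T' (h, \<delta>)"
        using split[of h \<delta>] by (simp add: L_def)
      then have "norm r / 2 \<le> e1 * norm (h, \<delta>)"
        using 1 L_ge[of r] by simp
      also have "\<dots> \<le> e1 * (norm h + norm \<delta>)"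
        using e1(1) norm_Pair_le by (intro mult_left_mono) auto
      also have "\<dots> \<le> e1 * (norm h + (norm r + k * norm h))"
      proof -
        have "norm \<delta> \<le> norm r + norm (u' h)" using norm_triangle_ineq[of r "u' h"] by (simp add: r_def)
        then show ?thesis using k(2)[of h] e1(1) by (intro mult_left_mono) auto
      qed
      also have "\<dots> = e1 * (1 + k) * norm h + e1 * norm r" by (simp add: algebra_simps)
      also have "\<dots> \<le> e1 * (1 + k) * norm h + 1 / 4 * norm r"
        using e1(2) by (intro add_left_mono mult_right_mono) auto
      finally have "norm r \<le> 4 * e1 * (1 + k) * norm h" by simp
      also have "\<dots> \<le> e * norm h" using e1(3) by (intro mult_right_mono) auto
      finally show "norm (u y - u x0 - u' (y - x0)) \<le> e * norm (y - x0)"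
        by (simp add: r_def \<delta>_def h_def)
    qed
  qed
  with u'eq show ?thesis by blast
qed

text \<open>The linear map is given by its columns \<open>B c\<close>. Differentiating the equation
  shows that the derivative of \<open>u\<close> solves an equation with the same \<open>B\<close>
  and a new inhomogeneity made of \<open>Dv\<close>, \<open>DB\<close> and \<open>u\<close>. The
  bound concerns \<open>B\<close> alone, so it persists and the induction closes.\<close>

lemma C_diff_linear_fixed_point:
  fixes u :: "'a::euclidean_space \<Rightarrow> 'b::euclidean_space"
  assumes "open S" "\<And>c. c \<in> Basis \<Longrightarrow> C_diff n (B c) S" "C_diff n v S"
    and "\<And>x. x \<in> S \<Longrightarrow> u x = v x + (\<Sum>c\<in>Basis. (u x \<bullet> c) *\<^sub>R B c x)"
    and bound: "\<And>x w. x \<in> S \<Longrightarrow> norm (\<Sum>c\<in>Basis. (w \<bullet> c) *\<^sub>R B c x) \<le> 1 / 2 * norm w"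
  shows "C_diff n u S"
  using assms(2-4)
proof (induction n arbitrary: u v)
  case 0
  note eq = "0.prems"(3)
  have "isCont u x0" if x0: "x0 \<in> S" for x0
  proof -
    \<comment> \<open>\<open>g\<close> is the change of the equation with \<open>u x0\<close>
      frozen. The rest of the increment is \<open>B\<close> applied to the increment itself and is
      absorbed by the bound 1/2, which gives the factor 2 below.\<close>
    define g where "g x = v x - v x0 + (\<Sum>c\<in>Basis. (u x0 \<bullet> c) *\<^sub>R (B c x - B c x0))" for x
    have "norm (u x - u x0) \<le> 2 * norm (g x)" if "x \<in> S" for x
    proof -
      let ?w = "u x - u x0"
      have A: "(\<Sum>c\<in>Basis. (?w \<bullet> c) *\<^sub>R B c x) = (\<Sum>c\<in>Basis. (u x \<bullet> c) *\<^sub>R B c x) - (\<Sum>c\<in>Basis. (u x0 \<bullet> c) *\<^sub>R B c x)"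
        by (simp add: inner_diff_left scaleR_diff_left sum_subtractf)
      have B: "(\<Sum>c\<in>Basis. (u x0 \<bullet> c) *\<^sub>R (B c x - B c x0)) = (\<Sum>c\<in>Basis. (u x0 \<bullet> c) *\<^sub>R B c x) - (\<Sum>c\<in>Basis. (u x0 \<bullet> c) *\<^sub>R B c x0)"
        by (simp add: scaleR_diff_right sum_subtractf)
      have abs: "a - a0 = (w - w0 + (p2 - p3)) + (p1 - p2)" if "a = w + p1" "a0 = w0 + p3" for a a0 w w0 p1 p2 p3 :: 'b
        using that by simp
      have "?w = g x + (\<Sum>c\<in>Basis. (?w \<bullet> c) *\<^sub>R B c x)"
        unfolding g_def A B by (rule abs[OF eq[OF that] eq[OF x0]])
      then have "norm ?w \<le> norm (g x) + norm (\<Sum>c\<in>Basis. (?w \<bullet> c) *\<^sub>R B c x)"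
        by (metis norm_triangle_ineq)
      then show ?thesis using bound[OF that, of ?w] by simp
    qed
    then have ev: "\<forall>\<^sub>F x in at x0. norm (u x - u x0) \<le> 2 * norm (g x)"
      using assms(1) x0 by (auto simp: eventually_at_topological)
    have "isCont v x0" "\<And>c. c \<in> Basis \<Longrightarrow> isCont (B c) x0"
      using "0.prems"(1,2) assms(1) x0 by (auto simp: continuous_on_eq_continuous_at)
    then have "isCont g x0"
      unfolding g_def by (intro continuous_intros) auto
    then have "(g \<longlongrightarrow> 0) (at x0)" using isContD[of x0 g] by (simp add: g_def)
    then have "((\<lambda>x. 2 * norm (g x)) \<longlongrightarrow> 0) (at x0)"
      using tendsto_mult_right_zero tendsto_norm_zero by blast
    then have "((\<lambda>x. u x - u x0) \<longlongrightarrow> 0) (at x0)"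
      using Lim_null_comparison[OF ev] by blast
    then show ?thesis by (simp add: isCont_def LIM_zero_iff)
  qed
  then show ?case by (simp add: continuous_at_imp_continuous_on)
next
  case (Suc n)
  have Cu: "C_diff n u S"
    by (rule Suc.IH[OF C_diff_mono_Suc C_diff_mono_Suc]) (use Suc.prems in auto)
  then have "continuous_on S u" using C_diff_mono[of n u S 0] by simp
  then have contu: "isCont u x" if "x \<in> S" for x
    using that assms(1) by (simp add: continuous_on_eq_continuous_at)
  let ?Dv = "\<lambda>x. frechet_derivative v (at x)"
  let ?DB = "\<lambda>c x. frechet_derivative (B c) (at x)"
  have Dv: "(v has_derivative ?Dv x) (at x)" if "x \<in> S" for x
    using C_diff_has_derivative[OF assms(1) Suc.prems(2) that] .
  have DB: "(B c has_derivative ?DB c x) (at x)" if "x \<in> S" "c \<in> Basis" for c x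
    using C_diff_has_derivative[OF assms(1) Suc.prems(1)[OF that(2)] that(1)] .
  define T where "T y = v (fst y) + (\<Sum>c\<in>Basis. (snd y \<bullet> c) *\<^sub>R B c (fst y))" for y
  define T' where "T' x w y = ?Dv x (fst y) + (\<Sum>c\<in>Basis. (w \<bullet> c) *\<^sub>R ?DB c x (fst y) + (snd y \<bullet> c) *\<^sub>R B c x)" for x w y
  have "\<exists>u'. (u has_derivative u') (at x) \<and> (\<forall>h. u' h = T' x (u x) (h, u' h))" if x: "x \<in> S" for x
  proof (rule fixed_point_has_derivative[OF _ contu[OF x] assms(1) x])
    have "((\<lambda>y. v (fst y)) has_derivative (\<lambda>y. ?Dv x (fst y))) (at (x, w))" for w :: 'b
      by (rule has_derivative_compose[OF has_derivative_fst[OF has_derivative_ident]]) (use Dv[OF x] in simp)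
    moreover have "((\<lambda>y. B c (fst y)) has_derivative (\<lambda>y. ?DB c x (fst y))) (at (x, w))" if "c \<in> Basis" for c and w :: 'b
      by (rule has_derivative_compose[OF has_derivative_fst[OF has_derivative_ident]]) (use DB[OF x that] in simp)
    ultimately show "(T has_derivative T' x (u x)) (at (x, u x))"
      unfolding T_def[abs_def] T'_def[abs_def]
      by (auto intro!: derivative_eq_intros)
    show "u y = T (y, u y)" if "y \<in> S" for y using Suc.prems(3)[OF that] by (simp add: T_def)
    fix w :: 'b
    have "?Dv x 0 = 0" "\<And>c. c \<in> Basis \<Longrightarrow> ?DB c x 0 = 0"
      using Dv[OF x] DB[OF x] by (auto intro!: linear_0 has_derivative_linear)
    then have "T' x (u x) (0, w) = (\<Sum>c\<in>Basis. (w \<bullet> c) *\<^sub>R B c x)"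
      by (simp add: T'_def)
    then show "norm (T' x (u x) (0, w)) \<le> 1 / 2 * norm w" using bound[OF x] by simp
  qed
  then obtain u' where u': "\<And>x. x \<in> S \<Longrightarrow> (u has_derivative u' x) (at x)"
    and u'eq: "\<And>x h. x \<in> S \<Longrightarrow> u' x h = T' x (u x) (h, u' x h)" by metis
  show ?case
  proof (rule C_diff_SucI[OF assms(1) u'])
    fix b :: 'a assume b: "b \<in> Basis"
    show "C_diff n (\<lambda>x. u' x b) S"
    proof (rule Suc.IH)
      show "C_diff n (B c) S" if "c \<in> Basis" for c using Suc.prems(1)[OF that] C_diff_mono_Suc by blast
      show "C_diff n (\<lambda>x. ?Dv x b + (\<Sum>c\<in>Basis. (u x \<bullet> c) *\<^sub>R ?DB c x b)) S"
        using Suc.prems b by (intro C_diff_add C_diff_sum C_diff_scaleR C_diff_inner assms(1) Cu C_diff_const) auto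
      fix x assume x: "x \<in> S"
      show "u' x b = ?Dv x b + (\<Sum>c\<in>Basis. (u x \<bullet> c) *\<^sub>R ?DB c x b) + (\<Sum>c\<in>Basis. (u' x b \<bullet> c) *\<^sub>R B c x)"
        using u'eq[OF x, of b] by (simp add: T'_def sum.distrib add.assoc)
    qed
  qed
qed

text \<open>A bootstrap: the derivative of \<open>u\<close> solves a linear fixed point equation
  whose coefficients are derivatives of \<open>T\<close> at \<open>(x, u x)\<close>, hence as
  regular as \<open>u\<close>. So \<open>u\<close> of class n makes its derivative of class n, and
  \<open>u\<close> of class n + 1.\<close>

lemma smooth_on_fixed_point:
  fixes T :: "'a::euclidean_space \<times> 'b::euclidean_space \<Rightarrow> 'b"
  assumes "open S" "open U" "smooth_on T U" "continuous_on S u"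
    and inU: "\<And>x. x \<in> S \<Longrightarrow> (x, u x) \<in> U" and fp: "\<And>x. x \<in> S \<Longrightarrow> u x = T (x, u x)"
    and contr: "\<And>x w. x \<in> S \<Longrightarrow> norm (frechet_derivative T (at (x, u x)) (0, w)) \<le> 1 / 2 * norm w"
  shows "smooth_on u S"
    and "\<And>x v. x \<in> S \<Longrightarrow> frechet_derivative u (at x) v = frechet_derivative T (at (x, u x)) (v, frechet_derivative u (at x) v)"
proof -
  let ?D = "\<lambda>x. frechet_derivative T (at (x, u x))"
  have "isCont u x" if "x \<in> S" for x
    using that assms(1,4) by (simp add: continuous_on_eq_continuous_at)
  then have "\<exists>u'. (u has_derivative u') (at x) \<and> (\<forall>v. u' v = ?D x (v, u' v))" if x: "x \<in> S" for x
    using fixed_point_has_derivative[OF smooth_on_has_derivative[OF assms(2,3) inU[OF x]] _ assms(1) x fp contr[OF x]] x by blast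
  then obtain u' where u': "\<And>x. x \<in> S \<Longrightarrow> (u has_derivative u' x) (at x)"
    and u'eq: "\<And>x v. x \<in> S \<Longrightarrow> u' x v = ?D x (v, u' x v)" by metis
  have fu': "frechet_derivative u (at x) = u' x" if "x \<in> S" for x
    using frechet_derivative_at[OF u'[OF that]] by simp
  show "frechet_derivative u (at x) v = ?D x (v, frechet_derivative u (at x) v)" if "x \<in> S" for x v
    unfolding fu'[OF that] by (rule u'eq[OF that])
  have lin: "linear (?D x)" if "x \<in> S" for x
    using smooth_on_has_derivative[OF assms(2,3) inU[OF that]] has_derivative_linear by blast
  have exp: "?D x (0, w) = (\<Sum>c\<in>Basis. (w \<bullet> c) *\<^sub>R ?D x (0, c))" if "x \<in> S" for x w
  proof -
    have "linear (\<lambda>w. ?D x (0, w))"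
      using linear_compose[OF _ lin[OF that], of "\<lambda>w. (0, w)"] by (simp add: o_def linear_iff)
    from linear_Basis_expansion[OF this] show ?thesis .
  qed
  have "C_diff n u S" for n
  proof (induction n)
    case 0
    then show ?case using assms(4) by simp
  next
    case (Suc n)
    have Cx: "C_diff n (\<lambda>x. (x, u x)) S"
      by (intro C_diff_Pair C_diff_ident Suc assms(1))
    have CD: "C_diff n (\<lambda>x. ?D x y) S" for y
    proof (rule C_diff_compose[OF assms(1,2) _ Cx])
      show "C_diff n (\<lambda>z. frechet_derivative T (at z) y) U"
        using smooth_on_frechet_derivative[OF assms(2,3)] unfolding smooth_on_def by blast
    qed (use inU in auto)
    show ?case
    proof (rule C_diff_SucI[OF assms(1) u'])
      fix b :: 'a assume b: "b \<in> Basis"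
      show "C_diff n (\<lambda>x. u' x b) S"
      proof (rule C_diff_linear_fixed_point[OF assms(1) CD CD])
        fix x assume x: "x \<in> S"
        have "u' x b = ?D x ((b, 0) + (0, u' x b))" using u'eq[OF x, of b] by simp
        then show "u' x b = ?D x (b, 0) + (\<Sum>c\<in>Basis. (u' x b \<bullet> c) *\<^sub>R ?D x (0, c))"
          unfolding linear_add[OF lin[OF x]] exp[OF x, symmetric] .
        show "norm (\<Sum>c\<in>Basis. (w \<bullet> c) *\<^sub>R ?D x (0, c)) \<le> 1 / 2 * norm w" for w
          unfolding exp[OF x, symmetric] by (rule contr[OF x])
      qed
    qed
  qed
  then show "smooth_on u S" by (simp add: smooth_on_def)
qed


section \<open>Stability of regular fibres\<close>

lemma open_strict_sublevel:
  fixes f :: "'a::topological_space \<Rightarrow> real"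
  assumes "open U" "continuous_on U f"
  shows "open {x \<in> U. f x < c}"
proof -
  have "{x \<in> U. f x < c} = U \<inter> f -` {..<c}" by auto
  then show ?thesis using continuous_open_preimage[OF assms(2,1) open_lessThan[of c]] by simp
qed

definition grad_Re :: "('a::euclidean_space \<Rightarrow> complex) \<Rightarrow> 'a \<Rightarrow> 'a" where
  "grad_Re P \<rho> = (\<Sum>b\<in>Basis. Re (frechet_derivative P (at \<rho>) b) *\<^sub>R b)"

definition grad_Im :: "('a::euclidean_space \<Rightarrow> complex) \<Rightarrow> 'a \<Rightarrow> 'a" where
  "grad_Im P \<rho> = (\<Sum>b\<in>Basis. Im (frechet_derivative P (at \<rho>) b) *\<^sub>R b)"

text \<open>The Gram determinant of the two gradients. It vanishes exactly where the derivative
  fails to be onto the complex plane.\<close>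

definition gram :: "('a::euclidean_space \<Rightarrow> complex) \<Rightarrow> 'a \<Rightarrow> real" where
  "gram P \<rho> = (grad_Re P \<rho> \<bullet> grad_Re P \<rho>) * (grad_Im P \<rho> \<bullet> grad_Im P \<rho>) - (grad_Re P \<rho> \<bullet> grad_Im P \<rho>)\<^sup>2"

text \<open>The minimal right inverse of the derivative, by Cramer's rule for the Gram matrix of the two gradients.\<close>

definition right_inv :: "('a::euclidean_space \<Rightarrow> complex) \<Rightarrow> 'a \<Rightarrow> complex \<Rightarrow> 'a" where
  "right_inv P \<rho> c = inverse (gram P \<rho>) *\<^sub>R
     (((grad_Im P \<rho> \<bullet> grad_Im P \<rho>) * Re c - (grad_Re P \<rho> \<bullet> grad_Im P \<rho>) * Im c) *\<^sub>R grad_Re P \<rho>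
    + ((grad_Re P \<rho> \<bullet> grad_Re P \<rho>) * Im c - (grad_Re P \<rho> \<bullet> grad_Im P \<rho>) * Re c) *\<^sub>R grad_Im P \<rho>)"

lemma
  assumes "linear (frechet_derivative P (at \<rho>))"
  shows grad_Re_inner: "grad_Re P \<rho> \<bullet> v = Re (frechet_derivative P (at \<rho>) v)"
    and grad_Im_inner: "grad_Im P \<rho> \<bullet> v = Im (frechet_derivative P (at \<rho>) v)"
  using linear_Basis_expansion[OF assms, of v]
  by (simp_all add: grad_Re_def grad_Im_def inner_sum_left mult.commute inner_commute[of v])

lemma derivative_right_inv:
  assumes "linear (frechet_derivative P (at \<rho>))" "gram P \<rho> \<noteq> 0"
  shows "frechet_derivative P (at \<rho>) (right_inv P \<rho> c) = c"
proof (rule complex_eqI)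
  define a where "a = grad_Re P \<rho> \<bullet> grad_Re P \<rho>"
  define b where "b = grad_Re P \<rho> \<bullet> grad_Im P \<rho>"
  define d where "d = grad_Im P \<rho> \<bullet> grad_Im P \<rho>"
  have b': "grad_Im P \<rho> \<bullet> grad_Re P \<rho> = b" by (simp add: b_def inner_commute)
  have g: "gram P \<rho> = a * d - b * b" by (simp add: gram_def a_def b_def d_def power2_eq_square)
  then have nz: "a * d - b * b \<noteq> 0" using assms(2) by simp
  have "Re (frechet_derivative P (at \<rho>) (right_inv P \<rho> c)) = inverse (a * d - b * b) * ((d * Re c - b * Im c) * a + (a * Im c - b * Re c) * b)"
    unfolding grad_Re_inner[OF assms(1), symmetric] right_inv_def
    by (simp add: inner_add_right g a_def[symmetric] b_def[symmetric] d_def[symmetric] algebra_simps)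
  also have "\<dots> = inverse (a * d - b * b) * ((a * d - b * b) * Re c)" by (simp add: algebra_simps)
  also have "\<dots> = Re c" using nz by (metis mult.assoc left_inverse mult_1)
  finally show "Re (frechet_derivative P (at \<rho>) (right_inv P \<rho> c)) = Re c" .
  have "Im (frechet_derivative P (at \<rho>) (right_inv P \<rho> c)) = inverse (a * d - b * b) * ((d * Re c - b * Im c) * b + (a * Im c - b * Re c) * d)"
    unfolding grad_Im_inner[OF assms(1), symmetric] right_inv_def
    by (simp add: inner_add_right g a_def[symmetric] b_def[symmetric] b' d_def[symmetric] algebra_simps)
  also have "\<dots> = inverse (a * d - b * b) * ((a * d - b * b) * Im c)" by (simp add: algebra_simps)
  also have "\<dots> = Im c" using nz by (metis mult.assoc left_inverse mult_1)
  finally show "Im (frechet_derivative P (at \<rho>) (right_inv P \<rho> c)) = Im c" .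
qed

lemma right_inv_linear: "linear (right_inv P \<rho>)"
  by (rule linearI) (simp_all add: right_inv_def algebra_simps)

lemma
  assumes "open S" "smooth_on P S"
  shows smooth_on_grad_Re: "smooth_on (grad_Re P) S" and smooth_on_grad_Im: "smooth_on (grad_Im P) S"
  unfolding grad_Re_def[abs_def] grad_Im_def[abs_def]
  by (intro smooth_on_sum smooth_on_scaleR smooth_on_const assms(1)
      smooth_on_bounded_linear[OF assms(1) bounded_linear_Re] smooth_on_bounded_linear[OF assms(1) bounded_linear_Im]
      smooth_on_frechet_derivative assms)+

lemma smooth_on_gram:
  assumes "open S" "smooth_on P S"
  shows "smooth_on (gram P) S"
  unfolding gram_def[abs_def] power2_eq_square
  by (intro smooth_on_diff smooth_on_mult smooth_on_inner smooth_on_grad_Re[OF assms] smooth_on_grad_Im[OF assms] assms(1))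

lemma smooth_on_right_inv:
  assumes "open S" "smooth_on P S" "open T" "smooth_on g T" "g ` T \<subseteq> S" "smooth_on c T"
    and "\<And>x. x \<in> T \<Longrightarrow> gram P (g x) \<noteq> 0"
  shows "smooth_on (\<lambda>x. right_inv P (g x) (c x)) T"
proof -
  note comp = smooth_on_compose[OF assms(3,1,5,4)]
  show ?thesis
    unfolding right_inv_def
    by (intro smooth_on_scaleR smooth_on_add smooth_on_diff smooth_on_mult smooth_on_inner smooth_on_inverse
        smooth_on_bounded_linear[OF assms(3) bounded_linear_Re] smooth_on_bounded_linear[OF assms(3) bounded_linear_Im]
        comp[OF smooth_on_grad_Re] comp[OF smooth_on_grad_Im] comp[OF smooth_on_gram] assms)
qed


text \<open>The perturbed fibres are the images of the unperturbed ones under the identity plus a small map \<open>D\<close>, and \<open>D\<close> is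
  the fixed point of a contraction depending smoothly on the base point. The contraction is chosen with values
  in the range of \<open>right_inv P \<rho>\<close>, which makes its fixed points exact solutions of \<open>Q (\<zeta>, \<rho> + D) = P \<rho>\<close>.\<close>

lemma fibre_stability:
  fixes Q :: "complex \<times> 'a::euclidean_space \<Rightarrow> complex"
  defines "P \<equiv> \<lambda>\<rho>. Q (0, \<rho>)"
  assumes s0: "s0 > 0" and Q: "smooth_on Q (ball 0 s0 \<times> UNIV)" and R: "R > 0"
    and cpt: "compact {\<rho>. cmod (P \<rho>) \<le> 3 * R}" and gram: "\<And>\<rho>. cmod (P \<rho>) \<le> 3 * R \<Longrightarrow> gram P \<rho> \<noteq> 0"
    and close: "\<And>\<zeta> \<rho>. \<zeta> \<in> ball 0 s0 \<Longrightarrow> cmod (Q (\<zeta>, \<rho>) - P \<rho>) \<le> R" and \<tau>: "\<tau> > 0"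
  shows "\<exists>s1>0. s1 \<le> s0 \<and> (\<forall>\<zeta>\<in>ball 0 s1. \<exists>S. smooth_on S {\<rho>. cmod (P \<rho>) < 3 * R} \<and>
     (\<forall>\<rho>. cmod (P \<rho>) < 3 * R \<longrightarrow> norm (S \<rho> - \<rho>) \<le> \<tau> \<and> inj (frechet_derivative S (at \<rho>))) \<and>
     inj_on S {\<rho>. cmod (P \<rho>) \<le> R} \<and>
     (\<forall>z\<in>cball 0 R. S ` {\<rho>. P \<rho> = z} = {\<rho>. Q (\<zeta>, \<rho>) = z}))"
proof -
  let ?DP = "\<lambda>\<rho>. frechet_derivative P (at \<rho>)"
  have smP: "smooth_on P UNIV"
    unfolding P_def
    by (rule smooth_on_compose[OF open_UNIV _ _ _ Q])
       (use s0 in \<open>auto intro!: smooth_on_Pair smooth_on_const smooth_on_ident open_Times\<close>)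
  have contP: "continuous_on A P" for A
    using smooth_on_continuous[OF smP] continuous_on_subset by blast
  have DP: "(P has_derivative ?DP \<rho>) (at \<rho>)" for \<rho>
    using smooth_on_has_derivative[OF open_UNIV smP] by blast
  have linDP: "linear (?DP \<rho>)" for \<rho> using DP has_derivative_linear by blast
  define G where "G = {\<rho>. gram P \<rho> \<noteq> 0}"
  have openG: "open G"
    unfolding G_def using smooth_on_continuous[OF smooth_on_gram[OF open_UNIV smP]]
    by (intro open_Collect_neq continuous_on_const)
  \<comment> \<open>Three levels are used. Points of perturbed fibres over \<open>cball 0 R\<close>
    have \<open>cmod (P \<rho>) \<le> 2 * R\<close> by \<open>close\<close>; the margin up to
    \<open>3 * R\<close> leaves a ball of fixed radius \<open>d\<close> around each of them in which
    the preimage can be sought.\<close>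
  define K where "K = {\<rho>. cmod (P \<rho>) \<le> 3 * R}"
  define \<Omega> where "\<Omega> = {\<rho>. cmod (P \<rho>) < 3 * R}"
  have KG: "K \<subseteq> G" using gram by (auto simp: K_def G_def)
  have \<Omega>K: "\<Omega> \<subseteq> K" by (auto simp: K_def \<Omega>_def)
  have open\<Omega>: "open \<Omega>"
    unfolding \<Omega>_def by (intro open_Collect_less continuous_on_norm contP continuous_on_const)
  have cptK: "compact K" using cpt by (simp add: K_def)
  have "compact {\<rho>. cmod (P \<rho>) \<le> 2 * R}"
  proof -
    have "closed {\<rho>. cmod (P \<rho>) \<le> 2 * R}"
      by (intro closed_Collect_le continuous_on_norm contP continuous_on_const)
    then have "compact (K \<inter> {\<rho>. cmod (P \<rho>) \<le> 2 * R})" using cptK by blast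
    moreover have "K \<inter> {\<rho>. cmod (P \<rho>) \<le> 2 * R} = {\<rho>. cmod (P \<rho>) \<le> 2 * R}"
      using R by (auto simp: K_def)
    ultimately show ?thesis by simp
  qed
  moreover have "{\<rho>. cmod (P \<rho>) \<le> 2 * R} \<subseteq> \<Omega>" using R by (auto simp: \<Omega>_def)
  ultimately obtain d where d: "d > 0" "\<And>\<rho>. cmod (P \<rho>) \<le> 2 * R \<Longrightarrow> cball \<rho> d \<subseteq> \<Omega>"
  proof -
    assume a: "compact {\<rho>. cmod (P \<rho>) \<le> 2 * R}" "{\<rho>. cmod (P \<rho>) \<le> 2 * R} \<subseteq> \<Omega>"
    obtain e where e: "e > 0" "(\<Union>x\<in>{\<rho>. cmod (P \<rho>) \<le> 2 * R}. ball x e) \<subseteq> \<Omega>"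
      using compact_subset_open_imp_ball_epsilon_subset[OF a(1) open\<Omega> a(2)] by blast
    show thesis
    proof (rule that[of "e / 2"])
      show "cball \<rho> (e / 2) \<subseteq> \<Omega>" if "cmod (P \<rho>) \<le> 2 * R" for \<rho>
      proof
        fix t assume "t \<in> cball \<rho> (e / 2)"
        then have "t \<in> ball \<rho> e" using e(1) by simp
        then show "t \<in> \<Omega>" using e(2) that by blast
      qed
    qed (use e in simp)
  qed

  \<comment> \<open>The fixed point map and its derivative at \<zeta> = 0\<close>
  define U where "U = ball (0::complex) s0 \<times> (G \<times> (UNIV :: 'a set))"
  have openU: "open U" unfolding U_def using openG by (intro open_Times) auto
  \<comment> \<open>\<open>X\<close> is \<open>Q (\<zeta>, \<rho> + D) - P \<rho>\<close> without
    its linear part. The equation \<open>D = T (\<zeta>, \<rho>, D)\<close> is thus a Newton step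
    that uses the derivative of the unperturbed map throughout.\<close>
  define X where "X x = Q (fst x, fst (snd x) + snd (snd x)) - P (fst (snd x)) - ?DP (fst (snd x)) (snd (snd x))" for x
  define T where "T x = - right_inv P (fst (snd x)) (X x)" for x
  have sm1: "smooth_on (\<lambda>x::complex \<times> 'a \<times> 'a. fst (snd x)) U" "smooth_on (\<lambda>x::complex \<times> 'a \<times> 'a. snd (snd x)) U"
    "smooth_on (\<lambda>x::complex \<times> 'a \<times> 'a. fst x) U"
    by (intro smooth_on_linear openU bounded_linear_intros)+
  have smX: "smooth_on X U"
    unfolding X_def[abs_def]
  proof (intro smooth_on_diff openU)
    show "smooth_on (\<lambda>x. Q (fst x, fst (snd x) + snd (snd x))) U"
      by (rule smooth_on_compose[OF openU _ _ _ Q]; (intro open_Times open_ball open_UNIV smooth_on_Pair smooth_on_add sm1 openU)?)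
         (auto simp: U_def)
    show "smooth_on (\<lambda>x. P (fst (snd x))) U"
      by (rule smooth_on_compose[OF openU open_UNIV _ sm1(1) smP]) auto
    show "smooth_on (\<lambda>x. ?DP (fst (snd x)) (snd (snd x))) U"
      by (rule smooth_on_frechet_derivative_compose[OF open_UNIV smP openU _ sm1(1,2)]) auto
  qed
  have smT: "smooth_on T U"
    unfolding T_def[abs_def]
    by (intro smooth_on_minus openU smooth_on_right_inv[OF open_UNIV smP openU sm1(1) _ smX]) (auto simp: U_def G_def)
  let ?DT = "\<lambda>x. frechet_derivative T (at x)"
  have DT: "(T has_derivative ?DT x) (at x)" if "x \<in> U" for x
    using smooth_on_has_derivative[OF openU smT that] .
  have linDT: "linear (?DT x)" if "x \<in> U" for x using DT[OF that] has_derivative_linear by blast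
  have T0: "T (0, \<rho>, 0) = 0" for \<rho>
    using linear_0[OF linDP] by (simp add: T_def X_def linear_0[OF right_inv_linear]) (simp add: P_def linear_0[OF right_inv_linear])
  \<comment> \<open>For \<zeta> = 0 the map \<open>T\<close> vanishes at \<open>D = 0\<close> for
    every \<rho>, and \<open>X\<close> begins with second order terms in \<open>D\<close>. So the
    derivative in \<rho> and \<open>D\<close> is zero on this set, and small Lipschitz constants
    nearby follow by compactness.\<close>
  have DT0: "?DT (0, \<rho>, 0) (0, y) = 0" if \<rho>: "\<rho> \<in> G" for \<rho> y
  proof -
    have inU: "(0, \<rho>, 0) \<in> U" using \<rho> s0 by (simp add: U_def)
    have 1: "?DT (0, \<rho>, 0) (0, v, 0) = 0" for v
    proof -
      have "((\<lambda>\<rho>. T (0, \<rho>, 0)) has_derivative (\<lambda>v. ?DT (0, \<rho>, 0) (0, v, 0))) (at \<rho>)"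
        by (rule has_derivative_compose[of "\<lambda>\<rho>. (0, \<rho>, 0)" "\<lambda>v. (0, v, 0)" \<rho> UNIV T, OF _ DT[OF inU]]) (auto intro!: derivative_eq_intros)
      moreover have "((\<lambda>\<rho>. T (0, \<rho>, 0)) has_derivative (\<lambda>v. 0)) (at \<rho>)" by (simp add: T0)
      ultimately show ?thesis using has_derivative_unique[THEN fun_cong] by blast
    qed
    have 2: "?DT (0, \<rho>, 0) (0, 0, w) = 0" for w
    proof -
      have "((\<lambda>D. T (0, \<rho>, D)) has_derivative (\<lambda>w. ?DT (0, \<rho>, 0) (0, 0, w))) (at 0)"
        by (rule has_derivative_compose[of "\<lambda>D. (0, \<rho>, D)" "\<lambda>w. (0, 0, w)" 0 UNIV T, OF _ DT[OF inU]]) (auto intro!: derivative_eq_intros)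
      moreover have "((\<lambda>D. T (0, \<rho>, D)) has_derivative (\<lambda>w. 0)) (at 0)"
      proof -
        have "((\<lambda>D. P (\<rho> + D)) has_derivative ?DP \<rho>) (at 0)"
          by (rule has_derivative_compose[of "\<lambda>D. \<rho> + D" "\<lambda>h. h" 0 UNIV P])
             (use DP[of \<rho>] in \<open>auto intro!: derivative_eq_intros\<close>)
        then have "((\<lambda>D. P (\<rho> + D) - P \<rho> - ?DP \<rho> D) has_derivative (\<lambda>w. ?DP \<rho> w - 0 - ?DP \<rho> w)) (at 0)"
          by (intro has_derivative_diff has_derivative_const linear_imp_has_derivative linDP)
        from has_derivative_minus[OF has_derivative_compose[OF this linear_imp_has_derivative[OF right_inv_linear]], of P \<rho>]
        have "((\<lambda>D. - right_inv P \<rho> (P (\<rho> + D) - P \<rho> - ?DP \<rho> D)) has_derivative (\<lambda>w. 0)) (at 0)"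
          by (simp add: linear_0[OF right_inv_linear])
        moreover have "T (0, \<rho>, D) = - right_inv P \<rho> (P (\<rho> + D) - P \<rho> - ?DP \<rho> D)" for D
          by (simp add: T_def X_def) (simp add: P_def)
        ultimately show ?thesis by simp
      qed
      ultimately show ?thesis using has_derivative_unique[THEN fun_cong] by blast
    qed
    show ?thesis
      using linear_add[OF linDT[OF inU], of "(0, fst y, 0)" "(0, 0, snd y)"] 1 2 by simp
  qed

  \<comment> \<open>Uniform contraction near \<zeta> = 0\<close>
  define N where "N = real (card (Basis :: ('a \<times> 'a) set))"
  have N: "N > 0" unfolding N_def by (simp add: card_gt_0_iff)
  \<comment> \<open>With \<open>1 / (8 * N)\<close> for each of the \<open>N\<close> basis
    directions, the triangle inequality yields the operator bound 1/8. Only strict inequalities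
    occur, so the set is open.\<close>
  define O1 where "O1 = {x \<in> U. \<forall>b\<in>Basis. norm (?DT x (0, b)) < 1 / (8 * N)}"
  have openO1: "open O1"
  proof -
    have "open {x \<in> U. norm (?DT x (0, b)) < 1 / (8 * N)}" for b
      by (intro open_strict_sublevel openU continuous_on_norm smooth_on_continuous[OF smooth_on_frechet_derivative[OF openU smT]])
    moreover have "O1 = U \<inter> (\<Inter>b\<in>Basis. {x \<in> U. norm (?DT x (0, b)) < 1 / (8 * N)})"
      by (auto simp: O1_def)
    ultimately show ?thesis using openU by (auto intro!: open_Int open_INT)
  qed
  have DT_bound: "norm (?DT x (0, y)) \<le> 1 / 8 * norm y" if x: "x \<in> O1" for x y
  proof -
    have "x \<in> U" using x by (simp add: O1_def)
    then have "linear (\<lambda>y. ?DT x (0, y))"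
      using linear_compose[OF _ linDT, of "\<lambda>y. (0, y)"] by (simp add: o_def linear_iff)
    then have "?DT x (0, y) = (\<Sum>b\<in>Basis. (y \<bullet> b) *\<^sub>R ?DT x (0, b))"
      by (rule linear_Basis_expansion)
    also have "norm \<dots> \<le> (\<Sum>b\<in>(Basis :: ('a \<times> 'a) set). norm y * (1 / (8 * N)))"
    proof (rule order_trans[OF norm_sum sum_mono])
      fix b :: "'a \<times> 'a" assume b: "b \<in> Basis"
      then have "norm (?DT x (0, b)) \<le> 1 / (8 * N)" using x by (force simp: O1_def)
      then show "norm ((y \<bullet> b) *\<^sub>R ?DT x (0, b)) \<le> norm y * (1 / (8 * N))"
        using Basis_le_norm[OF b, of y] by (simp only: norm_scaleR) (intro mult_mono; simp)
    qed
    also have "\<dots> = N * (norm y * (1 / (8 * N)))" by (simp only: sum_constant N_def)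
    also have "\<dots> = 1 / 8 * norm y" using N by simp
    finally show ?thesis .
  qed
  have lip: "norm (T (\<zeta>, y) - T (\<zeta>, y')) \<le> 1 / 8 * norm (y - y')"
    if C: "convex C" "\<And>y. y \<in> C \<Longrightarrow> (\<zeta>, y) \<in> O1" "y \<in> C" "y' \<in> C" for C \<zeta> y y'
  proof (rule differentiable_bound[OF C(1) _ _ C(3,4)])
    fix y assume y: "y \<in> C"
    then have "(\<zeta>, y) \<in> U" using C(2) by (auto simp: O1_def)
    then have "((\<lambda>y. T (\<zeta>, y)) has_derivative (\<lambda>h. ?DT (\<zeta>, y) (0, h))) (at y)"
      by (intro has_derivative_compose[OF _ DT]) (auto intro!: derivative_eq_intros)
    then show "((\<lambda>y. T (\<zeta>, y)) has_derivative (\<lambda>h. ?DT (\<zeta>, y) (0, h))) (at y within C)"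
      by (rule has_derivative_at_withinI)
    show "onorm (\<lambda>h. ?DT (\<zeta>, y) (0, h)) \<le> 1 / 8"
      using DT_bound[OF C(2)[OF y]] by (intro onorm_bound) auto
  qed
  \<comment> \<open>The tube lemma needs the two small variables \<zeta> and \<open>D\<close> in one
    factor and the compact variable \<rho> in the other.\<close>
  define swap where "swap x = (fst (fst x), snd x, snd (fst x))" for x :: "(complex \<times> 'a) \<times> 'a"
  have cswap: "continuous_on UNIV swap"
    unfolding swap_def[abs_def] by (intro continuous_intros)
  have tube: "\<exists>e>0. \<forall>\<zeta> \<rho> D. cmod \<zeta> < e \<longrightarrow> norm D < e \<longrightarrow> \<rho> \<in> K \<longrightarrow> (\<zeta>, \<rho>, D :: 'a) \<in> W"
    if W: "open W" "\<And>\<rho>. \<rho> \<in> K \<Longrightarrow> (0, \<rho>, 0) \<in> W" for W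
  proof -
    have op: "open (swap -` W)" using W(1) cswap by (rule open_vimage)
    have sub: "{(0, 0)} \<times> K \<subseteq> swap -` W" using W(2) by (auto simp: swap_def)
    obtain X0 where X0: "(0, 0) \<in> X0" "open X0" "X0 \<times> K \<subseteq> swap -` W"
      using Elementary_Topology.tube_lemma[OF cptK op sub] by blast
    obtain e where e: "e > 0" "ball (0, 0) e \<subseteq> X0" using openE[OF X0(2,1)] .
    show ?thesis
    proof (intro exI conjI allI impI)
      show "e / 2 > 0" using e(1) by simp
      fix \<zeta> :: complex and \<rho> D :: 'a assume "cmod \<zeta> < e / 2" "norm D < e / 2" "\<rho> \<in> K"
      then have "norm (\<zeta>, D) < e" using norm_Pair_le[of \<zeta> D] by simp
      then have "(\<zeta>, D) \<in> X0" using e(2) by (auto simp: dist_norm subset_iff simp flip: zero_prod_def)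
      then show "(\<zeta>, \<rho>, D) \<in> W" using X0(3) \<open>\<rho> \<in> K\<close> by (auto simp: swap_def)
    qed
  qed
  have "(0, \<rho>, 0) \<in> O1" if "\<rho> \<in> K" for \<rho>
    using that KG DT0 N s0 by (auto simp: O1_def U_def)
  then obtain e1 where e1: "e1 > 0" "\<And>\<zeta> \<rho> D. cmod \<zeta> < e1 \<Longrightarrow> norm D < e1 \<Longrightarrow> \<rho> \<in> K \<Longrightarrow> (\<zeta>, \<rho>, D) \<in> O1"
    using tube[OF openO1] by blast
  define r where "r = min (e1 / 2) (min \<tau> (d / 8))"
  have r: "r > 0" "r < e1" "r \<le> \<tau>" "8 * r \<le> d"
    using e1(1) \<tau> d(1) by (auto simp: r_def)
  have "open {x \<in> U. norm (T x) < r / 2}"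
    by (intro open_strict_sublevel openU continuous_on_norm smooth_on_continuous[OF smT])
  moreover have "(0, \<rho>, 0) \<in> {x \<in> U. norm (T x) < r / 2}" if "\<rho> \<in> K" for \<rho>
    using that KG T0 r(1) s0 by (auto simp: U_def)
  ultimately obtain e2 where e2: "e2 > 0"
    "\<And>\<zeta> \<rho> D. cmod \<zeta> < e2 \<Longrightarrow> norm D < e2 \<Longrightarrow> \<rho> \<in> K \<Longrightarrow> (\<zeta>, \<rho>, D) \<in> {x \<in> U. norm (T x) < r / 2}"
    using tube by blast
  define s1 where "s1 = min s0 (min e1 e2)"
  have s1: "s1 > 0" "s1 \<le> s0" "s1 \<le> e1" "s1 \<le> e2" using s0 e1(1) e2(1) by (auto simp: s1_def)

  \<comment> \<open>The deformation of the fibres for a fixed parameter\<close>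
  have main: "\<exists>S. smooth_on S \<Omega> \<and> (\<forall>\<rho>\<in>\<Omega>. norm (S \<rho> - \<rho>) \<le> \<tau> \<and> inj (frechet_derivative S (at \<rho>))) \<and>
     inj_on S {\<rho>. cmod (P \<rho>) \<le> R} \<and> (\<forall>z\<in>cball 0 R. S ` {\<rho>. P \<rho> = z} = {\<rho>. Q (\<zeta>, \<rho>) = z})" if \<zeta>: "cmod \<zeta> < s1" for \<zeta>
  proof -
    have inO1: "(\<zeta>, \<rho>, D) \<in> O1" if "\<rho> \<in> K" "norm D \<le> r" for \<rho> D
      using e1(2)[of \<zeta> D \<rho>] \<zeta> s1 r that by auto
    have ex: "\<exists>!D. D \<in> cball 0 r \<and> T (\<zeta>, \<rho>, D) = D" if \<rho>: "\<rho> \<in> K" for \<rho>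
    proof -
      have lipD: "norm (T (\<zeta>, \<rho>, D) - T (\<zeta>, \<rho>, D')) \<le> 1 / 8 * norm (D - D')" if "D \<in> cball 0 r" "D' \<in> cball 0 r" for D D'
      proof -
        have "norm (T (\<zeta>, \<rho>, D) - T (\<zeta>, \<rho>, D')) \<le> 1 / 8 * norm ((\<rho>, D) - (\<rho>, D'))"
          by (rule lip[of "{\<rho>} \<times> cball 0 r"]) (use that \<rho> inO1 in \<open>auto intro!: convex_Times\<close>)
        then show ?thesis by simp
      qed
      have "\<exists>!D\<in>cball 0 r. T (\<zeta>, \<rho>, D) = D"
      proof (rule Banach_fix)
        show "complete (cball (0::'a) r)" by (intro compact_imp_complete compact_cball)
        show "cball (0::'a) r \<noteq> {}" using r(1) by simp
        show "(0::real) \<le> 1 / 8" "(1 / 8 :: real) < 1" by auto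
        show "dist (T (\<zeta>, \<rho>, D)) (T (\<zeta>, \<rho>, D')) \<le> 1 / 8 * dist D D'" if "D \<in> cball 0 r" "D' \<in> cball 0 r" for D D'
          using lipD[OF that] by (simp add: dist_norm)
        have "norm (T (\<zeta>, \<rho>, D)) \<le> r" if D: "D \<in> cball 0 r" for D
        proof -
          have "norm (T (\<zeta>, \<rho>, 0)) < r / 2" using e2(2)[of \<zeta> 0 \<rho>] \<zeta> s1 \<rho> e2(1) by auto
          moreover have "norm (T (\<zeta>, \<rho>, D) - T (\<zeta>, \<rho>, 0)) \<le> 1 / 8 * r"
            using lipD[OF D, of 0] D r(1) by simp
          moreover have "norm (T (\<zeta>, \<rho>, D)) \<le> norm (T (\<zeta>, \<rho>, D) - T (\<zeta>, \<rho>, 0)) + norm (T (\<zeta>, \<rho>, 0))"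
            by (metis diff_add_cancel norm_triangle_ineq)
          ultimately show ?thesis using r(1) by simp
        qed
        then show "(\<lambda>D. T (\<zeta>, \<rho>, D)) ` cball 0 r \<subseteq> cball 0 r" by auto
      qed
      then show ?thesis by blast
    qed
    define D where "D \<rho> = (THE D. D \<in> cball 0 r \<and> T (\<zeta>, \<rho>, D) = D)" for \<rho>
    have D: "norm (D \<rho>) \<le> r" "D \<rho> = T (\<zeta>, \<rho>, D \<rho>)" if "\<rho> \<in> K" for \<rho>
      using theI'[OF ex[OF that]] unfolding D_def[symmetric] by auto
    \<comment> \<open>\<open>T\<close> has Lipschitz constant 1/8 in base point and \<open>D\<close>
      jointly; moving the \<open>D\<close> term to the left turns 1/8 into 1/7. Convex sets are
      required because the estimate comes from the mean value inequality, and \<open>K\<close>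
      itself need not be convex.\<close>
    have lipD: "norm (D \<rho> - D \<rho>') \<le> 1 / 7 * norm (\<rho> - \<rho>')" if C: "convex C" "C \<subseteq> K" "\<rho> \<in> C" "\<rho>' \<in> C" for C \<rho> \<rho>'
    proof -
      have K': "\<rho> \<in> K" "\<rho>' \<in> K" using C by auto
      have "norm (T (\<zeta>, \<rho>, D \<rho>) - T (\<zeta>, \<rho>', D \<rho>')) \<le> 1 / 8 * norm ((\<rho>, D \<rho>) - (\<rho>', D \<rho>'))"
        by (rule lip[of "C \<times> cball 0 r"]) (use C D(1) inO1 in \<open>auto intro!: convex_Times\<close>)
      also have "\<dots> \<le> 1 / 8 * (norm (\<rho> - \<rho>') + norm (D \<rho> - D \<rho>'))"
        using norm_Pair_le[of "\<rho> - \<rho>'" "D \<rho> - D \<rho>'"] by simp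
      finally show ?thesis using D(2)[OF K'(1)] D(2)[OF K'(2)] by simp
    qed
    have contD: "continuous_on \<Omega> D"
    proof (rule continuous_at_imp_continuous_on, rule ballI)
      fix \<rho> assume "\<rho> \<in> \<Omega>"
      then obtain t where t: "t > 0" "ball \<rho> t \<subseteq> \<Omega>" using openE[OF open\<Omega>] by blast
      have "continuous_on (ball \<rho> t) D"
        by (rule lipschitz_on_continuous_on[OF lipschitz_onI[of _ _ "1/7"]])
           (use lipD[of "ball \<rho> t"] t \<Omega>K in \<open>auto simp: dist_norm intro: convex_ball\<close>)
      then show "isCont D \<rho>" using t(1) by (simp add: continuous_on_eq_continuous_at)
    qed
    define T\<zeta> where "T\<zeta> y = T (\<zeta>, y)" for y
    have U\<zeta>: "(\<zeta>, y) \<in> U" if "y \<in> G \<times> UNIV" for y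
      using that \<zeta> s1 by (auto simp: U_def)
    have smT\<zeta>: "smooth_on T\<zeta> (G \<times> UNIV)"
      unfolding T\<zeta>_def
      by (rule smooth_on_compose[OF _ openU _ _ smT]; (intro open_Times open_UNIV openG smooth_on_Pair smooth_on_const smooth_on_ident)?)
         (use U\<zeta> in auto)
    have DT\<zeta>: "frechet_derivative T\<zeta> (at y) = (\<lambda>h. ?DT (\<zeta>, y) (0, h))" if "y \<in> G \<times> UNIV" for y
    proof -
      have "(T\<zeta> has_derivative (\<lambda>h. ?DT (\<zeta>, y) (0, h))) (at y)"
        unfolding T\<zeta>_def by (intro has_derivative_compose[OF _ DT] U\<zeta> that) (auto intro!: derivative_eq_intros)
      from frechet_derivative_at[OF this] show ?thesis by simp
    qed
    have contr: "norm (frechet_derivative T\<zeta> (at (\<rho>, D \<rho>)) h) \<le> 1 / 8 * norm h" if "\<rho> \<in> \<Omega>" for \<rho> h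
    proof -
      have "\<rho> \<in> K" "(\<rho>, D \<rho>) \<in> G \<times> UNIV" using that \<Omega>K KG by auto
      then show ?thesis using DT_bound[OF inO1[OF _ D(1)], of \<rho>] DT\<zeta>[of "(\<rho>, D \<rho>)"] by simp
    qed
    have smD: "smooth_on D \<Omega>"
      and D'eq: "\<And>\<rho> v. \<rho> \<in> \<Omega> \<Longrightarrow> frechet_derivative D (at \<rho>) v = frechet_derivative T\<zeta> (at (\<rho>, D \<rho>)) (v, frechet_derivative D (at \<rho>) v)"
    proof -
      have "norm (frechet_derivative T\<zeta> (at (\<rho>, D \<rho>)) (0, w)) \<le> 1 / 2 * norm w" if "\<rho> \<in> \<Omega>" for \<rho> w
      proof -
        have "norm (frechet_derivative T\<zeta> (at (\<rho>, D \<rho>)) (0, w)) \<le> 1 / 8 * norm w"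
          using contr[OF that, of "(0, w)"] by simp
        then show ?thesis using norm_ge_zero[of w] by linarith
      qed
      moreover have "open (G \<times> (UNIV :: 'a set))" by (intro open_Times openG open_UNIV)
      moreover have "D \<rho> = T\<zeta> (\<rho>, D \<rho>)" "(\<rho>, D \<rho>) \<in> G \<times> UNIV" if "\<rho> \<in> \<Omega>" for \<rho>
        using D(2) that \<Omega>K KG by (auto simp: T\<zeta>_def)
      ultimately show "smooth_on D \<Omega>"
        and "\<And>\<rho> v. \<rho> \<in> \<Omega> \<Longrightarrow> frechet_derivative D (at \<rho>) v = frechet_derivative T\<zeta> (at (\<rho>, D \<rho>)) (v, frechet_derivative D (at \<rho>) v)"
        using smooth_on_fixed_point[OF open\<Omega> _ smT\<zeta> contD] by blast+
    qed
    define S where "S \<rho> = \<rho> + D \<rho>" for \<rho>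
    have smS: "smooth_on S \<Omega>"
      unfolding S_def[abs_def] by (intro smooth_on_add smooth_on_ident open\<Omega> smD)
    have QS: "Q (\<zeta>, S \<rho>) = P \<rho>" if "\<rho> \<in> K" for \<rho>
    proof -
      have g: "gram P \<rho> \<noteq> 0" using that gram by (simp add: K_def)
      have "?DP \<rho> (D \<rho>) = ?DP \<rho> (- right_inv P \<rho> (X (\<zeta>, \<rho>, D \<rho>)))"
        using D(2)[OF that] by (simp add: T_def)
      also have "\<dots> = - X (\<zeta>, \<rho>, D \<rho>)"
        unfolding linear_neg[OF linDP] derivative_right_inv[OF linDP g] ..
      finally show ?thesis by (simp add: X_def S_def)
    qed
    have injS': "inj (frechet_derivative S (at \<rho>))" if \<rho>: "\<rho> \<in> \<Omega>" for \<rho>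
    proof -
      have "(S has_derivative (\<lambda>v. v + frechet_derivative D (at \<rho>) v)) (at \<rho>)"
        unfolding S_def[abs_def]
        by (intro has_derivative_add has_derivative_ident smooth_on_has_derivative[OF open\<Omega> smD \<rho>])
      then have S': "frechet_derivative S (at \<rho>) = (\<lambda>v. v + frechet_derivative D (at \<rho>) v)" and lin: "linear (\<lambda>v. v + frechet_derivative D (at \<rho>) v)"
        using frechet_derivative_at[of S] has_derivative_linear[of S] by auto
      have "v = 0" if "v + frechet_derivative D (at \<rho>) v = 0" for v
      proof -
        have neg: "frechet_derivative D (at \<rho>) v = - v" using that by (simp add: eq_neg_iff_add_eq_0 add.commute)
        have "norm (- v) \<le> 1 / 8 * norm (v, - v)"
          using contr[OF \<rho>, of "(v, - v)"] D'eq[OF \<rho>, of v] unfolding neg by simp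
        also have "\<dots> \<le> 1 / 8 * (norm v + norm (- v))" using norm_Pair_le[of v "- v"] by simp
        finally show ?thesis by simp
      qed
      then show ?thesis unfolding S' linear_injective_0[OF lin] by blast
    qed
    \<comment> \<open>Points with the same image differ by at most \<open>2 * r\<close>, hence by at
      most \<open>d\<close>, so they lie in a common ball inside \<Omega>. There \<open>D\<close>
      contracts, and this excludes distinct points.\<close>
    have inj: "inj_on S {\<rho>. cmod (P \<rho>) \<le> R}"
    proof (rule inj_onI)
      fix \<rho> \<rho>' assume a: "\<rho> \<in> {\<rho>. cmod (P \<rho>) \<le> R}" "\<rho>' \<in> {\<rho>. cmod (P \<rho>) \<le> R}" "S \<rho> = S \<rho>'"
      then have eq: "\<rho> - \<rho>' = D \<rho>' - D \<rho>" by (simp add: S_def algebra_simps)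
      have K': "\<rho> \<in> K" "\<rho>' \<in> K" using a R by (auto simp: K_def)
      have "norm (\<rho> - \<rho>') \<le> norm (D \<rho>') + norm (D \<rho>)" unfolding eq by (rule norm_triangle_ineq4)
      then have "norm (\<rho> - \<rho>') \<le> d" using D(1)[OF K'(1)] D(1)[OF K'(2)] r by simp
      then have "norm (D \<rho>' - D \<rho>) \<le> 1 / 7 * norm (\<rho>' - \<rho>)"
        using d(1) d(2)[of \<rho>] a R \<Omega>K by (intro lipD[of "cball \<rho> d"]) (auto simp: dist_norm)
      then show "\<rho> = \<rho>'" unfolding eq[symmetric] by (simp add: norm_minus_commute)
    qed
    have img: "S ` {\<rho>. P \<rho> = z} = {\<rho>. Q (\<zeta>, \<rho>) = z}" if z: "z \<in> cball 0 R" for z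
    proof (intro equalityI subsetI)
      fix \<sigma> assume "\<sigma> \<in> S ` {\<rho>. P \<rho> = z}"
      then show "\<sigma> \<in> {\<rho>. Q (\<zeta>, \<rho>) = z}" using QS z R by (auto simp: K_def)
    next
      fix \<sigma> assume \<sigma>: "\<sigma> \<in> {\<rho>. Q (\<zeta>, \<rho>) = z}"
      then have "cmod (z - P \<sigma>) \<le> R" using close[of \<zeta> \<sigma>] \<zeta> s1 by auto
      then have "cmod (P \<sigma>) \<le> 2 * R"
        using z norm_triangle_ineq2[of "P \<sigma>" z] by (simp add: norm_minus_commute)
      then have sub: "cball \<sigma> d \<subseteq> K" using d(2) \<Omega>K by blast
      \<comment> \<open>The whole perturbed fibre is reached: solving
        \<open>\<rho> + D \<rho> = \<sigma>\<close> for \<rho> is a second fixed point problem,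
        contractive because \<open>D\<close> is.\<close>
      have "\<exists>!\<rho>\<in>cball \<sigma> d. \<sigma> - D \<rho> = \<rho>"
      proof (rule Banach_fix)
        show "complete (cball \<sigma> d)" by (intro compact_imp_complete compact_cball)
        show "cball \<sigma> d \<noteq> {}" using d(1) by simp
        show "(0::real) \<le> 1 / 7" "(1 / 7 :: real) < 1" by auto
        show "dist (\<sigma> - D \<rho>) (\<sigma> - D \<rho>') \<le> 1 / 7 * dist \<rho> \<rho>'" if "\<rho> \<in> cball \<sigma> d" "\<rho>' \<in> cball \<sigma> d" for \<rho> \<rho>'
          using lipD[OF convex_cball sub that] by (simp add: dist_norm norm_minus_commute)
        show "(\<lambda>\<rho>. \<sigma> - D \<rho>) ` cball \<sigma> d \<subseteq> cball \<sigma> d"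
        proof
          fix y assume "y \<in> (\<lambda>\<rho>. \<sigma> - D \<rho>) ` cball \<sigma> d"
          then obtain \<rho> where "\<rho> \<in> K" "y = \<sigma> - D \<rho>" using sub by blast
          then show "y \<in> cball \<sigma> d" using D(1)[of \<rho>] r by (simp add: dist_norm)
        qed
      qed
      then obtain \<rho> where \<rho>: "\<rho> \<in> cball \<sigma> d" "\<sigma> - D \<rho> = \<rho>" by blast
      then have "S \<rho> = \<sigma>" by (metis S_def diff_add_cancel)
      moreover have "P \<rho> = z" using QS[of \<rho>] sub \<rho>(1) \<sigma> \<open>S \<rho> = \<sigma>\<close> by auto
      ultimately show "\<sigma> \<in> S ` {\<rho>. P \<rho> = z}" by blast
    qed
    have "norm (S \<rho> - \<rho>) \<le> \<tau>" if "\<rho> \<in> \<Omega>" for \<rho>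
      using D(1)[of \<rho>] that \<Omega>K r(3) by (auto simp: S_def)
    with smS injS' inj img show ?thesis by blast
  qed
  show ?thesis
  proof (rule exI[of _ s1], intro conjI ballI)
    show "s1 > 0" "s1 \<le> s0" by fact+
    fix \<zeta> assume "\<zeta> \<in> ball (0::complex) s1"
    then have "cmod \<zeta> < s1" by simp
    from main[OF this] show "\<exists>S. smooth_on S {\<rho>. cmod (P \<rho>) < 3 * R} \<and>
     (\<forall>\<rho>. cmod (P \<rho>) < 3 * R \<longrightarrow> norm (S \<rho> - \<rho>) \<le> \<tau> \<and> inj (frechet_derivative S (at \<rho>))) \<and>
     inj_on S {\<rho>. cmod (P \<rho>) \<le> R} \<and> (\<forall>z\<in>cball 0 R. S ` {\<rho>. P \<rho> = z} = {\<rho>. Q (\<zeta>, \<rho>) = z})"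
      unfolding \<Omega>_def by (auto simp: Ball_def)
  qed
qed

section \<open>Densities of push-forward measures\<close>

lemma integrable_continuous_compact_support:
  fixes f :: "'a::euclidean_space \<Rightarrow> 'b::euclidean_space"
  assumes "continuous_on UNIV f" "compact K" "\<And>x. x \<notin> K \<Longrightarrow> f x = 0"
  shows "integrable lborel f"
proof -
  have "f = (\<lambda>x. indicator K x *\<^sub>R f x)"
    using assms(3) by (auto simp: indicator_def)
  then show ?thesis
    using borel_integrable_compact[OF assms(2) continuous_on_subset[OF assms(1)]] by simp
qed

lemma lborel_integral_eq_cbox:
  fixes f :: "'a::euclidean_space \<Rightarrow> 'b::euclidean_space"
  assumes "continuous_on UNIV f" "\<And>x. x \<notin> cbox a b \<Longrightarrow> f x = 0"
  shows "(\<integral>x. f x \<partial>lborel) = integral (cbox a b) f"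
proof -
  have "(\<integral>x. f x \<partial>lborel) = integral UNIV f"
    using integral_lborel[OF integrable_continuous_compact_support[OF assms(1) compact_cbox assms(2)]] by simp
  also have "\<dots> = integral UNIV (\<lambda>x. if x \<in> cbox a b then f x else 0)"
    by (rule arg_cong[where f = "integral UNIV"]) (use assms(2) in auto)
  also have "\<dots> = integral (cbox a b) f" by (rule Henstock_Kurzweil_Integration.integral_restrict_UNIV)
  finally show ?thesis .
qed

lemma lborel_integral_translation:
  fixes f :: "'a::euclidean_space \<Rightarrow> 'b::euclidean_space"
  assumes "f \<in> borel_measurable borel"
  shows "(\<integral>x. f (c + x) \<partial>lborel) = (\<integral>x. f x \<partial>lborel)"
proof -
  have "(\<integral>x. f x \<partial>lborel) = (\<integral>x. f x \<partial>(distr lborel borel ((+) c)))"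
    by (simp only: lborel_distr_plus)
  also have "\<dots> = (\<integral>x. f (c + x) \<partial>lborel)"
    by (rule integral_distr) (use assms in auto)
  finally show ?thesis by simp
qed

lemma compact_cbox_bound:
  fixes K :: "'a::euclidean_space set"
  assumes "compact K"
  obtains a where "\<And>x s. x + s \<in> K \<Longrightarrow> norm s \<le> r \<Longrightarrow> x \<in> cbox (-a) a"
proof -
  obtain M where M: "\<And>x. x \<in> K \<Longrightarrow> norm x \<le> M"
    using compact_imp_bounded[OF assms] by (auto simp: bounded_iff)
  obtain a where a: "cball 0 (M + r) \<subseteq> cbox (-a) (a::'a)"
    using bounded_subset_cbox_symmetric[OF bounded_cball] by blast
  show thesis
  proof (rule that)
    fix x s assume "x + s \<in> K" "norm s \<le> r"
    then have "norm x \<le> M + r" using M[of "x + s"] norm_triangle_ineq2[of x "- s"] by simp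
    then show "x \<in> cbox (-a) a" using a by auto
  qed
qed

text \<open>The integral of a translate of \<open>u\<close> by \<open>s *\<^sub>R b\<close> does not
  depend on \<open>s\<close>; differentiating under the integral at \<open>s = 0\<close> gives the
  claim. The fixed box contains the supports of all translates with \<open>s\<close> between -1 and
  1.\<close>

lemma integral_directional_derivative_eq_0:
  fixes u :: "'a::euclidean_space \<Rightarrow> 'b::euclidean_space"
  assumes der: "\<And>x. (u has_derivative u' x) (at x)" and cont: "continuous_on UNIV (\<lambda>x. u' x b)"
    and K: "compact K" "\<And>x. x \<notin> K \<Longrightarrow> u x = 0"
  shows "(\<integral>x. u' x b \<partial>lborel) = 0"
proof -
  have contu: "continuous_on UNIV u"
    using der by (auto intro!: continuous_at_imp_continuous_on dest: has_derivative_continuous)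
  obtain a where a: "\<And>x s. x + s \<in> K \<Longrightarrow> norm s \<le> norm b \<Longrightarrow> x \<in> cbox (-a) a"
    using compact_cbox_bound[OF K(1), of "norm b"] by blast
  have in_box: "x \<in> cbox (-a) a" if "x + s *\<^sub>R b \<in> K" "s \<in> {-1<..<1}" for x s
  proof -
    have "\<bar>s\<bar> \<le> 1" using that(2) by (simp add: abs_le_iff)
    then have "norm (s *\<^sub>R b) \<le> norm b" using mult_right_mono[of "\<bar>s\<bar>" 1 "norm b"] by simp
    then show ?thesis using a[OF that(1)] by blast
  qed
  define I where "I s = integral (cbox (-a) a) (\<lambda>x. u (x + s *\<^sub>R b))" for s
  have I: "I s = (\<integral>x. u x \<partial>lborel)" if s: "s \<in> {-1<..<1}" for s
  proof -
    have "(\<integral>x. u (x + s *\<^sub>R b) \<partial>lborel) = I s"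
      unfolding I_def using in_box[OF _ s] K(2)
      by (intro lborel_integral_eq_cbox continuous_on_compose2[OF contu]) (auto intro!: continuous_intros)
    moreover have "(\<integral>x. u (s *\<^sub>R b + x) \<partial>lborel) = (\<integral>x. u x \<partial>lborel)"
      using contu by (intro lborel_integral_translation borel_measurable_continuous_onI)
    ultimately show ?thesis by (simp add: add.commute)
  qed
  have "(I has_vector_derivative integral (cbox (-a) a) (\<lambda>x. u' (x + 0 *\<^sub>R b) b)) (at 0 within {-1<..<1})"
    unfolding I_def
  proof (rule leibniz_rule_vector_derivative[where fx = "\<lambda>s x. u' (x + s *\<^sub>R b) b"])
    fix s :: real and x
    have "((\<lambda>s. u (x + s *\<^sub>R b)) has_derivative (\<lambda>h. u' (x + s *\<^sub>R b) (h *\<^sub>R b))) (at s)"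
      by (rule has_derivative_compose[OF _ der]) (auto intro!: derivative_eq_intros)
    then show "((\<lambda>s. u (x + s *\<^sub>R b)) has_vector_derivative u' (x + s *\<^sub>R b) b) (at s within {-1<..<1})"
      unfolding has_vector_derivative_def
      using linear_cmul[OF has_derivative_linear[OF der]] by (simp add: has_derivative_at_withinI)
    show "(\<lambda>x. u (x + s *\<^sub>R b)) integrable_on cbox (- a) a"
      by (intro integrable_continuous continuous_on_compose2[OF contu]) (auto intro!: continuous_intros)
  next
    show "continuous_on ({-1<..<1} \<times> cbox (- a) a) (\<lambda>(s, x). u' (x + s *\<^sub>R b) b)"
      unfolding split_beta by (intro continuous_on_compose2[OF cont]) (auto intro!: continuous_intros)
  qed auto
  then have 1: "(I has_vector_derivative integral (cbox (-a) a) (\<lambda>x. u' x b)) (at 0)"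
    by (simp add: at_within_open[of 0 "{-1<..<1::real}"])
  have "(I has_vector_derivative 0) (at 0)"
    by (rule has_vector_derivative_transform_within_open[where f = "\<lambda>_. \<integral>x. u x \<partial>lborel" and S = "{-1<..<1}"])
       (use I in auto)
  then have "integral (cbox (-a) a) (\<lambda>x. u' x b) = 0"
    using 1 vector_derivative_unique_at by blast
  moreover have "u' x b = 0" if "x \<notin> cbox (-a) a" for x
  proof -
    have "x \<notin> K" using a[of x 0] that by auto
    then have "(u has_derivative (\<lambda>_. 0)) (at x)"
      using K by (intro has_derivative_transform_within_open[of "\<lambda>_. 0" "\<lambda>_. 0" x UNIV "- K" u])
        (auto simp: open_Compl compact_imp_closed)
    then show ?thesis using has_derivative_unique[OF der] by metis
  qed
  ultimately show ?thesis using lborel_integral_eq_cbox[OF cont, of "- a" a] by simp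
qed

abbreviation (input) pd :: "complex \<Rightarrow> (complex \<Rightarrow> complex) \<Rightarrow> complex \<Rightarrow> complex" where
  "pd j F z \<equiv> frechet_derivative F (at z) j"

lemma smooth_on_UNIV_has_derivative:
  "smooth_on f UNIV \<Longrightarrow> (f has_derivative frechet_derivative f (at x)) (at x)"
  using smooth_on_has_derivative[OF open_UNIV] by blast

text \<open>Since the derivative of \<open>q\<close> maps \<open>right_inv q \<rho> j\<close> to \<open>j\<close>, this is an integration by parts along the
  vector field \<open>h \<cdot> right_inv q _ j\<close>; the weight \<open>h'\<close> is minus its divergence.\<close>

lemma submersion_integration_by_parts:
  fixes q :: "'a::euclidean_space \<Rightarrow> complex" and h :: "'a \<Rightarrow> real"
  assumes q: "smooth_on q UNIV" and h: "smooth_on h UNIV" and K: "compact K" "\<And>x. x \<notin> K \<Longrightarrow> h x = 0"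
    and gram: "\<And>x. x \<in> K \<Longrightarrow> gram q x \<noteq> 0"
  shows "\<exists>h'. smooth_on h' UNIV \<and> (\<forall>x. x \<notin> K \<longrightarrow> h' x = 0) \<and>
    (\<forall>F. smooth_on F UNIV \<longrightarrow> (\<integral>x. h x *\<^sub>R pd j F (q x) \<partial>lborel) = (\<integral>x. h' x *\<^sub>R F (q x) \<partial>lborel))"
proof -
  define Y where "Y x = h x *\<^sub>R right_inv q x j" for x
  have Y0: "Y x = 0" if "x \<notin> K" for x using K(2)[OF that] by (simp add: Y_def)
  have openK: "open (- K)" using K(1) by (simp add: open_Compl compact_imp_closed)
  have openG: "open {x. gram q x \<noteq> 0}"
    using smooth_on_continuous[OF smooth_on_gram[OF open_UNIV q]]
    by (intro open_Collect_neq continuous_on_const)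
  \<comment> \<open>The open sets where \<open>gram q\<close> is nonzero and \<open>- K\<close>
    cover the space by the hypothesis on \<open>K\<close>. Outside the first set
    \<open>right_inv\<close> has no meaning, but there its factor \<open>h\<close> is zero.\<close>
  have Y: "smooth_on Y UNIV"
  proof (rule smooth_on_Union[OF open_UNIV])
    fix x
    show "\<exists>T. open T \<and> x \<in> T \<and> smooth_on Y T"
    proof (cases "x \<in> K")
      case True
      have "smooth_on Y {x. gram q x \<noteq> 0}"
        unfolding Y_def
        by (intro smooth_on_scaleR openG smooth_on_subset[OF h] smooth_on_right_inv[OF open_UNIV q openG]
            smooth_on_ident smooth_on_const) auto
      then show ?thesis using openG gram[OF True] by blast
    next
      case False
      have "smooth_on Y (- K) \<longleftrightarrow> smooth_on (\<lambda>x. 0 :: 'a) (- K)"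
        by (rule smooth_on_cong[OF openK]) (use Y0 in auto)
      then show ?thesis using openK False smooth_on_const[OF openK] by blast
    qed
  qed
  let ?DY = "\<lambda>x. frechet_derivative Y (at x)"
  define h' where "h' x = - (\<Sum>b\<in>Basis. ?DY x b \<bullet> b)" for x
  have DY: "(Y has_derivative ?DY x) (at x)" for x using smooth_on_UNIV_has_derivative[OF Y] .
  have DY0: "?DY x b = 0" if "x \<notin> K" for x b
  proof -
    have "(Y has_derivative (\<lambda>_. 0)) (at x)"
      using that Y0 openK by (intro has_derivative_transform_within_open[of "\<lambda>_. 0" "\<lambda>_. 0" x UNIV "- K" Y]) auto
    then show ?thesis using has_derivative_unique[OF DY] by metis
  qed
  have "smooth_on h' UNIV"
    unfolding h'_def[abs_def]
    by (intro smooth_on_minus smooth_on_sum smooth_on_inner smooth_on_frechet_derivative Y open_UNIV smooth_on_const)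
  moreover have "h' x = 0" if "x \<notin> K" for x using DY0[OF that] by (simp add: h'_def)
  moreover have "(\<integral>x. h x *\<^sub>R pd j F (q x) \<partial>lborel) = (\<integral>x. h' x *\<^sub>R F (q x) \<partial>lborel)" if F: "smooth_on F UNIV" for F
  proof -
    let ?Dq = "\<lambda>x. frechet_derivative q (at x)" and ?DF = "\<lambda>z. frechet_derivative F (at z)"
    \<comment> \<open>\<open>v b\<close> is the derivative along \<open>b\<close> of
      \<open>(Y x \<bullet> b) *\<^sub>R F (q x)\<close>, so its integral vanishes. The sum over
      \<open>b\<close> is the divergence of \<open>F (q x)\<close> times \<open>Y\<close>, which
      splits into the two sides of the claim.\<close>
    define v where "v b x = (Y x \<bullet> b) *\<^sub>R ?DF (q x) (?Dq x b) + (?DY x b \<bullet> b) *\<^sub>R F (q x)" for b x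
    have Fq: "smooth_on (\<lambda>x. F (q x)) UNIV" by (rule smooth_on_compose[OF open_UNIV open_UNIV _ q F]) auto
    have DFq: "((\<lambda>x. F (q x)) has_derivative (\<lambda>h. ?DF (q x) (?Dq x h))) (at x)" for x
      using diff_chain_at[OF smooth_on_UNIV_has_derivative[OF q] smooth_on_UNIV_has_derivative[OF F]] by (simp add: o_def)
    have contv: "continuous_on UNIV (v b)" for b
    proof -
      have "continuous_on UNIV (\<lambda>x. frechet_derivative (\<lambda>x. F (q x)) (at x) b)"
        by (intro smooth_on_continuous smooth_on_frechet_derivative open_UNIV Fq)
      then have "continuous_on UNIV (\<lambda>x. ?DF (q x) (?Dq x b))"
        unfolding frechet_derivative_at[OF DFq, symmetric] .
      then show ?thesis
        unfolding v_def[abs_def]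
        by (intro continuous_intros smooth_on_continuous[OF Y] smooth_on_continuous[OF Fq]
            smooth_on_continuous[OF smooth_on_frechet_derivative[OF open_UNIV Y]])
    qed
    have v0: "v b x = 0" if "x \<notin> K" for b x
      using Y0[OF that] DY0[OF that] by (simp add: v_def)
    have int_v: "integrable lborel (v b)" for b
      by (rule integrable_continuous_compact_support[OF contv K(1) v0])
    have "(\<integral>x. v b x \<partial>lborel) = 0" for b
    proof -
      have "((\<lambda>x. (Y x \<bullet> b) *\<^sub>R F (q x)) has_derivative (\<lambda>h. (Y x \<bullet> b) *\<^sub>R ?DF (q x) (?Dq x h) + (?DY x h \<bullet> b) *\<^sub>R F (q x))) (at x)" for x
        by (rule has_derivative_scaleR[OF has_derivative_inner_left[OF DY] DFq])
      from integral_directional_derivative_eq_0[OF this contv[unfolded v_def[abs_def]] K(1)]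
      show ?thesis using Y0 by (simp add: v_def)
    qed
    then have "(\<integral>x. (\<Sum>b\<in>Basis. v b x) \<partial>lborel) = 0"
      using int_v by simp
    moreover have "(\<Sum>b\<in>Basis. v b x) = h x *\<^sub>R pd j F (q x) - h' x *\<^sub>R F (q x)" for x
    proof -
      have lin: "linear (\<lambda>h. ?DF (q x) (?Dq x h))" using DFq has_derivative_linear by blast
      have "(\<Sum>b\<in>Basis. (Y x \<bullet> b) *\<^sub>R ?DF (q x) (?Dq x b)) = ?DF (q x) (?Dq x (Y x))"
        by (rule linear_Basis_expansion[OF lin, symmetric])
      also have "\<dots> = h x *\<^sub>R pd j F (q x)"
      proof (cases "x \<in> K")
        case True
        have "?Dq x (right_inv q x j) = j"
          by (rule derivative_right_inv[OF has_derivative_linear[OF smooth_on_UNIV_has_derivative[OF q]] gram[OF True]])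
        then show ?thesis unfolding Y_def linear_cmul[OF lin] by simp
      next
        case False
        then show ?thesis using K(2) Y0 linear_0[OF lin] by simp
      qed
      finally show ?thesis by (simp add: v_def sum.distrib h'_def scaleR_sum_left)
    qed
    moreover have "integrable lborel (\<lambda>x. h x *\<^sub>R pd j F (q x))"
    proof (rule integrable_continuous_compact_support[OF _ K(1)])
      have "continuous_on UNIV (pd j F)" by (intro smooth_on_continuous smooth_on_frechet_derivative F open_UNIV)
      then show "continuous_on UNIV (\<lambda>x. h x *\<^sub>R pd j F (q x))"
        by (intro continuous_on_scaleR smooth_on_continuous[OF h] continuous_on_compose2[OF _ smooth_on_continuous[OF q]]) auto
    qed (use K in auto)
    moreover have "integrable lborel (\<lambda>x. h' x *\<^sub>R F (q x))"
      by (rule integrable_continuous_compact_support[OF _ K(1)])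
        (use \<open>\<And>x. x \<notin> K \<Longrightarrow> h' x = 0\<close> in \<open>auto intro!: continuous_on_scaleR smooth_on_continuous[OF \<open>smooth_on h' UNIV\<close>] smooth_on_continuous[OF Fq]\<close>)
    ultimately show ?thesis by simp
  qed
  ultimately show ?thesis by blast
qed

text \<open>Cauchy's formula for the twice iterated antiderivative in direction \<open>b\<close>. It inverts the second derivative
  at points whose translates by \<open>- L b\<close> lie outside the support.\<close>

definition antideriv2 :: "complex \<Rightarrow> real \<Rightarrow> (complex \<Rightarrow> complex) \<Rightarrow> complex \<Rightarrow> complex" where
  "antideriv2 b L g \<zeta> = integral (cbox 0 L) (\<lambda>t. t *\<^sub>R g (\<zeta> - t *\<^sub>R b))"

lemma antideriv2_has_derivative:
  assumes g: "smooth_on g UNIV"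
  shows "(antideriv2 b L g has_derivative (\<lambda>v. antideriv2 b L (pd v g) \<zeta>)) (at \<zeta>)"
proof -
  let ?Dg = "\<lambda>z. frechet_derivative g (at z)"
  have Dg: "(g has_derivative ?Dg z) (at z)" for z using smooth_on_UNIV_has_derivative[OF g] .
  define B where "B z = Blinfun (?Dg z)" for z
  have B: "blinfun_apply (B z) = ?Dg z" for z
    unfolding B_def using has_derivative_bounded_linear[OF Dg] bounded_linear_Blinfun_apply by blast
  have contB: "continuous_on UNIV B"
    by (rule continuous_on_blinfun_componentwise)
       (simp add: B smooth_on_continuous[OF smooth_on_frechet_derivative[OF open_UNIV g]])
  have contg: "continuous_on UNIV g" by (rule smooth_on_continuous[OF g])
  have slice: "continuous_on A (\<lambda>t. t *\<^sub>R B (\<zeta> - t *\<^sub>R b))" for A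
    by (intro continuous_on_scaleR continuous_on_compose2[OF contB]) (auto intro!: continuous_intros)
  have "(antideriv2 b L g has_derivative blinfun_apply (integral (cbox 0 L) (\<lambda>t. t *\<^sub>R B (\<zeta> - t *\<^sub>R b)))) (at \<zeta> within UNIV)"
    unfolding antideriv2_def[abs_def]
  proof (rule leibniz_rule)
    fix z t
    have "((\<lambda>z. g (z - t *\<^sub>R b)) has_derivative ?Dg (z - t *\<^sub>R b)) (at z)"
      by (rule has_derivative_compose[of "\<lambda>z. z - t *\<^sub>R b" "\<lambda>h. h" z UNIV g, OF _ Dg]) (auto intro!: derivative_eq_intros)
    then have "((\<lambda>z. t *\<^sub>R g (z - t *\<^sub>R b)) has_derivative (\<lambda>h. t *\<^sub>R ?Dg (z - t *\<^sub>R b) h)) (at z)"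
      by (rule has_derivative_scaleR_right)
    moreover have "blinfun_apply (t *\<^sub>R B (z - t *\<^sub>R b)) = (\<lambda>h. t *\<^sub>R ?Dg (z - t *\<^sub>R b) h)"
      by (rule ext) (simp add: scaleR_blinfun.rep_eq B)
    ultimately show "((\<lambda>z. t *\<^sub>R g (z - t *\<^sub>R b)) has_derivative blinfun_apply (t *\<^sub>R B (z - t *\<^sub>R b))) (at z within UNIV)"
      by simp
    show "(\<lambda>t. t *\<^sub>R g (z - t *\<^sub>R b)) integrable_on cbox 0 L"
      by (intro integrable_continuous continuous_on_scaleR continuous_on_compose2[OF contg]) (auto intro!: continuous_intros)
  next
    show "continuous_on (UNIV \<times> cbox 0 L) (\<lambda>(z, t). t *\<^sub>R B (z - t *\<^sub>R b))"
      unfolding split_beta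
      by (intro continuous_on_scaleR continuous_on_compose2[OF contB]) (auto intro!: continuous_intros)
  qed auto
  moreover have "blinfun_apply (integral (cbox 0 L) (\<lambda>t. t *\<^sub>R B (\<zeta> - t *\<^sub>R b))) v = antideriv2 b L (pd v g) \<zeta>" for v
    unfolding antideriv2_def
    by (subst blinfun_apply_integral[OF integrable_continuous[OF slice]]) (simp add: scaleR_blinfun.rep_eq B)
  then have "blinfun_apply (integral (cbox 0 L) (\<lambda>t. t *\<^sub>R B (\<zeta> - t *\<^sub>R b))) = (\<lambda>v. antideriv2 b L (pd v g) \<zeta>)"
    by (rule ext)
  ultimately show ?thesis by simp
qed

lemma smooth_on_antideriv2: "smooth_on g UNIV \<Longrightarrow> smooth_on (antideriv2 b L g) UNIV"
proof (rule smooth_onI[where F = "{antideriv2 b L g |g. smooth_on g UNIV}"])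
  fix f assume "f \<in> {antideriv2 b L g |g. smooth_on g UNIV}"
  then obtain g where "smooth_on g UNIV" "f = antideriv2 b L g" by blast
  then show "\<exists>f'. (\<forall>x\<in>UNIV. (f has_derivative f' x) (at x)) \<and> (\<forall>v\<in>Basis. (\<lambda>x. f' x v) \<in> {antideriv2 b L g |g. smooth_on g UNIV})"
    using antideriv2_has_derivative[of g b L] smooth_on_frechet_derivative[OF open_UNIV, of g]
    by (intro exI[of _ "\<lambda>x v. antideriv2 b L (pd v g) x"]) auto
qed auto

lemma pd_antideriv2: "smooth_on g UNIV \<Longrightarrow> pd v (antideriv2 b L g) = antideriv2 b L (pd v g)"
  by (rule ext) (metis antideriv2_has_derivative frechet_derivative_at)

text \<open>Taylor's formula with integral remainder on the segment from
  \<open>\<zeta> - L *\<^sub>R b\<close> to \<zeta>. The last two terms are the boundary terms,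
  which later vanish when the starting point is far away.\<close>

lemma antideriv2_pd_pd:
  assumes g: "smooth_on g UNIV" and L: "L \<ge> 0"
  shows "antideriv2 b L (pd b (pd b g)) \<zeta> = g \<zeta> - g (\<zeta> - L *\<^sub>R b) - L *\<^sub>R pd b g (\<zeta> - L *\<^sub>R b)"
proof -
  let ?A = "\<lambda>t. - (t *\<^sub>R pd b g (\<zeta> - t *\<^sub>R b)) - g (\<zeta> - t *\<^sub>R b)"
  have g1: "smooth_on (pd b g) UNIV" using smooth_on_frechet_derivative[OF open_UNIV g] .
  have comp: "((\<lambda>t. G (\<zeta> - t *\<^sub>R b)) has_vector_derivative - pd b G (\<zeta> - t *\<^sub>R b)) (at t)" if "smooth_on G UNIV" for G t
  proof -
    have "((\<lambda>t. G (\<zeta> - t *\<^sub>R b)) has_derivative (\<lambda>h. frechet_derivative G (at (\<zeta> - t *\<^sub>R b)) (- (h *\<^sub>R b)))) (at t)"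
      by (rule has_derivative_compose[OF _ smooth_on_UNIV_has_derivative[OF that]]) (auto intro!: derivative_eq_intros)
    moreover have "linear (frechet_derivative G (at (\<zeta> - t *\<^sub>R b)))"
      using smooth_on_UNIV_has_derivative[OF that] has_derivative_linear by blast
    ultimately show ?thesis by (simp add: has_vector_derivative_def linear_neg linear_cmul)
  qed
  have "((\<lambda>t. t *\<^sub>R pd b (pd b g) (\<zeta> - t *\<^sub>R b)) has_integral (?A L - ?A 0)) {0..L}"
  proof (rule fundamental_theorem_of_calculus[OF L])
    fix t :: real
    have "(?A has_vector_derivative - (t *\<^sub>R (- pd b (pd b g) (\<zeta> - t *\<^sub>R b)) + 1 *\<^sub>R pd b g (\<zeta> - t *\<^sub>R b)) - (- pd b g (\<zeta> - t *\<^sub>R b))) (at t)"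
      by (intro has_vector_derivative_diff has_vector_derivative_minus has_vector_derivative_scaleR comp g g1) (rule DERIV_ident)
    then show "(?A has_vector_derivative t *\<^sub>R pd b (pd b g) (\<zeta> - t *\<^sub>R b)) (at t within {0..L})"
      by (simp add: has_vector_derivative_at_within)
  qed
  then show ?thesis unfolding antideriv2_def by (simp add: integral_unique)
qed


text \<open>Lebesgue measure is determined by its values on boxes, and boxes in the complex plane
  are products of intervals. This makes iterated integrals over real and imaginary part
  available.\<close>

lemma lborel_complex_eq_distr: "(lborel :: complex measure) = distr lborel borel (\<lambda>p. Complex (fst p) (snd p))"
proof (rule lborel_eqI)
  fix l u :: complex assume lu: "\<And>b. b \<in> Basis \<Longrightarrow> l \<bullet> b \<le> u \<bullet> b"
  have meas: "(\<lambda>p. Complex (fst p) (snd p)) \<in> borel_measurable borel"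
    by (intro borel_measurable_continuous_onI) (simp add: Complex_eq continuous_intros)
  have le: "Re l \<le> Re u" "Im l \<le> Im u" using lu[of 1] lu[of \<i>] by (auto simp: Basis_complex_def inner_complex_def)
  have "(\<lambda>p. Complex (fst p) (snd p)) -` box l u \<inter> space lborel = box (Re l, Im l) (Re u, Im u)"
    by (auto simp: box_def Basis_complex_def Basis_prod_def inner_complex_def)
  then have "emeasure (distr lborel borel (\<lambda>p. Complex (fst p) (snd p))) (box l u) = emeasure lborel (box (Re l, Im l) (Re u, Im u))"
    using meas by (subst emeasure_distr) auto
  also have "\<dots> = (Re u - Re l) * (Im u - Im l)"
    using le by (subst emeasure_lborel_box) (auto simp: Basis_prod_def prod.union_disjoint image_def)
  also have "\<dots> = (\<Prod>b\<in>Basis. (u - l) \<bullet> b)"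
    by (simp add: Basis_complex_def inner_complex_def)
  finally show "emeasure (distr lborel borel (\<lambda>p. Complex (fst p) (snd p))) (box l u) = (\<Prod>b\<in>Basis. (u - l) \<bullet> b)" .
qed simp

lemma integral_complex_iterated:
  fixes f :: "complex \<Rightarrow> complex"
  assumes f: "continuous_on UNIV f" and L: "\<And>x y. x \<notin> {0..L} \<or> y \<notin> {0..L} \<Longrightarrow> f (Complex x y) = 0"
  shows "(\<integral>z. f z \<partial>lborel) = integral (cbox 0 L) (\<lambda>x. integral (cbox 0 L) (\<lambda>y. f (Complex x y)))"
proof -
  have cC: "continuous_on UNIV (\<lambda>p. Complex (fst p) (snd p))" by (simp add: Complex_eq continuous_intros)
  have cf: "continuous_on UNIV (\<lambda>p. f (Complex (fst p) (snd p)))" by (rule continuous_on_compose2[OF f cC]) auto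
  have "(\<integral>z. f z \<partial>lborel) = (\<integral>p. f (Complex (fst p) (snd p)) \<partial>lborel)"
    by (subst lborel_complex_eq_distr, rule integral_distr)
       (use borel_measurable_continuous_onI[OF cC] borel_measurable_continuous_onI[OF f] in auto)
  also have "\<dots> = integral (cbox (0, 0) (L, L)) (\<lambda>p. f (Complex (fst p) (snd p)))"
  proof (rule lborel_integral_eq_cbox[OF cf])
    fix p :: "real \<times> real" assume "p \<notin> cbox (0, 0) (L, L)"
    then have "fst p \<notin> {0..L} \<or> snd p \<notin> {0..L}" by (cases p) (auto simp: cbox_Pair_eq)
    then show "f (Complex (fst p) (snd p)) = 0" by (rule L)
  qed
  also have "\<dots> = integral (cbox 0 L) (\<lambda>x. integral (cbox 0 L) (\<lambda>y. f (Complex x y)))"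
    by (subst integral_prod_continuous) (use continuous_on_subset[OF cf] in auto)
  finally show ?thesis .
qed

lemma lborel_integral_reflect:
  fixes f :: "'a::euclidean_space \<Rightarrow> 'b::euclidean_space"
  assumes "f \<in> borel_measurable borel"
  shows "(\<integral>x. f (c - x) \<partial>lborel) = (\<integral>x. f x \<partial>lborel)"
proof -
  have "(\<integral>x. f x \<partial>lborel) = (\<integral>x. f x \<partial>(distr lborel borel (\<lambda>x. c + (-1) *\<^sub>R x)))"
    using lborel_affine[of "-1" c] by (simp add: density_1)
  also have "\<dots> = (\<integral>x. f (c + (-1) *\<^sub>R x) \<partial>lborel)"
    by (rule integral_distr) (use assms in auto)
  finally show ?thesis by simp
qed

text \<open>Two integrations by parts along 1 and two along \<i> trade \<open>g\<close> for an
  iterated antiderivative \<open>F\<close>, which is the convolution of \<open>g\<close> with a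
  continuous kernel. Fubini then exhibits the density as an integral of that kernel against the new
  weight, and continuity of the kernel passes to the density.\<close>

lemma pushforward_continuous_density:
  fixes q :: "'a::euclidean_space \<Rightarrow> complex" and h :: "'a \<Rightarrow> real"
  assumes q: "smooth_on q UNIV" and h: "smooth_on h UNIV" and K: "compact K" "\<And>x. x \<notin> K \<Longrightarrow> h x = 0"
    and gram: "\<And>x. x \<in> K \<Longrightarrow> gram q x \<noteq> 0" and R: "\<And>x. x \<in> K \<Longrightarrow> cmod (q x) \<le> R"
  shows "\<exists>w. continuous_on UNIV w \<and> (\<forall>(g :: complex \<Rightarrow> complex) M. smooth_on g UNIV \<longrightarrow> (\<forall>z. cmod z > M \<longrightarrow> g z = 0) \<longrightarrow>
    (\<integral>x. h x *\<^sub>R g (q x) \<partial>lborel) = (\<integral>z. g z * of_real (w z) \<partial>lborel))"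
proof -
  obtain h1 where h1: "smooth_on h1 UNIV" "\<And>x. x \<notin> K \<Longrightarrow> h1 x = 0"
    "\<And>F. smooth_on F UNIV \<Longrightarrow> (\<integral>x. h x *\<^sub>R pd 1 F (q x) \<partial>lborel) = (\<integral>x. h1 x *\<^sub>R F (q x) \<partial>lborel)"
    using submersion_integration_by_parts[OF q h K gram, of 1] by blast
  obtain h2 where h2: "smooth_on h2 UNIV" "\<And>x. x \<notin> K \<Longrightarrow> h2 x = 0"
    "\<And>F. smooth_on F UNIV \<Longrightarrow> (\<integral>x. h1 x *\<^sub>R pd 1 F (q x) \<partial>lborel) = (\<integral>x. h2 x *\<^sub>R F (q x) \<partial>lborel)"
    using submersion_integration_by_parts[OF q h1(1) K(1) h1(2) gram, of 1] by blast
  obtain h3 where h3: "smooth_on h3 UNIV" "\<And>x. x \<notin> K \<Longrightarrow> h3 x = 0"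
    "\<And>F. smooth_on F UNIV \<Longrightarrow> (\<integral>x. h2 x *\<^sub>R pd \<i> F (q x) \<partial>lborel) = (\<integral>x. h3 x *\<^sub>R F (q x) \<partial>lborel)"
    using submersion_integration_by_parts[OF q h2(1) K(1) h2(2) gram, of \<i>] by blast
  obtain h4 where h4: "smooth_on h4 UNIV" "\<And>x. x \<notin> K \<Longrightarrow> h4 x = 0"
    "\<And>F. smooth_on F UNIV \<Longrightarrow> (\<integral>x. h3 x *\<^sub>R pd \<i> F (q x) \<partial>lborel) = (\<integral>x. h4 x *\<^sub>R F (q x) \<partial>lborel)"
    using submersion_integration_by_parts[OF q h3(1) K(1) h3(2) gram, of \<i>] by blast
  have h4F: "(\<integral>x. h x *\<^sub>R pd 1 (pd 1 (pd \<i> (pd \<i> F))) (q x) \<partial>lborel) = (\<integral>x. h4 x *\<^sub>R F (q x) \<partial>lborel)" if F: "smooth_on F UNIV" for F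
  proof -
    note sm = smooth_on_frechet_derivative[OF open_UNIV]
    have sm': "smooth_on (pd \<i> F) UNIV" "smooth_on (pd \<i> (pd \<i> F)) UNIV" "smooth_on (pd 1 (pd \<i> (pd \<i> F))) UNIV"
      by (intro sm F)+
    show ?thesis
      unfolding h1(3)[OF sm'(3)] h2(3)[OF sm'(2)] h3(3)[OF sm'(1)] h4(3)[OF F] ..
  qed
  have contq: "continuous_on A q" for A using smooth_on_continuous[OF q] continuous_on_subset by blast
  have conth4: "continuous_on A h4" for A using smooth_on_continuous[OF h4(1)] continuous_on_subset by blast
  \<comment> \<open>A fundamental solution of the operator that differentiates twice along 1 and
    twice along \<i>. Two derivatives in each direction are what makes it continuous; with one it
    would be the indicator function of a quadrant.\<close>
  define k where "k z = max 0 (Re z) * max 0 (Im z)" for z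
  have contk: "continuous_on A k" for A unfolding k_def by (intro continuous_intros)
  define w where "w z = (\<integral>x. k (q x - z) * h4 x \<partial>lborel)" for z
  obtain a where a: "\<And>x s. x + s \<in> K \<Longrightarrow> norm s \<le> 0 \<Longrightarrow> x \<in> cbox (-a) a"
    using compact_cbox_bound[OF K(1), of 0] by blast
  have a': "h4 x = 0" if "x \<notin> cbox (-a) a" for x using a[of x 0] that h4(2) by auto
  have "w z = integral (cbox (-a) a) (\<lambda>x. k (q x - z) * h4 x)" for z
    unfolding w_def using a'
    by (intro lborel_integral_eq_cbox continuous_on_mult continuous_on_compose2[OF contk[of UNIV]] continuous_on_diff contq conth4 continuous_on_const) auto
  moreover have "continuous_on UNIV (\<lambda>z. integral (cbox (-a) a) (\<lambda>x. k (q x - z) * h4 x))"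
    by (rule integral_continuous_on_param, unfold split_beta)
       (intro continuous_on_mult continuous_on_compose2[OF contk[of UNIV]] continuous_on_diff continuous_on_compose2[OF contq[of UNIV]]
          continuous_on_compose2[OF conth4[of UNIV]] continuous_on_snd continuous_on_fst continuous_on_id; simp)
  ultimately have contw: "continuous_on UNIV w" by simp
  have "(\<integral>x. h x *\<^sub>R g (q x) \<partial>lborel) = (\<integral>z. g z * of_real (w z) \<partial>lborel)"
    if g: "smooth_on g UNIV" and M: "\<And>z. cmod z > M \<Longrightarrow> g z = 0" for g :: "complex \<Rightarrow> complex" and M :: real
  proof -
    have contg: "continuous_on A g" for A using smooth_on_continuous[OF g] continuous_on_subset by blast
    \<comment> \<open>Translating a point of the disc of radius \<open>\<bar>R\<bar>\<close> by at
      least \<open>L\<close> in a coordinate direction takes it strictly outside the disc of radius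
      \<open>M\<close>, so all boundary terms vanish.\<close>
    define L where "L = \<bar>R\<bar> + \<bar>M\<bar> + 1"
    have L: "L \<ge> 0" by (simp add: L_def)
    have far: "g (\<zeta> - t *\<^sub>R b - s *\<^sub>R c) = 0" if "cmod \<zeta> \<le> \<bar>R\<bar>" "t \<ge> L" "(b, c) \<in> {(1, \<i>), (\<i>, 1)}" for \<zeta> t s b c
    proof -
      have "cmod (\<zeta> - t *\<^sub>R b - s *\<^sub>R c) \<ge> t - cmod \<zeta>"
      proof (cases "b = 1")
        case True
        then show ?thesis using that(3) abs_Re_le_cmod[of "\<zeta> - t *\<^sub>R b - s *\<^sub>R c"] abs_Re_le_cmod[of \<zeta>] by auto
      next
        case False
        then show ?thesis using that(3) abs_Im_le_cmod[of "\<zeta> - t *\<^sub>R b - s *\<^sub>R c"] abs_Im_le_cmod[of \<zeta>] by auto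
      qed
      then have "cmod (\<zeta> - t *\<^sub>R b - s *\<^sub>R c) > M" using that(1,2) by (simp add: L_def)
      then show ?thesis using M by blast
    qed
    have g1: "smooth_on (pd v g) UNIV" for v using smooth_on_frechet_derivative[OF open_UNIV g] .
    have pd0: "pd v f z = 0" if "\<And>z. z \<in> S \<Longrightarrow> f z = 0" "open S" "z \<in> S" for v f z S
    proof -
      have "(f has_derivative (\<lambda>_. 0)) (at z)"
        using that by (intro has_derivative_transform_within_open[of "\<lambda>_. 0" "\<lambda>_. 0" z UNIV S f]) auto
      from frechet_derivative_at[OF this] show ?thesis by metis
    qed
    have M1: "pd v g z = 0" if "cmod z > M" for v z
      by (rule pd0[of "{z. cmod z > M}"]) (use M that in \<open>auto intro!: open_Collect_less continuous_intros\<close>)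
    have M2: "pd u (pd v g) z = 0" if "cmod z > M" for u v z
      by (rule pd0[of "{z. cmod z > M}"]) (use M1 that in \<open>auto intro!: open_Collect_less continuous_intros\<close>)
    \<comment> \<open>Neither compact support nor the differential equation for \<open>F\<close> is
      claimed globally: the values of \<open>q\<close> on \<open>K\<close> lie in the disc of radius
      \<open>\<bar>R\<bar>\<close>, and the weights vanish off \<open>K\<close>.\<close>
    define F where "F = antideriv2 1 L (antideriv2 \<i> L g)"
    have smF: "smooth_on F UNIV" unfolding F_def by (intro smooth_on_antideriv2 g)
    define G where "G = antideriv2 \<i> L (pd \<i> (pd \<i> g))"
    have smG: "smooth_on G UNIV" unfolding G_def by (intro smooth_on_antideriv2 smooth_on_frechet_derivative[OF open_UNIV] g)
    have "pd \<i> (pd \<i> F) = antideriv2 1 L G"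
      unfolding F_def G_def
      by (simp add: pd_antideriv2 smooth_on_antideriv2 smooth_on_frechet_derivative[OF open_UNIV] g)
    then have pdF: "pd 1 (pd 1 (pd \<i> (pd \<i> F))) = antideriv2 1 L (pd 1 (pd 1 G))"
      by (simp add: pd_antideriv2 smG smooth_on_frechet_derivative[OF open_UNIV])
    have 4: "pd 1 (pd 1 (pd \<i> (pd \<i> F))) \<zeta> = g \<zeta>" if \<zeta>: "cmod \<zeta> \<le> \<bar>R\<bar>" for \<zeta>
    proof -
      have big: "cmod (\<zeta> - L *\<^sub>R 1 - s *\<^sub>R \<i>) > M" "cmod (\<zeta> - L *\<^sub>R \<i>) > M" for s
        using \<zeta> abs_Re_le_cmod[of "\<zeta> - L *\<^sub>R 1 - s *\<^sub>R \<i>"] abs_Re_le_cmod[of \<zeta>] abs_Im_le_cmod[of "\<zeta> - L *\<^sub>R \<i>"] abs_Im_le_cmod[of \<zeta>]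
        by (simp_all add: L_def) linarith+
      have zero: "antideriv2 \<i> L f (\<zeta> - L *\<^sub>R 1) = 0" if "\<And>z. cmod z > M \<Longrightarrow> f z = 0" for f
        unfolding antideriv2_def using that big(1) by simp
      have "G \<zeta> = g \<zeta>"
        unfolding G_def antideriv2_pd_pd[OF g L] using M M1 big(2) by simp
      moreover have "G (\<zeta> - L *\<^sub>R 1) = 0" unfolding G_def by (rule zero) (rule M2)
      moreover have "pd 1 G (\<zeta> - L *\<^sub>R 1) = 0"
      proof -
        have "pd 1 (pd \<i> (pd \<i> g)) z = 0" if "cmod z > M" for z
          by (rule pd0[of "{z. cmod z > M}"]) (use M2 that in \<open>auto intro!: open_Collect_less continuous_intros\<close>)
        then show ?thesis
          unfolding G_def fun_cong[OF pd_antideriv2[OF smooth_on_frechet_derivative[OF open_UNIV g1]]] by (rule zero)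
      qed
      ultimately show ?thesis
        unfolding fun_cong[OF pdF] antideriv2_pd_pd[OF smG L] by simp
    qed
    have F_eq: "F \<zeta> = (\<integral>z. of_real (k (\<zeta> - z)) * g z \<partial>lborel)" if \<zeta>: "cmod \<zeta> \<le> \<bar>R\<bar>" for \<zeta>
    proof -
      let ?f = "\<lambda>z. of_real (k z) * g (\<zeta> - z)"
      have cf: "continuous_on UNIV ?f"
        by (intro continuous_on_mult continuous_on_of_real contk continuous_on_compose2[OF contg[of UNIV]] continuous_on_diff continuous_on_const continuous_on_id) auto
      have "?f (Complex x y) = 0" if "x \<notin> {0..L} \<or> y \<notin> {0..L}" for x y
        using that far[OF \<zeta>, of x 1 \<i> y] far[OF \<zeta>, of y \<i> 1 x]
        by (auto simp: k_def Complex_eq scaleR_conv_of_real algebra_simps)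
      from integral_complex_iterated[OF cf this]
      have "(\<integral>z. ?f z \<partial>lborel) = integral (cbox 0 L) (\<lambda>x. integral (cbox 0 L) (\<lambda>y. ?f (Complex x y)))" .
      also have "\<dots> = integral (cbox 0 L) (\<lambda>x. integral (cbox 0 L) (\<lambda>y. x *\<^sub>R (y *\<^sub>R g (\<zeta> - x *\<^sub>R 1 - y *\<^sub>R \<i>))))"
        by (intro integral_cong) (auto simp: k_def Complex_eq scaleR_conv_of_real algebra_simps)
      also have "\<dots> = F \<zeta>"
        unfolding F_def antideriv2_def by (simp only: Henstock_Kurzweil_Integration.integral_cmul)
      also have "(\<integral>z. ?f z \<partial>lborel) = (\<integral>z. of_real (k (\<zeta> - z)) * g z \<partial>lborel)"
        using lborel_integral_reflect[of ?f \<zeta>] borel_measurable_continuous_onI[OF cf] by simp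
      finally show ?thesis by simp
    qed
    let ?H = "\<lambda>x z. of_real (h4 x * k (q x - z)) * g z"
    have "(\<integral>x. h x *\<^sub>R g (q x) \<partial>lborel) = (\<integral>x. h x *\<^sub>R pd 1 (pd 1 (pd \<i> (pd \<i> F))) (q x) \<partial>lborel)"
    proof (rule Bochner_Integration.integral_cong[OF refl])
      fix x
      show "h x *\<^sub>R g (q x) = h x *\<^sub>R pd 1 (pd 1 (pd \<i> (pd \<i> F))) (q x)"
      proof (cases "x \<in> K")
        case True
        then have "cmod (q x) \<le> \<bar>R\<bar>" using R[of x] by simp
        then show ?thesis using 4 by simp
      qed (use K in simp)
    qed
    also have "\<dots> = (\<integral>x. h4 x *\<^sub>R F (q x) \<partial>lborel)" by (rule h4F[OF smF])
    also have "\<dots> = (\<integral>x. (\<integral>z. ?H x z \<partial>lborel) \<partial>lborel)"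
    proof (rule Bochner_Integration.integral_cong[OF refl])
      fix x
      show "h4 x *\<^sub>R F (q x) = (\<integral>z. ?H x z \<partial>lborel)"
      proof (cases "x \<in> K")
        case True
        then have "cmod (q x) \<le> \<bar>R\<bar>" using R[of x] by simp
        then show ?thesis using F_eq[of "q x"] by (simp add: scaleR_conv_of_real mult.assoc)
      qed (use h4 in simp)
    qed
    also have "\<dots> = (\<integral>z. (\<integral>x. ?H x z \<partial>lborel) \<partial>lborel)"
    proof (rule lborel_pair.Fubini_integral[symmetric])
      have "integrable lborel (\<lambda>y. ?H (fst y) (snd y))"
      proof (rule integrable_continuous_compact_support)
        show "compact (K \<times> cball (0::complex) M)" using K(1) by (intro compact_Times) auto
        show "continuous_on UNIV (\<lambda>y. ?H (fst y) (snd y))"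
          by (intro continuous_on_mult continuous_on_of_real continuous_on_compose2[OF contk[of UNIV]] continuous_on_compose2[OF contq[of UNIV]]
             continuous_on_compose2[OF conth4[of UNIV]] continuous_on_compose2[OF contg[of UNIV]] continuous_on_diff continuous_on_fst continuous_on_snd continuous_on_id; simp)
        show "?H (fst y) (snd y) = 0" if "y \<notin> K \<times> cball 0 M" for y
        proof (cases "fst y \<in> K")
          case True
          then have "cmod (snd y) > M" using that by (auto simp: mem_Times_iff)
          then show ?thesis using M by simp
        qed (use h4 in simp)
      qed
      then show "integrable (lborel \<Otimes>\<^sub>M lborel) (\<lambda>(x, z). ?H x z)" by (simp add: lborel_prod split_beta')
    qed
    also have "\<dots> = (\<integral>z. g z * of_real (w z) \<partial>lborel)"
    proof (rule Bochner_Integration.integral_cong[OF refl])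
      fix z
      have "(\<integral>x. ?H x z \<partial>lborel) = (\<integral>x. of_real (k (q x - z) * h4 x) \<partial>lborel) * g z"
        by (subst integral_mult_left_zero[symmetric]) (simp add: mult.commute)
      also have "(\<integral>x. complex_of_real (k (q x - z) * h4 x) \<partial>lborel) = of_real (w z)"
        unfolding w_def
      proof (rule integral_of_real)
        show "integrable lborel (\<lambda>x. k (q x - z) * h4 x)"
          by (rule integrable_continuous_compact_support[OF _ K(1)])
            (use h4(2) in \<open>auto intro!: continuous_on_mult continuous_on_compose2[OF contk[of UNIV]] continuous_on_diff contq conth4 continuous_on_const\<close>)
      qed
      finally show "(\<integral>x. ?H x z \<partial>lborel) = g z * of_real (w z)" by simp
    qed
    finally show ?thesis .
  qed
  with contw show ?thesis by blast
qed

section \<open>Bump functions and existence of the Weyl density\<close>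

text \<open>The usual flat function divided by \<open>u ^ k\<close>. With the extra power the
  derivative is a linear combination of members of the same family, so smoothness can be proved by
  one induction over all \<open>k\<close>.\<close>

definition flat_exp :: "real \<Rightarrow> nat \<Rightarrow> real \<Rightarrow> real" where
  "flat_exp a k u = (if u > 0 then exp (- a / u) / u ^ k else 0)"

lemma power_div_fact_le_exp:
  assumes "x \<ge> (0::real)"
  shows "x ^ m / fact m \<le> exp x"
proof -
  have "(\<Sum>n\<in>{m}. x ^ n /\<^sub>R fact n) \<le> (\<Sum>n. x ^ n /\<^sub>R fact n)"
    by (rule sum_le_suminf) (use assms summable_exp_generic[of x] in auto)
  then show ?thesis by (simp add: exp_def divide_inverse mult.commute)
qed

text \<open>Keeping a single term of the exponential series for \<open>exp (a / u)\<close>, the one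
  of degree \<open>k + 2\<close>, beats the pole of order \<open>k\<close> and leaves
  \<open>u\<^sup>2\<close>. A quadratic bound is what makes the difference quotient at 0 tend to
  0.\<close>

lemma flat_exp_le:
  assumes "a > 0"
  shows "\<bar>flat_exp a k u\<bar> \<le> fact (k + 2) / a ^ (k + 2) * u\<^sup>2"
proof (cases "u > 0")
  case True
  define c where "c = (fact (k + 2) :: real)"
  define e where "e = exp (a / u)"
  have pos: "c > 0" "e > 0" by (simp_all add: c_def e_def)
  have "(a / u) ^ (k + 2) / c \<le> e"
    unfolding c_def e_def by (rule power_div_fact_le_exp) (use assms True in simp)
  then have "a ^ (k + 2) \<le> c * e * u ^ (k + 2)"
    using pos True by (simp only: power_divide divide_divide_eq_left pos_divide_le_eq zero_less_power mult_pos_pos) (simp only: ac_simps)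
  then have 1: "1 / e \<le> c * u ^ (k + 2) / a ^ (k + 2)"
    using pos assms by (simp only: pos_divide_le_eq pos_le_divide_eq zero_less_power times_divide_eq_left mult_1) (simp only: ac_simps)
  have "exp (- a / u) / u ^ k = 1 / e / u ^ k" by (simp add: e_def exp_minus inverse_eq_divide)
  also have "\<dots> \<le> c * u ^ (k + 2) / a ^ (k + 2) / u ^ k" using 1 True by (intro divide_right_mono) auto
  also have "\<dots> = fact (k + 2) / a ^ (k + 2) * u\<^sup>2"
    unfolding c_def using True by (simp only: power_add[of u]) simp
  finally show ?thesis using True by (simp add: flat_exp_def)
qed (use assms in \<open>simp add: flat_exp_def\<close>)

lemma flat_exp_has_real_derivative:
  assumes "a > 0"
  shows "(flat_exp a k has_real_derivative a * flat_exp a (k + 2) u - real k * flat_exp a (k + 1) u) (at u)"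
proof -
  consider "u > 0" | "u < 0" | "u = 0" by linarith
  then show ?thesis
  proof cases
    case 1
    have "((\<lambda>u. exp (- a / u) / u ^ k) has_real_derivative
        (exp (- a / u) * (a / u\<^sup>2) * u ^ k - exp (- a / u) * (real k * u ^ (k - 1))) / (u ^ k * u ^ k)) (at u)"
      using 1 by (auto intro!: derivative_eq_intros simp: power2_eq_square)
    also have "(exp (- a / u) * (a / u\<^sup>2) * u ^ k - exp (- a / u) * (real k * u ^ (k - 1))) / (u ^ k * u ^ k)
       = a * flat_exp a (k + 2) u - real k * flat_exp a (k + 1) u"
    proof (cases k)
      case 0
      then show ?thesis using 1 by (simp add: flat_exp_def power2_eq_square)
    next
      case (Suc j)
      then show ?thesis using 1
        by (simp add: flat_exp_def power2_eq_square divide_simps) (simp add: algebra_simps)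
    qed
    finally show ?thesis
      by (rule has_field_derivative_transform_within_open[where S = "{0<..}"]) (use 1 in \<open>auto simp: flat_exp_def\<close>)
  next
    case 2
    have "((\<lambda>u. 0) has_real_derivative 0) (at u)" by simp
    then have "(flat_exp a k has_real_derivative 0) (at u)"
      by (rule has_field_derivative_transform_within_open[where S = "{..<0}"]) (use 2 in \<open>auto simp: flat_exp_def\<close>)
    then show ?thesis using 2 by (simp add: flat_exp_def)
  next
    case 3
    define c where "c = fact (k + 2) / a ^ (k + 2)"
    have le: "\<bar>flat_exp a k h\<bar> \<le> c * h\<^sup>2" for h using flat_exp_le[OF assms] by (simp add: c_def)
    have "\<forall>\<^sub>F h in at 0. norm (flat_exp a k h / h) \<le> c * \<bar>h\<bar>"
      using eventually_neq_at_within
    proof (rule eventually_mono)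
      fix h :: real assume "h \<noteq> 0"
      then have "norm (flat_exp a k h / h) \<le> c * h\<^sup>2 / \<bar>h\<bar>" using le[of h] by (simp add: divide_right_mono abs_divide)
      also have "\<dots> = c * \<bar>h\<bar>" using \<open>h \<noteq> 0\<close> by (simp add: power2_eq_square abs_if)
      finally show "norm (flat_exp a k h / h) \<le> c * \<bar>h\<bar>" .
    qed
    moreover have "((\<lambda>h. c * \<bar>h\<bar>) \<longlongrightarrow> 0) (at 0)"
      by (auto intro!: tendsto_eq_intros)
    ultimately have "((\<lambda>h. flat_exp a k h / h) \<longlongrightarrow> 0) (at 0)" by (rule Lim_null_comparison)
    then have "(flat_exp a k has_real_derivative 0) (at 0)"
      by (simp add: DERIV_def flat_exp_def)
    then show ?thesis using 3 by (simp add: flat_exp_def)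
  qed
qed

lemma flat_exp_pos: "u > 0 \<Longrightarrow> flat_exp a k u > 0"
  by (simp add: flat_exp_def)

lemma smooth_on_flat_exp:
  assumes "a > 0"
  shows "smooth_on (flat_exp a k) UNIV"
proof -
  have "C_diff n (flat_exp a k) UNIV" for n
  proof (induction n arbitrary: k)
    case 0
    show ?case
      using flat_exp_has_real_derivative[OF assms] by (auto intro!: continuous_at_imp_continuous_on DERIV_isCont)
  next
    case (Suc n)
    show ?case
    proof (rule C_diff_SucI)
      show "(flat_exp a k has_derivative (\<lambda>v. (a * flat_exp a (k + 2) u - real k * flat_exp a (k + 1) u) * v)) (at u)" for u
        using flat_exp_has_real_derivative[OF assms] by (simp add: has_field_derivative_def)
      fix b :: real
      have "C_diff n (\<lambda>u. (a * flat_exp a (k + 2) u + (- real k) * flat_exp a (k + 1) u) * b) UNIV"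
        by (intro C_diff_mult C_diff_add C_diff_const Suc open_UNIV)
      then show "C_diff n (\<lambda>u. (a * flat_exp a (k + 2) u - real k * flat_exp a (k + 1) u) * b) UNIV" by simp
    qed simp
  qed
  then show ?thesis by (simp add: smooth_on_def)
qed

text \<open>\<open>R\<close> is the radius of the support. Large values of \<open>a\<close> shrink
  the disc around 0 in which the Laplacian can be negative.\<close>

definition radial_bump :: "real \<Rightarrow> real \<Rightarrow> complex \<Rightarrow> real" where
  "radial_bump a R z = flat_exp a 0 (R\<^sup>2 - z \<bullet> z)"

lemma smooth_on_radial_bump: "a > 0 \<Longrightarrow> smooth_on (radial_bump a R) UNIV"
  unfolding radial_bump_def[abs_def]
  by (rule smooth_on_compose[OF open_UNIV open_UNIV _ _ smooth_on_flat_exp])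
    (auto intro!: smooth_on_diff smooth_on_inner smooth_on_const smooth_on_ident)

lemma radial_bump_pos: "cmod z < R \<Longrightarrow> radial_bump a R z > 0"
  unfolding radial_bump_def
  by (rule flat_exp_pos) (simp add: power2_norm_eq_inner[symmetric] power_strict_mono)

lemma radial_bump_eq_0: "cmod z \<ge> R \<Longrightarrow> R \<ge> 0 \<Longrightarrow> radial_bump a R z = 0"
  using power_mono[of R "cmod z" 2]
  by (simp add: radial_bump_def flat_exp_def power2_norm_eq_inner[symmetric] not_less)

lemma radial_bump_test_function:
  assumes "a > 0" "R > 0" "cball 0 R \<subseteq> V"
  shows "(\<lambda>z. complex_of_real (radial_bump a R z)) \<in> test_functions V"
proof -
  have "{z. complex_of_real (radial_bump a R z) \<noteq> 0} \<subseteq> cball 0 R"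
    using radial_bump_eq_0[of R] assms(2) by force
  then have "closure {z. complex_of_real (radial_bump a R z) \<noteq> 0} \<subseteq> cball 0 R"
    by (intro closure_minimal) auto
  moreover from this have "compact (closure {z. complex_of_real (radial_bump a R z) \<noteq> 0})"
    using bounded_subset compact_eq_bounded_closed bounded_cball by blast
  ultimately show ?thesis
    using assms(3) smooth_on_bounded_linear[OF open_UNIV bounded_linear_of_real smooth_on_radial_bump[OF assms(1)]]
    by (auto simp: test_functions_def)
qed

text \<open>The push-forward is localized first: the weight \<beta>, a bump function of
  \<open>p\<close>, is positive over \<open>V\<close> and vanishes outside a compact set on which
  \<open>p\<close> is a submersion. Its density is then divided by \<beta>. A test function is
  \<beta> times another one because its support is a compact part of \<open>V\<close>, where \<beta>
  is nonzero.\<close>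

lemma weyl_density_exists:
  fixes p :: "C4 \<Rightarrow> complex"
  assumes q: "smooth_on (\<lambda>\<rho>. p (cplx \<rho>)) UNIV" and "R > 0"
    and K: "compact {\<rho>. cmod (p (cplx \<rho>)) \<le> R}"
    and gram: "\<And>\<rho>. cmod (p (cplx \<rho>)) \<le> R \<Longrightarrow> gram (\<lambda>\<rho>. p (cplx \<rho>)) \<rho> \<noteq> 0"
    and V: "V \<subseteq> ball 0 R"
  shows "\<exists>w. weyl_density V p w"
proof -
  let ?q = "\<lambda>\<rho>. p (cplx \<rho>)"
  define \<beta> where "\<beta> = radial_bump 1 R"
  have \<beta>: "smooth_on \<beta> UNIV" unfolding \<beta>_def by (rule smooth_on_radial_bump) simp
  have \<beta>pos: "\<beta> z > 0" if "cmod z < R" for z unfolding \<beta>_def using radial_bump_pos[OF that] .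
  have \<beta>0: "\<beta> z = 0" if "cmod z \<ge> R" for z unfolding \<beta>_def using radial_bump_eq_0[OF that] \<open>R > 0\<close> by simp
  have "smooth_on (\<lambda>\<rho>. \<beta> (?q \<rho>)) UNIV"
    by (rule smooth_on_compose[OF open_UNIV open_UNIV _ q \<beta>]) auto
  then have "\<exists>w. continuous_on UNIV w \<and> (\<forall>(g :: complex \<Rightarrow> complex) M. smooth_on g UNIV \<longrightarrow> (\<forall>z. cmod z > M \<longrightarrow> g z = 0) \<longrightarrow>
    (\<integral>x. \<beta> (?q x) *\<^sub>R g (?q x) \<partial>lborel) = (\<integral>z. g z * of_real (w z) \<partial>lborel))"
    by (rule pushforward_continuous_density[OF q _ K, of _ R]) (use gram \<beta>0 in simp_all)
  then obtain w where w: "continuous_on UNIV w"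
    "\<And>(g :: complex \<Rightarrow> complex) M. smooth_on g UNIV \<Longrightarrow> (\<And>z. cmod z > M \<Longrightarrow> g z = 0) \<Longrightarrow>
      (\<integral>x. \<beta> (?q x) *\<^sub>R g (?q x) \<partial>lborel) = (\<integral>z. g z * of_real (w z) \<partial>lborel)"
    by blast
  have "weyl_density V p (\<lambda>z. w z / \<beta> z)"
    unfolding weyl_density_def
  proof (intro conjI ballI)
    show "continuous_on V (\<lambda>z. w z / \<beta> z)"
      using V \<beta>pos by (intro continuous_on_divide continuous_on_subset[OF w(1)] continuous_on_subset[OF smooth_on_continuous[OF \<beta>]])
        (force simp: subset_iff)+
    fix f assume "f \<in> test_functions V"
    then have f: "smooth_on f UNIV" and S: "compact (closure {z. f z \<noteq> 0})" "closure {z. f z \<noteq> 0} \<subseteq> V"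
      by (auto simp: test_functions_def)
    define S where "S = closure {z. f z \<noteq> 0}"
    have f0: "f z = 0" if "z \<notin> S" for z using that closure_subset[of "{z. f z \<noteq> 0}"] by (auto simp: S_def)
    have SR: "cmod z < R" if "z \<in> S" for z using that S V by (auto simp: S_def)
    define g where "g z = inverse (\<beta> z) *\<^sub>R f z" for z
    have g0: "g z = 0" if "z \<notin> S" for z using f0[OF that] by (simp add: g_def)
    have openS: "open (- S)" by (simp add: S_def open_Compl)
    have gs: "smooth_on g UNIV"
    proof (rule smooth_on_Union[OF open_UNIV])
      fix z
      show "\<exists>T. open T \<and> z \<in> T \<and> smooth_on g T"
      proof (cases "z \<in> S")
        case True
        have "smooth_on g (ball 0 R)"
          unfolding g_def using \<beta>pos
          by (intro smooth_on_scaleR smooth_on_inverse smooth_on_subset[OF \<beta>] smooth_on_subset[OF f] open_ball) force+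
        then show ?thesis using SR[OF True] by (intro exI[of _ "ball 0 R"]) auto
      next
        case False
        have "smooth_on g (- S) \<longleftrightarrow> smooth_on (\<lambda>z. 0 :: complex) (- S)"
          by (rule smooth_on_cong[OF openS]) (use g0 in auto)
        then show ?thesis using openS False smooth_on_const[OF openS] by blast
      qed
    qed
    have fg: "f z = \<beta> z *\<^sub>R g z" for z
    proof (cases "z \<in> S")
      case True
      then show ?thesis using \<beta>pos[OF SR[OF True]] by (simp add: g_def)
    qed (simp add: f0 g0)
    have gR: "g z = 0" if "cmod z > R" for z using g0[of z] SR[of z] that by force
    have eq: "f z * of_real (w z / \<beta> z) = g z * of_real (w z)" for z
      by (simp add: g_def scaleR_conv_of_real divide_inverse)
    have "continuous_on UNIV (\<lambda>z. g z * of_real (w z))"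
      by (intro continuous_on_mult continuous_on_of_real smooth_on_continuous[OF gs] w(1))
    then show "integrable lborel (\<lambda>z. f z * of_real (w z / \<beta> z))"
      unfolding eq by (rule integrable_continuous_compact_support[OF _ S(1)]) (use g0 in \<open>auto simp: S_def\<close>)
    show "integrable lborel (\<lambda>\<rho>. f (?q \<rho>))"
    proof (rule integrable_continuous_compact_support[OF _ K])
      show "continuous_on UNIV (\<lambda>\<rho>. f (?q \<rho>))"
        by (rule continuous_on_compose2[OF smooth_on_continuous[OF f] smooth_on_continuous[OF q]]) auto
    qed (use f0 SR in force)
    show "(\<integral>z. f z * of_real (w z / \<beta> z) \<partial>lborel) = (\<integral>\<rho>. f (?q \<rho>) \<partial>lborel)"
      unfolding eq using w(2)[OF gs gR] by (simp only: fg)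
  qed
  then show ?thesis by blast
qed

section \<open>Complex shears\<close>

lemma bounded_linear_cplx: "bounded_linear cplx"
proof -
  have "linear cplx"
    by (rule linearI) (simp_all add: cplx_def vec_eq_iff scaleR_conv_of_real[where 'a=complex])
  then show ?thesis by (simp add: linear_conv_bounded_linear)
qed

lemma bounded_linear_Im4: "bounded_linear Im4"
proof -
  have "linear Im4"
    by (rule linearI) (simp_all add: Im4_def vec_eq_iff)
  then show ?thesis by (simp add: linear_conv_bounded_linear)
qed

lemmas Im4_add = linear_add[OF bounded_linear.linear[OF bounded_linear_Im4]]

lemma norm_Im4_le: "norm (Im4 \<rho>) \<le> norm \<rho>"
proof -
  have "norm ((\<chi> j. Im (x $ j)) :: real^2) \<le> norm (x :: complex^2)" for x
    unfolding norm_vec_def by (intro L2_set_mono) (auto simp: abs_Im_le_cmod)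
  then show ?thesis
    unfolding norm_prod_def by (intro real_sqrt_le_mono add_mono power_mono) (auto simp: Im4_def)
qed

lemma Im4_cplx [simp]: "Im4 (cplx \<rho>) = 0"
  by (simp add: Im4_def cplx_def vec_eq_iff prod_eq_iff)

lemma norm_cplx: "norm (cplx \<rho>) = norm \<rho>"
  by (simp add: cplx_def norm_prod_def norm_vec_def)

lemma cplx_in_tube [simp]: "r > 0 \<Longrightarrow> cplx \<rho> \<in> tube r"
  by (simp add: tube_def)

lemma open_tube: "open (tube r)"
  unfolding tube_def
  by (intro open_Collect_less continuous_intros linear_continuous_on bounded_linear_Im4)

lemma tube_mono: "r \<le> s \<Longrightarrow> tube r \<subseteq> tube s"
  by (auto simp: tube_def)

definition dir_xi1 :: C4 where "dir_xi1 = (0, axis 1 1)"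

lemma norm_dir_xi1: "norm dir_xi1 = 1"
  by (simp add: dir_xi1_def norm_Pair norm_vec_def L2_set_def axis_def UNIV_2)

definition shear :: "(complex \<Rightarrow> complex) \<Rightarrow> complex \<Rightarrow> C4 \<Rightarrow> C4" where
  "shear \<phi> \<zeta> \<rho> = \<rho> + cscale (\<zeta> * \<phi> (fst \<rho> $ 1)) dir_xi1"

lemma fst_shear [simp]: "fst (shear \<phi> \<zeta> \<rho>) = fst \<rho>"
  by (simp add: shear_def cscale_def dir_xi1_def)

text \<open>The coefficient \<phi> sees only the first position coordinate, which shears fix. So
  shears form a group in \<zeta>, and the inverse belongs to \<open>- \<zeta>\<close>.\<close>

lemma shear_shear: "shear \<phi> \<zeta> (shear \<phi> \<zeta>' \<rho>) = shear \<phi> (\<zeta> + \<zeta>') \<rho>"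
  using fst_shear[of \<phi> \<zeta>' \<rho>]
  by (simp add: shear_def[of \<phi> \<zeta>]) (simp add: shear_def distrib_right cscale_simps ac_simps)

lemma shear_0 [simp]: "shear \<phi> 0 \<rho> = \<rho>"
  by (simp add: shear_def cscale_simps)

lemma norm_shear: "norm (shear \<phi> \<zeta> \<rho> - \<rho>) = cmod \<zeta> * cmod (\<phi> (fst \<rho> $ 1))"
  by (simp add: shear_def norm_cscale norm_dir_xi1 norm_mult)

lemma in_tube_cscale: "norm (Im4 \<rho>) + cmod w < r \<Longrightarrow> \<rho> + cscale w dir_xi1 \<in> tube r"
  using norm_triangle_ineq[of "Im4 \<rho>" "Im4 (cscale w dir_xi1)"] norm_Im4_le[of "cscale w dir_xi1"]
  by (simp add: tube_def Im4_add norm_cscale norm_dir_xi1)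

text \<open>Cauchy's estimate on discs of radius \<open>r / 8\<close> about parameters of modulus at
  most \<open>r / 4\<close>. These discs stay within modulus \<open>r / 2\<close>, which together
  with the imaginary part of \<rho> keeps inside the tube; the radius explains the factor 8.\<close>

lemma tube_lipschitz:
  assumes f: "holomorphic4_on f (tube r)" "\<And>\<rho>. \<rho> \<in> tube r \<Longrightarrow> cmod (f \<rho>) \<le> B" and "r > 0"
    and \<rho>: "\<rho> \<in> tube (r / 2)" and w: "cmod w \<le> r / 4"
  shows "cmod (f (\<rho> + cscale w dir_xi1) - f \<rho>) \<le> 8 * B / r * cmod w"
proof -
  define h where "h w = f (\<rho> + cscale w dir_xi1)" for w
  have inT: "\<rho> + cscale w dir_xi1 \<in> tube r" if "cmod w < r / 2" for w
    using \<rho> that by (intro in_tube_cscale) (simp add: tube_def)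
  have hd: "(h has_field_derivative frechet_derivative f (at (\<rho> + cscale w dir_xi1)) dir_xi1) (at w)" if "cmod w < r / 2" for w
    unfolding h_def by (rule holomorphic4_on_line[OF f(1) inT[OF that]])
  have bound: "cmod (frechet_derivative f (at (\<rho> + cscale w dir_xi1)) dir_xi1) \<le> 8 * B / r" if "cmod w \<le> r / 4" for w
  proof -
    have near: "cmod v < r / 2" if "dist w v \<le> r / 8" for v
      using that \<open>cmod w \<le> r / 4\<close> \<open>r > 0\<close> norm_triangle_ineq2[of v w] by (simp add: dist_norm norm_minus_commute)
    have "cmod ((deriv ^^ 1) h w) \<le> fact 1 * B / (r / 8) ^ 1"
    proof (rule Cauchy_inequality)
      show "h holomorphic_on ball w (r / 8)"
        using hd near by (intro holomorphic_onI) (meson field_differentiable_at_within field_differentiable_def less_imp_le mem_ball)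
      show "continuous_on (cball w (r / 8)) h"
        using hd near by (intro continuous_at_imp_continuous_on ballI) (meson DERIV_isCont mem_cball)
      show "cmod (h v) \<le> B" if "cmod (w - v) = r / 8" for v
        unfolding h_def by (intro f(2) inT near) (use that in \<open>simp add: dist_norm\<close>)
    qed (use \<open>r > 0\<close> in simp)
    moreover have "cmod w < r / 2" using that \<open>r > 0\<close> by simp
    ultimately show ?thesis using DERIV_imp_deriv[OF hd] by (simp add: mult.commute)
  qed
  have "cmod (h w - h 0) \<le> 8 * B / r * cmod (w - 0)"
  proof (rule field_differentiable_bound[OF convex_cball[of 0 "r / 4"]])
    fix v :: complex assume "v \<in> cball 0 (r / 4)"
    then have v: "cmod v \<le> r / 4" "cmod v < r / 2" using \<open>r > 0\<close> by auto
    show "(h has_field_derivative frechet_derivative f (at (\<rho> + cscale v dir_xi1)) dir_xi1) (at v within cball 0 (r / 4))"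
      by (rule has_field_derivative_at_within[OF hd[OF v(2)]])
    show "cmod (frechet_derivative f (at (\<rho> + cscale v dir_xi1)) dir_xi1) \<le> 8 * B / r" by (rule bound[OF v(1)])
  qed (use w \<open>r > 0\<close> in auto)
  then show ?thesis by (simp add: h_def cscale_simps)
qed

lemma entire_smooth_on:
  assumes "f holomorphic_on UNIV"
  shows "smooth_on f UNIV"
proof (rule smooth_onI[where F = "{f. f holomorphic_on UNIV}"])
  fix f :: "complex \<Rightarrow> complex" assume "f \<in> {f. f holomorphic_on UNIV}"
  then have f: "f holomorphic_on UNIV" by simp
  show "\<exists>f'. (\<forall>x\<in>UNIV. (f has_derivative f' x) (at x)) \<and> (\<forall>b\<in>Basis. (\<lambda>x. f' x b) \<in> {f. f holomorphic_on UNIV})"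
  proof (intro exI conjI ballI)
    show "(f has_derivative (\<lambda>v. deriv f x * v)) (at x)" for x
      using holomorphic_derivI[OF f open_UNIV, of x] by (simp add: has_field_derivative_def)
    show "(\<lambda>x. deriv f x * b) \<in> {f. f holomorphic_on UNIV}" for b
      using f by (auto intro!: holomorphic_intros holomorphic_deriv)
  qed
qed (use assms in auto)

section \<open>The second variation of the Weyl density\<close>

lemma integral_param_derivative_eq_0:
  fixes g :: "real \<Rightarrow> 'a::euclidean_space \<Rightarrow> real"
  assumes der: "\<And>t x. t \<in> {-s<..<s} \<Longrightarrow> ((\<lambda>t. g t x) has_real_derivative g' t x) (at t)"
    and cont: "continuous_on ({-s<..<s} \<times> cbox a b) (\<lambda>(t, x). g t x)"
      "continuous_on ({-s<..<s} \<times> cbox a b) (\<lambda>(t, x). g' t x)"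
    and const: "\<And>t. t \<in> {-s<..<s} \<Longrightarrow> integral (cbox a b) (g t) = c" and t: "t \<in> {-s<..<s}"
  shows "integral (cbox a b) (g' t) = 0"
proof -
  have "((\<lambda>t. integral (cbox a b) (g t)) has_vector_derivative integral (cbox a b) (g' t)) (at t within {-s<..<s})"
  proof (rule leibniz_rule_vector_derivative[OF _ _ cont(2) t])
    fix u x assume u: "u \<in> {-s<..<s}"
    show "((\<lambda>t. g t x) has_vector_derivative g' u x) (at u within {-s<..<s})"
      using der[OF u, of x] by (simp add: has_real_derivative_iff_has_vector_derivative has_vector_derivative_at_within)
    have "continuous_on (cbox a b) (\<lambda>x. case (u, x) of (t, x) \<Rightarrow> g t x)"
      by (rule continuous_on_compose2[OF cont(1)]) (use u in \<open>auto intro!: continuous_intros\<close>)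
    then show "g u integrable_on cbox a b" by (intro integrable_continuous) simp
  qed simp
  moreover have "at t within {-s<..<s} = at t" using t by (intro at_within_open) auto
  ultimately have "((\<lambda>t. integral (cbox a b) (g t)) has_vector_derivative integral (cbox a b) (g' t)) (at t)" by simp
  moreover have "((\<lambda>t. integral (cbox a b) (g t)) has_vector_derivative 0) (at t)"
    by (rule has_vector_derivative_transform_within_open[where f = "\<lambda>_. c" and S = "{-s<..<s}"]) (use const t in auto)
  ultimately show ?thesis using vector_derivative_unique_at by blast
qed

lemma flat_exp_curve_derivative:
  fixes P :: "real \<Rightarrow> complex"
  assumes "a > 0" "(P has_vector_derivative P') (at t)"
  shows "((\<lambda>t. flat_exp a k (c - P t \<bullet> P t)) has_real_derivative
    (a * flat_exp a (k + 2) (c - P t \<bullet> P t) - real k * flat_exp a (k + 1) (c - P t \<bullet> P t)) * (- 2 * (P t \<bullet> P'))) (at t)"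
proof (rule DERIV_chain2[OF flat_exp_has_real_derivative[OF assms(1)]])
  have "(P has_derivative (\<lambda>h. h *\<^sub>R P')) (at t)" using assms(2) by (simp add: has_vector_derivative_def)
  from has_derivative_inner[OF this this]
  have "((\<lambda>t. P t \<bullet> P t) has_real_derivative 2 * (P t \<bullet> P')) (at t)"
    by (simp add: has_field_derivative_def inner_commute mult_commute_abs algebra_simps)
  then show "((\<lambda>t. c - P t \<bullet> P t) has_real_derivative - 2 * (P t \<bullet> P')) (at t)"
    by (auto intro!: derivative_eq_intros)
qed

text \<open>A quarter of the Laplacian of \<open>radial_bump a R\<close>.\<close>

definition bump_laplace :: "real \<Rightarrow> real \<Rightarrow> complex \<Rightarrow> real" where
  "bump_laplace a R z = a * ((a * flat_exp a 4 (R\<^sup>2 - z \<bullet> z) - 2 * flat_exp a 3 (R\<^sup>2 - z \<bullet> z)) * (z \<bullet> z) - flat_exp a 2 (R\<^sup>2 - z \<bullet> z))"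

text \<open>Up to a positive factor the value is
  \<open>(a - 2 * u) * (z \<bullet> z) - u\<^sup>2\<close> with
  \<open>u = R\<^sup>2 - z \<bullet> z\<close>. The value of \<open>a\<close> is chosen to make the
  first term at least \<open>R ^ 4 + t0\<close>, while \<open>u\<^sup>2\<close> stays below
  \<open>R ^ 4\<close>.\<close>

lemma bump_laplace_pos:
  assumes "t0 > 0" "t0 \<le> z \<bullet> z" "z \<bullet> z < R\<^sup>2" "a = 2 * R\<^sup>2 + R ^ 4 / t0 + 1"
  shows "bump_laplace a R z > 0"
proof -
  define u where "u = R\<^sup>2 - z \<bullet> z"
  have u: "0 < u" "u < R\<^sup>2" using assms by (auto simp: u_def)
  have apos: "a > 0" using assms by (simp add: add_nonneg_pos)
  have "(a - 2 * u) * (z \<bullet> z) \<ge> (R ^ 4 / t0 + 1) * t0"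
  proof (intro mult_mono)
    have "R ^ 4 / t0 \<ge> 0" using assms(1) by simp
    then show "R ^ 4 / t0 + 1 \<le> a - 2 * u" "0 \<le> a - 2 * u" using u(2) assms(4) by linarith+
  qed (use assms in auto)
  also have "(R ^ 4 / t0 + 1) * t0 = R ^ 4 + t0" using assms(1) by (simp add: field_simps)
  finally have 1: "(a - 2 * u) * (z \<bullet> z) \<ge> R ^ 4 + t0" .
  have "u\<^sup>2 \<le> (R\<^sup>2)\<^sup>2" using u by (intro power_mono) auto
  then have "u\<^sup>2 < R ^ 4 + t0" using assms(1) by simp
  with 1 have 2: "(a - 2 * u) * (z \<bullet> z) - u\<^sup>2 > 0" by linarith
  have "bump_laplace a R z = a * (exp (- a / u) / u ^ 4 * ((a - 2 * u) * (z \<bullet> z) - u\<^sup>2))"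
    unfolding bump_laplace_def u_def[symmetric] flat_exp_def using u(1)
    by (simp add: field_simps power_numeral_reduce)
  also have "\<dots> > 0" using 2 u(1) apos by (intro mult_pos_pos divide_pos_pos) auto
  finally show ?thesis .
qed

lemma bump_laplace_eq_0: "z \<bullet> z \<ge> R\<^sup>2 \<Longrightarrow> bump_laplace a R z = 0"
  by (simp add: bump_laplace_def flat_exp_def)

lemma continuous_on_flat_exp: "a > 0 \<Longrightarrow> continuous_on A (flat_exp a k)"
  using smooth_on_continuous[OF smooth_on_flat_exp] continuous_on_subset by blast

text \<open>The second derivatives of \<open>radial_bump a R (p (\<rho> + \<zeta> c(\<rho>) e))\<close> in the directions \<open>1\<close> and \<open>\<i>\<close> of \<open>\<zeta>\<close>
  add up to the Laplacian because the map is holomorphic in \<open>\<zeta>\<close>.\<close>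

lemma bump_second_variation:
  assumes p: "holomorphic4_on p (tube r)" and s: "s > 0" "s \<le> r"
    and c: "continuous_on UNIV c" "\<And>\<rho>. cmod (c \<rho>) \<le> 1" and a: "a > 0" and R: "R \<ge> 0"
    and supp: "\<And>\<zeta> \<rho>. cmod \<zeta> < s \<Longrightarrow> \<rho> \<notin> cbox (- b) b \<Longrightarrow> cmod (p (cplx \<rho> + cscale (\<zeta> * c \<rho>) dir_xi1)) \<ge> R"
    and const: "\<And>\<zeta>. cmod \<zeta> < s \<Longrightarrow> (\<integral>\<rho>. radial_bump a R (p (cplx \<rho> + cscale (\<zeta> * c \<rho>) dir_xi1)) \<partial>lborel) = U"
  shows "integral (cbox (- b) b) (\<lambda>\<rho>. bump_laplace a R (p (cplx \<rho>)) * (cmod (c \<rho> * frechet_derivative p (at (cplx \<rho>)) dir_xi1))\<^sup>2) = 0"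
proof -
  define p1 where "p1 = (\<lambda>\<rho>. frechet_derivative p (at \<rho>) dir_xi1)"
  define p2 where "p2 = (\<lambda>\<rho>. frechet_derivative p1 (at \<rho>) dir_xi1)"
  have hp1: "holomorphic4_on p1 (tube r)"
    unfolding p1_def by (rule holomorphic4_on_frechet_derivative[OF open_tube p])
  have hp2: "holomorphic4_on p2 (tube r)"
    unfolding p2_def by (rule holomorphic4_on_frechet_derivative[OF open_tube hp1])
  let ?I = "{-s<..<s}"
  \<comment> \<open>Only real lines \<open>\<zeta> = t * d\<close> with \<open>cmod d = 1\<close>
    are used, in the end \<open>d = 1\<close> and \<open>d = \<i>\<close>. Each variation is then an
    ordinary second derivative in the real variable \<open>t\<close>.\<close>
  define K where "K d t \<rho> = cplx \<rho> + cscale (of_real t * d * c \<rho>) dir_xi1" for d t \<rho>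
  have inT: "K d t \<rho> \<in> tube r" if "t \<in> ?I" "cmod d = 1" for d t \<rho>
  proof -
    have "cmod (of_real t * d * c \<rho>) \<le> \<bar>t\<bar> * 1"
      unfolding norm_mult using that c(2)[of \<rho>] by (simp add: mult_left_le)
    also have "\<dots> < r" using that s by auto
    finally show ?thesis unfolding K_def by (intro in_tube_cscale) simp
  qed
  have contK: "continuous_on A (\<lambda>y. K d (fst y) (snd y))" for A d
    unfolding K_def
    by (intro continuous_on_add linear_continuous_on[OF bounded_linear_cplx, THEN continuous_on_compose2[of UNIV]]
        bounded_bilinear.continuous_on[OF bounded_bilinear_cscale] continuous_on_mult continuous_on_of_real
        continuous_on_compose2[OF c(1)] continuous_on_fst continuous_on_snd continuous_on_id continuous_on_const) auto
  have contf: "continuous_on (?I \<times> A) (\<lambda>y. f (K d (fst y) (snd y)))" if "holomorphic4_on f (tube r)" "cmod d = 1" for f A d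
    by (rule continuous_on_compose2[OF holomorphic4_on_continuous[OF that(1)] contK]) (use inT that(2) in auto)
  have der: "((\<lambda>t. f (K d t \<rho>)) has_vector_derivative d * c \<rho> * frechet_derivative f (at (K d t \<rho>)) dir_xi1) (at t)"
    if f: "holomorphic4_on f (tube r)" and "cmod d = 1" "t \<in> ?I" for f d t \<rho>
  proof -
    let ?w = "\<lambda>t. of_real t * d * c \<rho>"
    have "((\<lambda>w. f (cplx \<rho> + cscale w dir_xi1)) has_field_derivative frechet_derivative f (at (K d t \<rho>)) dir_xi1) (at (?w t))"
      unfolding K_def by (rule holomorphic4_on_line[OF f]) (use inT[OF that(3,2), of \<rho>] in \<open>simp add: K_def\<close>)
    moreover have "(?w has_vector_derivative d * c \<rho>) (at t)"
      by (auto intro!: derivative_eq_intros simp: has_vector_derivative_def scaleR_conv_of_real)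
    ultimately have "(((\<lambda>w. f (cplx \<rho> + cscale w dir_xi1)) \<circ> ?w) has_vector_derivative d * c \<rho> * frechet_derivative f (at (K d t \<rho>)) dir_xi1) (at t)"
      by (rule field_vector_diff_chain_at[rotated])
    then show ?thesis by (simp add: o_def K_def)
  qed
  \<comment> \<open>\<open>Q1\<close> and \<open>Q2\<close> are the first two
    \<open>t\<close>-derivatives of \<open>p\<close> along the line, \<open>g1\<close> and
    \<open>g2\<close> those of the bump \<open>g\<close>.\<close>
  define u where "u d t \<rho> = R\<^sup>2 - p (K d t \<rho>) \<bullet> p (K d t \<rho>)" for d t \<rho>
  define Q1 where "Q1 d t \<rho> = d * c \<rho> * p1 (K d t \<rho>)" for d t \<rho>
  define Q2 where "Q2 d t \<rho> = d * c \<rho> * (d * c \<rho> * p2 (K d t \<rho>))" for d t \<rho>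
  define g where "g d t \<rho> = flat_exp a 0 (u d t \<rho>)" for d t \<rho>
  define g1 where "g1 d t \<rho> = a * flat_exp a 2 (u d t \<rho>) * (- 2 * (p (K d t \<rho>) \<bullet> Q1 d t \<rho>))" for d t \<rho>
  define g2 where "g2 d t \<rho> = a * flat_exp a 2 (u d t \<rho>) * (- 2 * (p (K d t \<rho>) \<bullet> Q2 d t \<rho> + Q1 d t \<rho> \<bullet> Q1 d t \<rho>))
     + a * ((a * flat_exp a 4 (u d t \<rho>) - 2 * flat_exp a 3 (u d t \<rho>)) * (- 2 * (p (K d t \<rho>) \<bullet> Q1 d t \<rho>))) * (- 2 * (p (K d t \<rho>) \<bullet> Q1 d t \<rho>))" for d t \<rho>
  have DP: "((\<lambda>t. p (K d t \<rho>)) has_vector_derivative Q1 d t \<rho>) (at t)" if "cmod d = 1" "t \<in> ?I" for d t \<rho>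
    unfolding Q1_def p1_def by (rule der[OF p that])
  have DQ: "((\<lambda>t. Q1 d t \<rho>) has_vector_derivative Q2 d t \<rho>) (at t)" if "cmod d = 1" "t \<in> ?I" for d t \<rho>
    unfolding Q1_def Q2_def p2_def by (intro has_vector_derivative_mult_right der[OF hp1 that])
  have Dg: "((\<lambda>t. g d t \<rho>) has_real_derivative g1 d t \<rho>) (at t)" if "cmod d = 1" "t \<in> ?I" for d t \<rho>
    using flat_exp_curve_derivative[OF a DP[OF that], of 0 "R\<^sup>2" \<rho>] unfolding g_def g1_def u_def by (simp add: numeral_2_eq_2)
  have Dg1: "((\<lambda>t. g1 d t \<rho>) has_real_derivative g2 d t \<rho>) (at t)" if "cmod d = 1" "t \<in> ?I" for d t \<rho>
  proof -
    note 1 = DP[OF that, of \<rho>, unfolded has_vector_derivative_def] and 2 = DQ[OF that, of \<rho>, unfolded has_vector_derivative_def]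
    have "((\<lambda>t. p (K d t \<rho>) \<bullet> Q1 d t \<rho>) has_real_derivative p (K d t \<rho>) \<bullet> Q2 d t \<rho> + Q1 d t \<rho> \<bullet> Q1 d t \<rho>) (at t)"
      unfolding has_field_derivative_def
      by (rule has_derivative_eq_rhs[OF has_derivative_inner[OF 1 2]]) (auto simp: fun_eq_iff algebra_simps)
    then have A: "((\<lambda>t. - 2 * (p (K d t \<rho>) \<bullet> Q1 d t \<rho>)) has_real_derivative - 2 * (p (K d t \<rho>) \<bullet> Q2 d t \<rho> + Q1 d t \<rho> \<bullet> Q1 d t \<rho>)) (at t)"
      by (rule DERIV_cmult)
    have "((\<lambda>t. flat_exp a 2 (u d t \<rho>)) has_real_derivative (a * flat_exp a 4 (u d t \<rho>) - 2 * flat_exp a 3 (u d t \<rho>)) * (- 2 * (p (K d t \<rho>) \<bullet> Q1 d t \<rho>))) (at t)"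
      using flat_exp_curve_derivative[OF a DP[OF that], of 2 "R\<^sup>2" \<rho>] unfolding u_def by simp
    then have "((\<lambda>t. a * flat_exp a 2 (u d t \<rho>)) has_real_derivative a * ((a * flat_exp a 4 (u d t \<rho>) - 2 * flat_exp a 3 (u d t \<rho>)) * (- 2 * (p (K d t \<rho>) \<bullet> Q1 d t \<rho>)))) (at t)"
      by (rule DERIV_cmult)
    from DERIV_mult[OF this A] show ?thesis
      unfolding g1_def g2_def by (simp only: add.commute mult.commute mult.left_commute)
  qed
  have contc: "continuous_on A (\<lambda>y. c (snd y))" for A :: "(real \<times> R4) set"
    by (rule continuous_on_compose2[OF c(1)]) (auto intro!: continuous_intros)
  have cu: "continuous_on (?I \<times> A) (\<lambda>y. flat_exp a k (u d (fst y) (snd y)))" if "cmod d = 1" for d k A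
    unfolding u_def
    by (rule continuous_on_compose2[OF continuous_on_flat_exp[OF a, of UNIV]])
       (auto intro!: continuous_on_diff continuous_on_const continuous_on_inner contf[OF p that])
  have cQ: "continuous_on (?I \<times> A) (\<lambda>y. Q1 d (fst y) (snd y))" "continuous_on (?I \<times> A) (\<lambda>y. Q2 d (fst y) (snd y))" if "cmod d = 1" for d A
    unfolding Q1_def Q2_def
    by (intro continuous_on_mult continuous_on_const contc contf[OF hp1 that] contf[OF hp2 that])+
  have cg: "continuous_on (?I \<times> A) (\<lambda>y. g d (fst y) (snd y))" "continuous_on (?I \<times> A) (\<lambda>y. g1 d (fst y) (snd y))"
    "continuous_on (?I \<times> A) (\<lambda>y. g2 d (fst y) (snd y))" if "cmod d = 1" for d A
    unfolding g_def g1_def g2_def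
    by (intro continuous_on_add continuous_on_diff continuous_on_mult continuous_on_const continuous_on_inner cu[OF that] cQ[OF that] contf[OF p that])+
  have const': "integral (cbox (- b) b) (g d t) = U" if "cmod d = 1" "t \<in> ?I" for d t
  proof -
    have t: "cmod (of_real t * d) < s" using that by (auto simp: norm_mult)
    have rb: "radial_bump a R (p (cplx \<rho> + cscale (of_real t * d * c \<rho>) dir_xi1)) = g d t \<rho>" for \<rho>
      by (simp add: radial_bump_def g_def u_def K_def)
    have "continuous_on UNIV (g d t)"
    proof -
      have "continuous_on UNIV (\<lambda>\<rho>. (\<lambda>y. g d (fst y) (snd y)) (t, \<rho>))"
        by (rule continuous_on_compose2[OF cg(1)[OF that(1), of UNIV]]) (use that in \<open>auto intro!: continuous_intros\<close>)
      then show ?thesis by simp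
    qed
    moreover have "g d t \<rho> = 0" if "\<rho> \<notin> cbox (- b) b" for \<rho>
      using radial_bump_eq_0[OF supp[OF t that] R, where a = a] unfolding rb .
    ultimately have "(\<integral>\<rho>. g d t \<rho> \<partial>lborel) = integral (cbox (- b) b) (g d t)"
      by (rule lborel_integral_eq_cbox)
    then show ?thesis using const[OF t] unfolding rb by simp
  qed
  have "integral (cbox (- b) b) (g1 d t) = 0" if "cmod d = 1" "t \<in> ?I" for d t
    using integral_param_derivative_eq_0[OF Dg[OF that(1)] _ _ const'[OF that(1)] that(2)] cg(1,2)[OF that(1)] by (simp add: split_beta)
  then have "integral (cbox (- b) b) (g2 d t) = 0" if "cmod d = 1" "t \<in> ?I" for d t
    using integral_param_derivative_eq_0[OF Dg1[OF that(1)], where a = "- b" and b = b and c = 0 and t = t] cg(2,3)[OF that(1)] that by (simp add: split_beta)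
  then have z: "integral (cbox (- b) b) (g2 1 0) = 0" "integral (cbox (- b) b) (g2 \<i> 0) = 0" using s(1) by auto
  have slice: "g2 d 0 integrable_on cbox (- b) b" if "cmod d = 1" for d
  proof -
    have "continuous_on (cbox (- b) b) (\<lambda>\<rho>. (\<lambda>y. g2 d (fst y) (snd y)) (0, \<rho>))"
      by (rule continuous_on_compose2[OF cg(3)[OF that, of UNIV]]) (use s(1) in \<open>auto intro!: continuous_intros\<close>)
    then show ?thesis by (intro integrable_continuous) simp
  qed
  have "integral (cbox (- b) b) (\<lambda>\<rho>. g2 1 0 \<rho> + g2 \<i> 0 \<rho>) = 0"
    using integral_add[OF slice slice, of 1 \<i>] z by simp
  \<comment> \<open>Passing from \<open>d = 1\<close> to \<open>d = \<i>\<close> reverses the sign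
    of \<open>Q2\<close>, so the second derivatives of \<open>p\<close> cancel. The squares of the
    inner products of \<open>P\<close> with \<open>v\<close> and with \<open>\<i> * v\<close> add up
    to \<open>(P \<bullet> P) * (v \<bullet> v)\<close>.\<close>
  moreover have "g2 1 0 \<rho> + g2 \<i> 0 \<rho> = 4 * (bump_laplace a R (p (cplx \<rho>)) * (cmod (c \<rho> * p1 (cplx \<rho>)))\<^sup>2)" for \<rho>
  proof -
    have K0: "K d 0 \<rho> = cplx \<rho>" for d by (simp add: K_def cscale_simps)
    define P v q where "P = p (cplx \<rho>)" and "v = c \<rho> * p1 (cplx \<rho>)" and "q = c \<rho> * (c \<rho> * p2 (cplx \<rho>))"
    have Q: "Q1 1 0 \<rho> = v" "Q2 1 0 \<rho> = q" "Q1 \<i> 0 \<rho> = \<i> * v" "Q2 \<i> 0 \<rho> = - q"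
      by (simp_all add: Q1_def Q2_def K0 v_def q_def algebra_simps)
    have iv: "(\<i> * v) \<bullet> (\<i> * v) = v \<bullet> v" by (simp add: inner_complex_def)
    have sq: "(P \<bullet> v)\<^sup>2 + (P \<bullet> (\<i> * v))\<^sup>2 = (P \<bullet> P) * (v \<bullet> v)"
      by (simp add: inner_complex_def power2_eq_square algebra_simps)
    have vv: "(cmod v)\<^sup>2 = v \<bullet> v" by (simp add: power2_norm_eq_inner)
    define e2 e34 where "e2 = flat_exp a 2 (R\<^sup>2 - P \<bullet> P)" and "e34 = a * flat_exp a 4 (R\<^sup>2 - P \<bullet> P) - 2 * flat_exp a 3 (R\<^sup>2 - P \<bullet> P)"
    have "g2 1 0 \<rho> + g2 \<i> 0 \<rho> = a * e2 * (- 2 * (P \<bullet> q + v \<bullet> v)) + a * (e34 * (- 2 * (P \<bullet> v))) * (- 2 * (P \<bullet> v))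
      + (a * e2 * (- 2 * (- (P \<bullet> q) + v \<bullet> v)) + a * (e34 * (- 2 * (P \<bullet> (\<i> * v)))) * (- 2 * (P \<bullet> (\<i> * v))))"
      unfolding g2_def u_def K0 Q iv P_def[symmetric] e2_def e34_def inner_minus_right by simp
    also have "\<dots> = 4 * (a * (e34 * ((P \<bullet> v)\<^sup>2 + (P \<bullet> (\<i> * v))\<^sup>2) - e2 * (v \<bullet> v)))"
      by (simp add: algebra_simps power2_eq_square)
    also have "\<dots> = 4 * (a * (e34 * (P \<bullet> P) - e2) * (v \<bullet> v))"
      unfolding sq by (simp add: algebra_simps)
    also have "\<dots> = 4 * (bump_laplace a R P * (cmod v)\<^sup>2)"
      unfolding vv bump_laplace_def e2_def e34_def by simp
    finally show ?thesis by (simp add: P_def v_def)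
  qed
  ultimately show ?thesis by (simp add: p1_def)
qed


lemma norm_Im4_cscale_dir: "norm (Im4 (cscale w dir_xi1)) = \<bar>Im w\<bar>"
  by (simp add: Im4_def cscale_def dir_xi1_def norm_Pair norm_vec_def L2_set_def UNIV_2 axis_def)

definition real_xi1 :: R4 where "real_xi1 = (0, axis 1 1)"

definition real_x1 :: R4 where "real_x1 = (axis 1 1, 0)"

lemma norm_real_xi1 [simp]: "norm real_xi1 = 1"
  by (simp add: real_xi1_def norm_Pair)

lemma cplx_add_dir: "cplx (\<rho> + s *\<^sub>R real_xi1) = cplx \<rho> + cscale (of_real s) dir_xi1"
  by (simp add: real_xi1_def cplx_def cscale_def dir_xi1_def vec_eq_iff axis_def)

lemma elliptic_at_infinityD: "elliptic_at_infinity C p \<Longrightarrow> norm \<rho> \<ge> C \<Longrightarrow> cmod (p (cplx \<rho>)) \<ge> 1 / C"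
  unfolding elliptic_at_infinity_def by blast

definition gaussian :: "real \<Rightarrow> real \<Rightarrow> complex \<Rightarrow> complex" where
  "gaussian N b w = exp (- of_real N * (w - of_real b)\<^sup>2)"

lemma gaussian_of_real: "gaussian N b (of_real x) = of_real (exp (- N * (x - b)\<^sup>2))"
  by (simp add: gaussian_def exp_of_real[symmetric])

lemma abs_fst_component_le: "\<bar>fst (\<rho> :: R4) $ 1\<bar> \<le> norm \<rho>"
  using component_le_norm_cart[of "fst \<rho>" 1] norm_fst_le[of "fst \<rho>" "snd \<rho>"] by simp

text \<open>Otherwise \<open>p\<close> would be constant on the whole line by the identity theorem, against ellipticity.\<close>

lemma ex_nonzero_derivative_along_line:
  assumes C: "C > 0" and p: "holomorphic4_on p (tube (1 / C))" and ell: "elliptic_at_infinity C p"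
    and \<rho>: "cmod (p (cplx \<rho>)) < 1 / C" and \<sigma>: "\<sigma> > 0"
  shows "\<exists>s. \<bar>s\<bar> < \<sigma> \<and> frechet_derivative p (at (cplx (\<rho> + s *\<^sub>R real_xi1))) dir_xi1 \<noteq> 0"
proof (rule ccontr)
  assume "\<not> ?thesis"
  then have zero: "frechet_derivative p (at (cplx \<rho> + cscale (of_real s) dir_xi1)) dir_xi1 = 0" if "\<bar>s\<bar> < \<sigma>" for s :: real
    using that by (auto simp: cplx_add_dir)
  define T where "T = {w. \<bar>Im w\<bar> < 1 / C}"
  have "T = {w. Im w < 1 / C} \<inter> {w. Im w > - (1 / C)}" by (auto simp: T_def)
  then have T: "open T" "convex T"
    by (auto intro!: open_Int convex_Int open_halfspace_Im_lt open_halfspace_Im_gt convex_halfspace_Im_lt convex_halfspace_Im_gt)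
  have inT: "cplx \<rho> + cscale w dir_xi1 \<in> tube (1 / C)" if "w \<in> T" for w
    using that by (simp add: tube_def Im4_add norm_Im4_cscale_dir T_def)
  define h where "h w = p (cplx \<rho> + cscale w dir_xi1)" for w
  define h' where "h' w = frechet_derivative p (at (cplx \<rho> + cscale w dir_xi1)) dir_xi1" for w
  have hd: "(h has_field_derivative h' w) (at w)" if "w \<in> T" for w
    unfolding h_def h'_def by (rule holomorphic4_on_line[OF p inT[OF that]])
  have h'd: "(h' has_field_derivative frechet_derivative (\<lambda>\<rho>. frechet_derivative p (at \<rho>) dir_xi1) (at (cplx \<rho> + cscale w dir_xi1)) dir_xi1) (at w)"
    if "w \<in> T" for w
    unfolding h'_def by (rule holomorphic4_on_line[OF holomorphic4_on_frechet_derivative[OF open_tube p] inT[OF that]])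
  have "h' w = 0" if w: "w \<in> T" for w
  proof (rule analytic_continuation[OF _ T(1) convex_connected[OF T(2)], of h' "complex_of_real ` {-\<sigma><..<\<sigma>}" 0])
    show "h' holomorphic_on T"
      using h'd by (intro holomorphic_onI) (meson field_differentiable_at_within field_differentiable_def)
    show "complex_of_real ` {-\<sigma><..<\<sigma>} \<subseteq> T" "0 \<in> T" using C by (auto simp: T_def)
    show "h' z = 0" if "z \<in> complex_of_real ` {-\<sigma><..<\<sigma>}" for z
      using that zero by (auto simp: h'_def)
    show "0 islimpt complex_of_real ` {-\<sigma><..<\<sigma>}"
      unfolding islimpt_approachable
    proof (intro allI impI)
      fix e :: real assume "e > 0"
      define x where "x = min \<sigma> e / 2"
      have "x \<in> {-\<sigma><..<\<sigma>}" "x > 0" "x < e" using \<sigma> \<open>e > 0\<close> by (auto simp: x_def min_def)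
      then show "\<exists>x'\<in>complex_of_real ` {-\<sigma><..<\<sigma>}. x' \<noteq> 0 \<and> dist x' 0 < e"
        by (intro bexI[of _ "of_real x"] imageI) auto
    qed
  qed (use w in auto)
  then obtain c where c: "\<And>w. w \<in> T \<Longrightarrow> h w = c"
    using has_field_derivative_zero_constant[OF T(2), of h] hd by (metis has_field_derivative_at_within)
  define s where "s = C + norm \<rho>"
  have "h (of_real s) = h 0" using c C by (simp add: T_def)
  then have eq: "p (cplx (\<rho> + s *\<^sub>R real_xi1)) = p (cplx \<rho>)" by (simp add: h_def cplx_add_dir cscale_simps)
  have "norm (s *\<^sub>R real_xi1) = s" using C by (simp add: s_def)
  then have "norm (\<rho> + s *\<^sub>R real_xi1) \<ge> C"
    using norm_triangle_ineq2[of "s *\<^sub>R real_xi1" "- \<rho>"] by (simp add: s_def add.commute)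
  then show False using elliptic_at_infinityD[OF ell, of "\<rho> + s *\<^sub>R real_xi1"] \<rho> eq by simp
qed

text \<open>Gaussians concentrating at the largest values of \<open>x\<^sub>1\<close> on the fibres. Near the fibre over \<open>0\<close> those values
  are exceeded at points of other fibres, since a linear function has no interior maximum; there the Laplacian of
  the bump is positive, and it dominates the integral of the second variation.\<close>

lemma ex_variation:
  assumes C: "C > 0" and p: "holomorphic4_on p (tube (1 / C))" and bdd: "\<forall>\<rho>\<in>tube (1 / C). cmod (p \<rho>) \<le> C"
    and ell: "elliptic_at_infinity C p" and ne: "real_fibre p 0 \<noteq> {}" and V: "open V" "0 \<in> V"
  shows "\<exists>N b f. N \<ge> 0 \<and> f \<in> test_functions V \<and>
    (\<forall>s>0. \<exists>\<zeta>. cmod \<zeta> < s \<and> (\<integral>\<rho>. f (p (shear (gaussian N b) \<zeta> (cplx \<rho>))) \<partial>lborel) \<noteq> (\<integral>\<rho>. f (p (cplx \<rho>)) \<partial>lborel))"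
proof -

  \<comment> \<open>A point beyond the zero fibre\<close>
  define q where "q \<rho> = p (cplx \<rho>)" for \<rho>
  define x1 where "x1 \<rho> = fst \<rho> $ 1" for \<rho> :: R4
  have contq: "continuous_on A q" for A
    unfolding q_def using C
    by (intro continuous_on_compose2[OF holomorphic4_on_continuous[OF p] linear_continuous_on[OF bounded_linear_cplx]]) auto
  have contx1: "continuous_on A x1" for A unfolding x1_def by (intro continuous_intros)
  have ell': "norm \<rho> < C" if "cmod (q \<rho>) < 1 / C" for \<rho>
    using elliptic_at_infinityD[OF ell, of \<rho>] that unfolding q_def by linarith
  have F0: "real_fibre p 0 = {\<rho>. q \<rho> = 0}" by (simp add: real_fibre_def q_def)
  have "compact {\<rho>. q \<rho> = 0}"
  proof -
    have "closed {\<rho>. q \<rho> = 0}" by (intro closed_Collect_eq contq continuous_on_const)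
    moreover have "{\<rho>. q \<rho> = 0} \<subseteq> cball 0 C"
    proof
      fix \<rho> assume "\<rho> \<in> {\<rho>. q \<rho> = 0}"
      then have "cmod (q \<rho>) < 1 / C" using C by simp
      from ell'[OF this] show "\<rho> \<in> cball 0 C" by simp
    qed
    ultimately show ?thesis using bounded_subset[OF bounded_cball] compact_eq_bounded_closed by blast
  qed
  \<comment> \<open>A point of the compact zero fibre where the first position coordinate is
    largest.\<close>
  then obtain \<rho>s where \<rho>s: "q \<rho>s = 0" "\<And>\<rho>. q \<rho> = 0 \<Longrightarrow> x1 \<rho> \<le> x1 \<rho>s"
    using continuous_attains_sup[OF _ _ contx1[of "{\<rho>. q \<rho> = 0}"]] ne unfolding F0 by auto
  obtain R' where R': "R' > 0" "cball 0 R' \<subseteq> V" using open_contains_cball V by blast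
  define R0 where "R0 = min R' (1 / (2 * C))"
  have R0: "R0 > 0" "cball 0 R0 \<subseteq> V" "R0 < 1 / C"
  proof -
    show "R0 > 0" using R' C by (simp add: R0_def)
    have "cball 0 R0 \<subseteq> cball 0 R'" by (intro subset_cball) (simp add: R0_def)
    then show "cball 0 R0 \<subseteq> V" using R' by blast
    have "1 / (2 * C) < 1 / C" using C by (simp add: field_simps)
    then show "R0 < 1 / C" unfolding R0_def by linarith
  qed
  have open1: "open {s::real. cmod (q (\<rho> + s *\<^sub>R v)) < R0}" for \<rho> v
    by (intro open_Collect_less continuous_on_norm continuous_on_compose2[OF contq[of UNIV]]) (auto intro!: continuous_intros)
  obtain \<tau>0 where \<tau>0: "\<tau>0 > 0" "ball 0 \<tau>0 \<subseteq> {s. cmod (q (\<rho>s + s *\<^sub>R real_x1)) < R0}"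
  proof -
    have "0 \<in> {s. cmod (q (\<rho>s + s *\<^sub>R real_x1)) < R0}" using \<rho>s(1) R0(1) by simp
    from openE[OF open1 this] show thesis using that by blast
  qed
  define \<tau> where "\<tau> = \<tau>0 / 2"
  \<comment> \<open>A small step in the direction of the first position coordinate exceeds its
    maximum over the zero fibre. Hence \<open>q \<rho>1\<close> is nonzero, yet still small by
    continuity.\<close>
  define \<rho>1 where "\<rho>1 = \<rho>s + \<tau> *\<^sub>R real_x1"
  have \<tau>: "\<tau> > 0" "cmod (q \<rho>1) < R0" using \<tau>0 by (auto simp: \<tau>_def \<rho>1_def subset_iff dist_norm simp del: scaleR_half_double)
  define M where "M = x1 \<rho>s"
  have x1\<rho>1: "x1 \<rho>1 = M + \<tau>" by (simp add: \<rho>1_def x1_def M_def real_x1_def)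
  have q\<rho>1: "q \<rho>1 \<noteq> 0" using \<rho>s(2)[of \<rho>1] x1\<rho>1 \<tau>(1) by (auto simp: M_def)
  have "open {s::real. q (\<rho>1 + s *\<^sub>R real_xi1) \<noteq> 0}"
    by (intro open_Collect_neq continuous_on_const continuous_on_compose2[OF contq[of UNIV]]) (auto intro!: continuous_intros)
  then have "open ({s. cmod (q (\<rho>1 + s *\<^sub>R real_xi1)) < R0} \<inter> {s. q (\<rho>1 + s *\<^sub>R real_xi1) \<noteq> 0})"
    using open1 by blast
  then obtain \<sigma> where \<sigma>: "\<sigma> > 0" "ball 0 \<sigma> \<subseteq> {s. cmod (q (\<rho>1 + s *\<^sub>R real_xi1)) < R0} \<inter> {s. q (\<rho>1 + s *\<^sub>R real_xi1) \<noteq> 0}"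
  proof -
    assume op: "open ({s. cmod (q (\<rho>1 + s *\<^sub>R real_xi1)) < R0} \<inter> {s. q (\<rho>1 + s *\<^sub>R real_xi1) \<noteq> 0})"
    have "0 \<in> {s. cmod (q (\<rho>1 + s *\<^sub>R real_xi1)) < R0} \<inter> {s. q (\<rho>1 + s *\<^sub>R real_xi1) \<noteq> 0}" using \<tau>(2) q\<rho>1 by simp
    from openE[OF op this] show thesis using that by blast
  qed
  \<comment> \<open>The derivative of \<open>p\<close> along the first momentum coordinate may
    vanish at \<open>\<rho>1\<close>. Moving along that same coordinate repairs this without
    changing \<open>x1\<close>.\<close>
  obtain s2 where s2: "\<bar>s2\<bar> < \<sigma>" "frechet_derivative p (at (cplx (\<rho>1 + s2 *\<^sub>R real_xi1))) dir_xi1 \<noteq> 0"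
    using ex_nonzero_derivative_along_line[OF C p ell _ \<sigma>(1), of \<rho>1] \<tau>(2) R0(3) by (auto simp: q_def)
  define \<rho>2 where "\<rho>2 = \<rho>1 + s2 *\<^sub>R real_xi1"
  have "s2 \<in> ball 0 \<sigma>" using s2(1) by simp
  then have \<rho>2: "cmod (q \<rho>2) < R0" "q \<rho>2 \<noteq> 0" "frechet_derivative p (at (cplx \<rho>2)) dir_xi1 \<noteq> 0" "x1 \<rho>2 = M + \<tau>"
    using \<sigma>(2) s2(2) x1\<rho>1 by (auto simp: \<rho>2_def x1_def real_xi1_def)
  \<comment> \<open>Strictly between \<open>cmod (q \<rho>2)\<close> and \<open>R0\<close>: the
    point \<open>q \<rho>2\<close> must lie inside the support of the bump, and that support inside
    \<open>V\<close>.\<close>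
  define R where "R = (cmod (q \<rho>2) + R0) / 2"
  have R: "R > 0" "cmod (q \<rho>2) < R" "R < R0" "R < 1 / C"
  proof -
    have "cmod (q \<rho>2) + R0 > 0" using R0(1) by (intro add_nonneg_pos norm_ge_zero)
    then show "R > 0" by (simp add: R_def)
  qed (use \<rho>2(1) R0(3) in \<open>simp_all add: R_def\<close>)

  \<comment> \<open>The disc of negative Laplacian and the Gaussian weight\<close>
  have "closed {\<rho>. M + \<tau> / 3 \<le> x1 \<rho>}" by (intro closed_Collect_le contx1 continuous_on_const)
  then have cptZ: "compact (cball 0 C \<inter> {\<rho>. M + \<tau> / 3 \<le> x1 \<rho>})" by (intro compact_Int_closed compact_cball)
  have \<rho>2Z: "\<rho>2 \<in> cball 0 C \<inter> {\<rho>. M + \<tau> / 3 \<le> x1 \<rho>}" using ell'[of \<rho>2] \<rho>2 R \<tau>(1) by auto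
  obtain \<rho>m where \<rho>m: "\<rho>m \<in> cball 0 C \<inter> {\<rho>. M + \<tau> / 3 \<le> x1 \<rho>}"
    "\<And>\<rho>. \<rho> \<in> cball 0 C \<inter> {\<rho>. M + \<tau> / 3 \<le> x1 \<rho>} \<Longrightarrow> cmod (q \<rho>m) \<le> cmod (q \<rho>)"
    using continuous_attains_inf[OF cptZ _ continuous_on_norm[OF contq]] \<rho>2Z by blast
  \<comment> \<open>On the part of the ball with \<open>x1\<close> at least
    \<open>M + \<tau> / 3\<close> the symbol has no zero, so its minimal modulus is positive. Over
    the disc \<open>z \<bullet> z < t0\<close>, where the Laplacian may be negative,
    \<open>x1\<close> therefore remains below \<open>M + \<tau> / 3\<close>.\<close>
  define t0 where "t0 = (cmod (q \<rho>m))\<^sup>2"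
  have "q \<rho>m \<noteq> 0" using \<rho>m(1) \<rho>s(2)[of \<rho>m] \<tau>(1) by (auto simp: M_def)
  then have t0: "t0 > 0" by (simp add: t0_def)
  have small: "x1 \<rho> < M + \<tau> / 3" if "q \<rho> \<bullet> q \<rho> < t0" "norm \<rho> < C" for \<rho>
  proof (rule ccontr)
    assume "\<not> ?thesis"
    then have "cmod (q \<rho>m) \<le> cmod (q \<rho>)" using that(2) by (intro \<rho>m(2)) auto
    then have "t0 \<le> (cmod (q \<rho>))\<^sup>2" unfolding t0_def by (intro power_mono) auto
    then show False using that(1) by (simp add: power2_norm_eq_inner)
  qed
  define a where "a = 2 * R\<^sup>2 + R ^ 4 / t0 + 1"
  have a: "a > 0" unfolding a_def using t0 by (intro add_nonneg_pos) auto
  obtain b where b: "cball 0 C \<subseteq> cbox (- b) (b :: R4)"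
    using bounded_subset_cbox_symmetric[OF bounded_cball] by blast
  have inbox: "\<rho> \<in> cbox (- b) b" if "norm \<rho> \<le> C" for \<rho> using that b by auto
  have "ball 0 C \<subseteq> interior (cbox (- b) b)" using b by (intro interior_maximal) auto
  then have box: "box (- b) b \<noteq> {}" using C by (force simp: interior_cbox)
  obtain B where B: "\<And>\<rho>. \<rho> \<in> cbox (- b) b \<Longrightarrow> norm \<rho> \<le> B"
    using bounded_cbox[of "- b" b] by (auto simp: bounded_iff)
  \<comment> \<open>The centre of the Gaussian lies to the right of the whole box, so on the box the
    weight increases with \<open>x1\<close>.\<close>
  define a0 where "a0 = \<bar>M + \<tau>\<bar> + \<bar>B\<bar> + 1"
  have a0: "x1 \<rho> \<le> a0" if "\<rho> \<in> cbox (- b) b" for \<rho>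
    using B[OF that] abs_fst_component_le[of \<rho>] by (simp add: a0_def x1_def)
  \<comment> \<open>Negative contributions occur only for \<open>x1 < c\<close>, and positive ones
    are counted only for \<open>x1 > c'\<close>. The point \<open>\<rho>2\<close> lies beyond both.
    The gap between the two thresholds produces the exponential gain \<gamma>.\<close>
  define c c' where "c = M + \<tau> / 3" and "c' = M + 2 * \<tau> / 3"
  have c: "c < c'" "c' < a0" using \<tau>(1) by (auto simp: c_def c'_def a0_def)
  define \<gamma> where "\<gamma> = (a0 - c)\<^sup>2 - (a0 - c')\<^sup>2"
  have \<gamma>: "\<gamma> > 0" unfolding \<gamma>_def using c by (simp add: power_strict_mono)

  \<comment> \<open>Comparison of the weighted integrand with its positive part\<close>
  define D where "D \<rho> = frechet_derivative p (at (cplx \<rho>)) dir_xi1" for \<rho>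
  define g where "g \<rho> = bump_laplace a R (q \<rho>) * (cmod (D \<rho>))\<^sup>2" for \<rho>
  \<comment> \<open>A continuous lower bound for the positive part of \<open>g\<close>, supported to
    the right of \<open>c'\<close>. Continuity is used below to conclude from its positivity at
    \<open>\<rho>2\<close> that its integral is positive.\<close>
  define g1 where "g1 \<rho> = max 0 (g \<rho>) * min 1 (max 0 (x1 \<rho> - c'))" for \<rho>
  have contD: "continuous_on A D" for A
    unfolding D_def using C
    by (intro continuous_on_compose2[OF holomorphic4_on_continuous[OF holomorphic4_on_frechet_derivative[OF open_tube p]]
         linear_continuous_on[OF bounded_linear_cplx]]) auto
  have contflat: "continuous_on A (\<lambda>\<rho>. flat_exp a k (R\<^sup>2 - q \<rho> \<bullet> q \<rho>))" for A k
    by (intro continuous_on_compose2[OF continuous_on_flat_exp[OF a, of UNIV]] continuous_on_diff continuous_on_const continuous_on_inner contq) auto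
  have contg: "continuous_on A g" for A
    unfolding g_def bump_laplace_def
    by (intro continuous_on_mult continuous_on_diff continuous_on_const continuous_on_inner contq contflat continuous_on_power continuous_on_norm contD)
  have contg1: "continuous_on A g1" for A
    unfolding g1_def by (intro continuous_on_mult continuous_on_max continuous_on_min continuous_on_diff continuous_on_const contg contx1)
  have gpos: "g \<rho> \<ge> 0" if "t0 \<le> q \<rho> \<bullet> q \<rho>" for \<rho>
  proof (cases "q \<rho> \<bullet> q \<rho> < R\<^sup>2")
    case True
    then show ?thesis using bump_laplace_pos[OF t0 that True a_def] by (simp add: g_def)
  qed (simp add: g_def bump_laplace_eq_0)
  \<comment> \<open>The weight is normalized by its value at \<open>x1 = c'\<close>. It is then at
    least 1 to the right of \<open>c'\<close>, at most \<open>exp (- 2 * N * \<gamma>)\<close> to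
    the left of \<open>c\<close>, and harmless in between, where \<open>g\<close> is nonnegative.
    The factor 2 arises because the second variation contains the square of the Gaussian.\<close>
  have pointwise: "g1 \<rho> - exp (- 2 * N * \<gamma>) * \<bar>g \<rho>\<bar> \<le> exp (2 * N * (a0 - c')\<^sup>2) * (g \<rho> * exp (- 2 * N * (x1 \<rho> - a0)\<^sup>2))"
    if N: "N \<ge> 0" and \<rho>: "\<rho> \<in> cbox (- b) b" for N \<rho>
  proof -
    define E where "E = exp (2 * N * ((a0 - c')\<^sup>2 - (x1 \<rho> - a0)\<^sup>2))"
    have E: "exp (2 * N * (a0 - c')\<^sup>2) * (g \<rho> * exp (- 2 * N * (x1 \<rho> - a0)\<^sup>2)) = g \<rho> * E"
      by (simp add: E_def exp_diff exp_minus algebra_simps divide_inverse right_diff_distrib)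
    show ?thesis
    proof (cases "q \<rho> \<bullet> q \<rho> < t0")
      case True
      have "t0 \<le> (cmod (q \<rho>2))\<^sup>2" unfolding t0_def using \<rho>m(2)[OF \<rho>2Z] by (intro power_mono) auto
      then have "(cmod (q \<rho>))\<^sup>2 < (cmod (q \<rho>2))\<^sup>2" using True by (simp add: power2_norm_eq_inner)
      then have "cmod (q \<rho>) < cmod (q \<rho>2)" using power_less_imp_less_base norm_ge_zero by blast
      then have "norm \<rho> < C" using R by (intro ell') linarith
      then have x: "x1 \<rho> < c" using small[OF True] by (simp add: c_def)
      then have "g1 \<rho> = 0" using c by (simp add: g1_def)
      moreover have "(a0 - c)\<^sup>2 \<le> (a0 - x1 \<rho>)\<^sup>2" using x c by (intro power_mono) auto
      then have "(a0 - c')\<^sup>2 - (x1 \<rho> - a0)\<^sup>2 \<le> - \<gamma>" by (simp add: \<gamma>_def power2_commute)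
      then have "2 * N * ((a0 - c')\<^sup>2 - (x1 \<rho> - a0)\<^sup>2) \<le> 2 * N * (- \<gamma>)" using N by (intro mult_left_mono) auto
      then have "E \<le> exp (- 2 * N * \<gamma>)" by (simp add: E_def)
      then have "\<bar>g \<rho>\<bar> * E \<le> \<bar>g \<rho>\<bar> * exp (- 2 * N * \<gamma>)" by (intro mult_left_mono) auto
      moreover have "- (\<bar>g \<rho>\<bar> * E) \<le> g \<rho> * E" by (simp add: E_def abs_if)
      ultimately show ?thesis unfolding E by (simp add: mult.commute)
    next
      case False
      then have g0: "g \<rho> \<ge> 0" using gpos by simp
      have "g1 \<rho> \<le> g \<rho> * E"
      proof (cases "x1 \<rho> > c'")
        case True
        have "(a0 - x1 \<rho>)\<^sup>2 \<le> (a0 - c')\<^sup>2" using True a0[OF \<rho>] by (intro power_mono) auto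
        then have "E \<ge> 1" using N by (simp add: E_def power2_commute)
        then have "g \<rho> * 1 \<le> g \<rho> * E" using g0 by (intro mult_left_mono) auto
        moreover have "g1 \<rho> \<le> g \<rho> * 1" unfolding g1_def using g0 by (intro mult_mono) auto
        ultimately show ?thesis by linarith
      next
        case False
        then show ?thesis using g0 by (simp add: g1_def E_def)
      qed
      moreover have "exp (- 2 * N * \<gamma>) * \<bar>g \<rho>\<bar> \<ge> 0" by simp
      ultimately show ?thesis unfolding E by linarith
    qed
  qed
  have int: "f integrable_on cbox (- b) b" if "continuous_on (cbox (- b) b) f" for f :: "R4 \<Rightarrow> real"
    using integrable_continuous[OF that] .
  define \<kappa> where "\<kappa> = integral (cbox (- b) b) g1"
  have g1nn: "g1 \<rho> \<ge> 0" for \<rho> by (simp add: g1_def)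
  have "\<kappa> \<noteq> 0"
  proof
    assume "\<kappa> = 0"
    then have "(g1 has_integral 0) (cbox (- b) b)"
      using integrable_integral[OF int[OF contg1]] by (simp add: \<kappa>_def)
    then have "g1 \<rho>2 = 0"
      by (rule has_integral_0_cbox_imp_0[OF contg1 g1nn _ box]) (use \<rho>2Z in \<open>auto intro!: inbox\<close>)
    moreover have "g \<rho>2 > 0"
    proof -
      have "t0 \<le> q \<rho>2 \<bullet> q \<rho>2"
        unfolding t0_def power2_norm_eq_inner[symmetric] using \<rho>m(2)[OF \<rho>2Z] by (intro power_mono) auto
      moreover have "q \<rho>2 \<bullet> q \<rho>2 < R\<^sup>2"
        unfolding power2_norm_eq_inner[symmetric] using R by (intro power_strict_mono) auto
      ultimately show ?thesis using bump_laplace_pos[OF t0 _ _ a_def] \<rho>2(3) by (simp add: g_def D_def)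
    qed
    ultimately show False using \<rho>2(4) \<tau>(1) by (auto simp: g1_def c'_def min_def max_def split: if_splits)
  qed
  moreover have "\<kappa> \<ge> 0" unfolding \<kappa>_def by (intro integral_nonneg int contg1 g1nn)
  ultimately have \<kappa>: "\<kappa> > 0" by simp
  define J where "J = integral (cbox (- b) b) (\<lambda>\<rho>. \<bar>g \<rho>\<bar>)"
  have "\<exists>N\<ge>0. exp (- 2 * N * \<gamma>) * J < \<kappa>"
  proof -
    have "((\<lambda>N. exp (- 2 * N * \<gamma>) * J) \<longlongrightarrow> 0) at_top"
      using \<gamma> by real_asymp
    then have "\<forall>\<^sub>F N in at_top. exp (- 2 * N * \<gamma>) * J < \<kappa>" using \<kappa> by (rule order_tendstoD)
    then have "\<forall>\<^sub>F N in at_top. N \<ge> 0 \<and> exp (- 2 * N * \<gamma>) * J < \<kappa>"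
      using eventually_ge_at_top[of 0] by eventually_elim auto
    then show ?thesis using eventually_happens by fastforce
  qed
  then obtain N where N: "N \<ge> 0" "exp (- 2 * N * \<gamma>) * J < \<kappa>" by blast

  \<comment> \<open>Contradiction from a vanishing second variation\<close>
  define cc where "cc \<rho> = gaussian N a0 (of_real (x1 \<rho>))" for \<rho>
  have cc: "cc \<rho> = of_real (exp (- N * (x1 \<rho> - a0)\<^sup>2))" for \<rho> by (simp add: cc_def gaussian_of_real)
  have cc1: "cmod (cc \<rho>) \<le> 1" for \<rho> using N(1) by (simp add: cc)
  have contcc: "continuous_on UNIV cc" unfolding cc by (intro continuous_intros contx1)
  have shear_eq: "shear (gaussian N a0) \<zeta> (cplx \<rho>) = cplx \<rho> + cscale (\<zeta> * cc \<rho>) dir_xi1" for \<zeta> \<rho>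
    by (simp add: shear_def cc_def x1_def cplx_def)
  let ?f = "\<lambda>z. complex_of_real (radial_bump a R z)"
  have "\<exists>\<zeta>. cmod \<zeta> < s \<and> (\<integral>\<rho>. ?f (p (shear (gaussian N a0) \<zeta> (cplx \<rho>))) \<partial>lborel) \<noteq> (\<integral>\<rho>. ?f (p (cplx \<rho>)) \<partial>lborel)"
    if s: "s > 0" for s
  proof (rule ccontr)
    assume "\<not> ?thesis"
    then have eq: "(\<integral>\<rho>. radial_bump a R (p (cplx \<rho> + cscale (\<zeta> * cc \<rho>) dir_xi1)) \<partial>lborel) = (\<integral>\<rho>. radial_bump a R (p (cplx \<rho>)) \<partial>lborel)"
      if "cmod \<zeta> < s" for \<zeta>
      using that by (simp add: shear_eq integral_complex_of_real)
    \<comment> \<open>\<open>8 * C * C\<close> is the Lipschitz constant given by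
      \<open>tube_lipschitz\<close> for width \<open>1 / C\<close> and bound \<open>C\<close>.
      Outside the box \<open>cmod p\<close> is at least \<open>1 / C\<close>, so after a
      displacement of this size it is still at least \<open>R\<close>, where the bump
      vanishes.\<close>
    define s0 where "s0 = min s (min (1 / (4 * C)) ((1 / C - R) / (8 * C * C)))"
    have s0: "s0 > 0" "s0 \<le> s" "s0 \<le> 1 / (4 * C)" "8 * C * C * s0 \<le> 1 / C - R"
    proof -
      show "s0 > 0" "s0 \<le> s" "s0 \<le> 1 / (4 * C)" using s C R by (auto simp: s0_def)
      have "s0 \<le> (1 / C - R) / (8 * C * C)" by (simp add: s0_def)
      then show "8 * C * C * s0 \<le> 1 / C - R" using C by (simp add: pos_le_divide_eq mult.commute)
    qed
    have "integral (cbox (- b) b) (\<lambda>\<rho>. bump_laplace a R (p (cplx \<rho>)) * (cmod (cc \<rho> * frechet_derivative p (at (cplx \<rho>)) dir_xi1))\<^sup>2) = 0"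
    proof (rule bump_second_variation[OF p s0(1) _ contcc cc1 a])
      show "s0 \<le> 1 / C" using s0(3) C by (simp add: field_simps)
      show "R \<ge> 0" using R by simp
      fix \<zeta> \<rho> assume \<zeta>: "cmod \<zeta> < s0"
      show "(\<integral>\<rho>. radial_bump a R (p (cplx \<rho> + cscale (\<zeta> * cc \<rho>) dir_xi1)) \<partial>lborel) = (\<integral>\<rho>. radial_bump a R (p (cplx \<rho>)) \<partial>lborel)"
        using \<zeta> s0(2) by (intro eq) simp
      assume "\<rho> \<notin> cbox (- b) b"
      then have "norm \<rho> \<ge> C" using inbox[of \<rho>] by linarith
      then have big: "cmod (p (cplx \<rho>)) \<ge> 1 / C" by (rule elliptic_at_infinityD[OF ell])
      have w: "cmod (\<zeta> * cc \<rho>) \<le> s0"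
        unfolding norm_mult using mult_mono[OF less_imp_le[OF \<zeta>] cc1[of \<rho>]] s0(1) by simp
      have "cmod (p (cplx \<rho> + cscale (\<zeta> * cc \<rho>) dir_xi1) - p (cplx \<rho>)) \<le> 8 * C / (1 / C) * cmod (\<zeta> * cc \<rho>)"
        by (rule tube_lipschitz[OF p]) (use bdd C w s0(3) in auto)
      also have "\<dots> \<le> 8 * C * C * s0" using w C by (simp add: mult_left_mono)
      finally have "cmod (p (cplx \<rho> + cscale (\<zeta> * cc \<rho>) dir_xi1) - p (cplx \<rho>)) \<le> 1 / C - R" using s0(4) by simp
      then show "R \<le> cmod (p (cplx \<rho> + cscale (\<zeta> * cc \<rho>) dir_xi1))"
        using big norm_triangle_ineq2[of "p (cplx \<rho>)" "p (cplx \<rho> + cscale (\<zeta> * cc \<rho>) dir_xi1)"] by (simp add: norm_minus_commute)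
    qed
    moreover have "(cmod (cc \<rho> * D \<rho>))\<^sup>2 = exp (- 2 * N * (x1 \<rho> - a0)\<^sup>2) * (cmod (D \<rho>))\<^sup>2" for \<rho>
      by (simp add: cc norm_mult power_mult_distrib exp_double[symmetric])
    ultimately have zero: "integral (cbox (- b) b) (\<lambda>\<rho>. g \<rho> * exp (- 2 * N * (x1 \<rho> - a0)\<^sup>2)) = 0"
      by (simp add: g_def D_def q_def algebra_simps)
    have contw: "continuous_on A (\<lambda>\<rho>. g \<rho> * exp (- 2 * N * (x1 \<rho> - a0)\<^sup>2))" for A
      by (intro continuous_intros contg contx1)
    have "integral (cbox (- b) b) (\<lambda>\<rho>. g1 \<rho> - exp (- 2 * N * \<gamma>) * \<bar>g \<rho>\<bar>)
      \<le> integral (cbox (- b) b) (\<lambda>\<rho>. exp (2 * N * (a0 - c')\<^sup>2) * (g \<rho> * exp (- 2 * N * (x1 \<rho> - a0)\<^sup>2)))"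
      by (intro integral_le int continuous_on_diff continuous_on_mult continuous_on_const contg1 continuous_on_rabs contg contw pointwise N(1))
    also have "\<dots> = 0" using zero by simp
    also have "integral (cbox (- b) b) (\<lambda>\<rho>. g1 \<rho> - exp (- 2 * N * \<gamma>) * \<bar>g \<rho>\<bar>) = \<kappa> - exp (- 2 * N * \<gamma>) * J"
      unfolding \<kappa>_def J_def
      by (subst Henstock_Kurzweil_Integration.integral_diff) (auto intro!: int continuous_on_mult continuous_on_const contg1 continuous_on_rabs contg)
    finally show False using N(2) by simp
  qed
  moreover have "?f \<in> test_functions V"
    by (rule radial_bump_test_function[OF a R(1)]) (use R R0 in auto)
  ultimately show ?thesis using N(1) by (intro exI[of _ N] exI[of _ a0] exI[of _ ?f]) auto
qed

section \<open>Sheared symbols\<close>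

lemma
  assumes "((\<lambda>\<rho>. p (cplx \<rho>)) has_derivative D) (at \<rho>)"
  shows differential_re_part: "differential (re_part p) \<rho> = (\<lambda>v. Re (D v))"
    and differential_im_part: "differential (im_part p) \<rho> = (\<lambda>v. Im (D v))"
proof -
  have "(re_part p has_derivative (\<lambda>v. Re (D v))) (at \<rho>)" "(im_part p has_derivative (\<lambda>v. Im (D v))) (at \<rho>)"
    unfolding re_part_def[abs_def] im_part_def[abs_def]
    by (intro bounded_linear.has_derivative[OF bounded_linear_Re assms] bounded_linear.has_derivative[OF bounded_linear_Im assms])+
  then show "differential (re_part p) \<rho> = (\<lambda>v. Re (D v))" "differential (im_part p) \<rho> = (\<lambda>v. Im (D v))"
    using frechet_derivative_at by metis+
qed

lemma Lagrange_identity: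
  fixes \<alpha> \<beta> :: "'i \<Rightarrow> real"
  shows "(\<Sum>b\<in>A. \<Sum>c\<in>A. (\<alpha> b * \<beta> c - \<alpha> c * \<beta> b)\<^sup>2) / 2 = (\<Sum>b\<in>A. \<alpha> b * \<alpha> b) * (\<Sum>b\<in>A. \<beta> b * \<beta> b) - (\<Sum>b\<in>A. \<alpha> b * \<beta> b)\<^sup>2"
proof -
  have "(\<Sum>b\<in>A. \<Sum>c\<in>A. (\<alpha> b * \<beta> c - \<alpha> c * \<beta> b)\<^sup>2) =
    (\<Sum>b\<in>A. \<Sum>c\<in>A. (\<alpha> b * \<alpha> b) * (\<beta> c * \<beta> c)) + (\<Sum>b\<in>A. \<Sum>c\<in>A. (\<beta> b * \<beta> b) * (\<alpha> c * \<alpha> c)) - 2 * (\<Sum>b\<in>A. \<Sum>c\<in>A. (\<alpha> b * \<beta> b) * (\<alpha> c * \<beta> c))"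
    by (simp add: sum_distrib_left sum.distrib[symmetric] sum_subtractf[symmetric] power2_eq_square algebra_simps)
  then show ?thesis unfolding sum_product[symmetric] power2_eq_square by (simp add: field_simps)
qed

text \<open>Lagrange's identity. It translates the lower bound on the wedge product in
  \<open>uniform_constant\<close> into the nondegeneracy needed for
  \<open>right_inv\<close>.\<close>

lemma norm_2form_eq_gram:
  assumes "linear (frechet_derivative q (at \<rho>))"
  shows "norm_2form (wedge (\<lambda>v. Re (frechet_derivative q (at \<rho>) v)) (\<lambda>v. Im (frechet_derivative q (at \<rho>) v))) = sqrt (gram q \<rho>)"
proof -
  let ?\<alpha> = "\<lambda>v. Re (frechet_derivative q (at \<rho>) v)" and ?\<beta> = "\<lambda>v. Im (frechet_derivative q (at \<rho>) v)"
  have A: "grad_Re q \<rho> \<bullet> y = (\<Sum>b\<in>Basis. ?\<alpha> b * (b \<bullet> y))" "grad_Im q \<rho> \<bullet> y = (\<Sum>b\<in>Basis. ?\<beta> b * (b \<bullet> y))" for y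
    by (simp_all add: grad_Re_def grad_Im_def inner_sum_left)
  have B: "b \<bullet> grad_Re q \<rho> = ?\<alpha> b" "b \<bullet> grad_Im q \<rho> = ?\<beta> b" for b
    using grad_Re_inner[OF assms] grad_Im_inner[OF assms] by (simp_all add: inner_commute)
  have "grad_Re q \<rho> \<bullet> grad_Re q \<rho> = (\<Sum>b\<in>Basis. ?\<alpha> b * ?\<alpha> b)" by (subst A(1)) (simp only: B(1))
  moreover have "grad_Im q \<rho> \<bullet> grad_Im q \<rho> = (\<Sum>b\<in>Basis. ?\<beta> b * ?\<beta> b)" by (subst A(2)) (simp only: B(2))
  moreover have "grad_Re q \<rho> \<bullet> grad_Im q \<rho> = (\<Sum>b\<in>Basis. ?\<alpha> b * ?\<beta> b)" by (subst A(1)) (simp only: B(2))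
  ultimately have "gram q \<rho> = (\<Sum>b\<in>Basis. ?\<alpha> b * ?\<alpha> b) * (\<Sum>b\<in>Basis. ?\<beta> b * ?\<beta> b) - (\<Sum>b\<in>Basis. ?\<alpha> b * ?\<beta> b)\<^sup>2"
    by (simp only: gram_def)
  then show ?thesis
    unfolding norm_2form_def wedge_def using Lagrange_identity[of ?\<alpha> ?\<beta> Basis] by simp
qed

lemma lin_indep2_of_norm_2form:
  assumes "norm_2form (wedge \<alpha> \<beta>) > 0"
  shows "lin_indep2 \<alpha> \<beta>"
proof (rule ccontr)
  assume "\<not> lin_indep2 \<alpha> \<beta>"
  then obtain a b where ab: "\<And>v. a * \<alpha> v + b * \<beta> v = 0" "a \<noteq> 0 \<or> b \<noteq> 0" unfolding lin_indep2_def by blast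
  have "wedge \<alpha> \<beta> u v = 0" for u v
  proof (cases "a = 0")
    case True
    then have "\<beta> w = 0" for w using ab(1)[of w] ab(2) by simp
    then show ?thesis by (simp add: wedge_def)
  next
    case False
    have "a * wedge \<alpha> \<beta> u v = (a * \<alpha> u + b * \<beta> u) * \<beta> v - (a * \<alpha> v + b * \<beta> v) * \<beta> u"
      by (simp add: wedge_def algebra_simps)
    then show ?thesis using False ab(1) by simp
  qed
  then show False using assms by (simp add: norm_2form_def)
qed

definition shear_deriv :: "(complex \<Rightarrow> complex) \<Rightarrow> complex \<Rightarrow> C4 \<Rightarrow> C4 \<Rightarrow> C4" where
  "shear_deriv \<phi> \<zeta> \<rho> v = v + cscale (\<zeta> * deriv \<phi> (fst \<rho> $ 1) * fst v $ 1) dir_xi1"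

lemma shear_has_derivative:
  assumes "\<phi> holomorphic_on UNIV"
  shows "(shear \<phi> \<zeta> has_derivative shear_deriv \<phi> \<zeta> \<rho>) (at \<rho>)"
proof -
  have "((\<lambda>\<rho>::C4. fst \<rho> $ 1) has_derivative (\<lambda>v. fst v $ 1)) (at \<rho>)"
    by (intro bounded_linear_imp_has_derivative bounded_linear_compose[OF bounded_linear_vec_nth bounded_linear_fst])
  moreover have "(\<phi> has_derivative (\<lambda>h. deriv \<phi> (fst \<rho> $ 1) * h)) (at (fst \<rho> $ 1))"
    using holomorphic_derivI[OF assms open_UNIV] by (simp add: has_field_derivative_def)
  ultimately have "((\<lambda>\<rho>. \<phi> (fst \<rho> $ 1)) has_derivative (\<lambda>v. deriv \<phi> (fst \<rho> $ 1) * fst v $ 1)) (at \<rho>)"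
    by (rule has_derivative_compose)
  then have "((\<lambda>\<rho>. \<zeta> * \<phi> (fst \<rho> $ 1)) has_derivative (\<lambda>v. \<zeta> * (deriv \<phi> (fst \<rho> $ 1) * fst v $ 1))) (at \<rho>)"
    by (rule has_derivative_mult_right)
  then have "((\<lambda>\<rho>. \<rho> + cscale (\<zeta> * \<phi> (fst \<rho> $ 1)) dir_xi1) has_derivative
      (\<lambda>v. v + cscale (\<zeta> * (deriv \<phi> (fst \<rho> $ 1) * fst v $ 1)) dir_xi1)) (at \<rho>)"
    by (intro has_derivative_add has_derivative_ident
        bounded_linear.has_derivative[OF bounded_bilinear.bounded_linear_left[OF bounded_bilinear_cscale]])
  then show ?thesis by (simp add: shear_def[abs_def] shear_deriv_def[abs_def] mult.assoc)
qed

lemma holomorphic4_on_shear: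
  assumes "holomorphic4_on p S" "\<phi> holomorphic_on UNIV" "\<And>\<rho>. \<rho> \<in> T \<Longrightarrow> shear \<phi> \<zeta> \<rho> \<in> S"
  shows "holomorphic4_on (\<lambda>\<rho>. p (shear \<phi> \<zeta> \<rho>)) T"
  unfolding holomorphic4_on_def
proof (intro ballI exI conjI allI)
  fix \<rho> assume \<rho>: "\<rho> \<in> T"
  show "((\<lambda>\<rho>. p (shear \<phi> \<zeta> \<rho>)) has_derivative (\<lambda>v. frechet_derivative p (at (shear \<phi> \<zeta> \<rho>)) (shear_deriv \<phi> \<zeta> \<rho> v))) (at \<rho>)"
    by (rule has_derivative_compose[OF shear_has_derivative[OF assms(2)] holomorphic4_on_has_derivative(1)[OF assms(1) assms(3)[OF \<rho>]]])
  have "shear_deriv \<phi> \<zeta> \<rho> (cscale c v) = cscale c (shear_deriv \<phi> \<zeta> \<rho> v)" for c v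
    by (simp add: shear_deriv_def cscale_simps cscale_cscale) (simp add: cscale_def ac_simps)
  then show "frechet_derivative p (at (shear \<phi> \<zeta> \<rho>)) (shear_deriv \<phi> \<zeta> \<rho> (cscale c v)) = c * frechet_derivative p (at (shear \<phi> \<zeta> \<rho>)) (shear_deriv \<phi> \<zeta> \<rho> v)" for c v
    by (simp add: holomorphic4_on_has_derivative(2)[OF assms(1) assms(3)[OF \<rho>]])
qed

lemma shear_deriv_eq_0D: "shear_deriv \<phi> \<zeta> \<rho> v = 0 \<Longrightarrow> v = 0"
proof -
  assume z: "shear_deriv \<phi> \<zeta> \<rho> v = 0"
  have "fst (shear_deriv \<phi> \<zeta> \<rho> v) = fst v" by (simp add: shear_deriv_def cscale_def dir_xi1_def)
  then have "fst v = 0" using z by simp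
  then show "v = 0" using z by (simp add: shear_deriv_def cscale_simps)
qed

text \<open>The shear adds a multiple of the differential of the first position coordinate to that
  of the first momentum coordinate, and the wedge of a 1-form with itself vanishes.\<close>

lemma sigma_shear_deriv: "sigma (shear_deriv \<phi> \<zeta> \<rho> u) (shear_deriv \<phi> \<zeta> \<rho> v) = sigma u v"
  by (simp add: sigma_def shear_deriv_def cscale_def dir_xi1_def UNIV_2 axis_def algebra_simps)

lemma smooth_on_shear:
  assumes "\<phi> holomorphic_on UNIV"
  shows "smooth_on (shear \<phi> \<zeta>) UNIV"
proof -
  have "smooth_on (\<lambda>\<rho>::C4. \<phi> (fst \<rho> $ 1)) UNIV"
    by (rule smooth_on_compose[OF open_UNIV open_UNIV _ _ entire_smooth_on[OF assms]])
      (auto intro!: smooth_on_linear bounded_linear_compose[OF bounded_linear_vec_nth bounded_linear_fst])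
  then show ?thesis
    unfolding shear_def[abs_def]
    by (intro smooth_on_add smooth_on_ident smooth_on_bilinear[OF _ bounded_bilinear_cscale] smooth_on_mult smooth_on_const open_UNIV)
qed

text \<open>Shearing changes \<open>\<xi> \<cdot> dx\<close> by a multiple of \<open>\<phi>(x\<^sub>1) dx\<^sub>1\<close>, which is exact.\<close>

lemma xi_dx_integral_shear:
  fixes \<gamma> :: "real \<Rightarrow> C4"
  assumes \<phi>: "\<phi> holomorphic_on UNIV" and \<gamma>: "smooth_on \<gamma> UNIV" "\<gamma> 1 = \<gamma> 0"
  shows "xi_dx_integral (\<lambda>t. shear \<phi> \<zeta> (\<gamma> t)) = xi_dx_integral \<gamma>"
proof -
  obtain G where G: "\<And>w. (G has_field_derivative \<phi> w) (at w)"
    using holomorphic_convex_primitive'[OF convex_UNIV open_UNIV \<phi>] by auto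
  let ?x = "\<lambda>k t. fst (\<gamma> t) $ k"
  let ?x' = "\<lambda>k t. frechet_derivative (?x k) (at t) 1"
  have smx: "smooth_on (?x k) UNIV" for k
    using smooth_on_bounded_linear[OF open_UNIV bounded_linear_compose[OF bounded_linear_vec_nth bounded_linear_fst] \<gamma>(1)] .
  have smxi: "smooth_on (\<lambda>t. snd (\<gamma> t) $ k) UNIV" for k
    using smooth_on_bounded_linear[OF open_UNIV bounded_linear_compose[OF bounded_linear_vec_nth bounded_linear_snd] \<gamma>(1)] .
  have vd: "(?x k has_vector_derivative ?x' k t) (at t)" for k t
  proof -
    have hd: "(?x k has_derivative frechet_derivative (?x k) (at t)) (at t)" by (rule smooth_on_UNIV_has_derivative[OF smx])
    have "frechet_derivative (?x k) (at t) h = h *\<^sub>R ?x' k t" for h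
      using linear_cmul[OF has_derivative_linear[OF hd], of h 1] by simp
    then show ?thesis unfolding has_vector_derivative_def by (intro has_derivative_eq_rhs[OF hd] ext)
  qed
  have vd': "vector_derivative (?x k) (at t) = ?x' k t" for k t using vector_derivative_at[OF vd] .
  have cx': "continuous_on A (?x' k)" for A k
    using smooth_on_continuous[OF smooth_on_frechet_derivative[OF open_UNIV smx]] continuous_on_subset by blast
  have cxi: "continuous_on A (\<lambda>t. snd (\<gamma> t) $ k)" for A k
    using smooth_on_continuous[OF smxi] continuous_on_subset by blast
  have int: "((\<lambda>t. \<phi> (?x 1 t) * ?x' 1 t) has_integral (G (?x 1 1) - G (?x 1 0))) {0..1}"
  proof (rule fundamental_theorem_of_calculus)
    fix t :: real
    have "((G \<circ> ?x 1) has_vector_derivative ?x' 1 t * \<phi> (?x 1 t)) (at t)"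
      by (rule field_vector_diff_chain_at[OF vd G])
    then show "((\<lambda>t. G (?x 1 t)) has_vector_derivative \<phi> (?x 1 t) * ?x' 1 t) (at t within {0..1})"
      by (simp add: o_def mult.commute has_vector_derivative_at_within)
  qed simp
  have "xi_dx_integral (\<lambda>t. shear \<phi> \<zeta> (\<gamma> t)) = integral {0..1} (\<lambda>t. (\<Sum>k\<in>UNIV. snd (\<gamma> t) $ k * ?x' k t) + \<zeta> * (\<phi> (?x 1 t) * ?x' 1 t))"
    unfolding xi_dx_integral_def fst_shear vd'
    by (rule integral_cong) (simp add: shear_def cscale_def dir_xi1_def UNIV_2 axis_def algebra_simps)
  also have "\<dots> = integral {0..1} (\<lambda>t. \<Sum>k\<in>UNIV. snd (\<gamma> t) $ k * ?x' k t) + integral {0..1} (\<lambda>t. \<zeta> * (\<phi> (?x 1 t) * ?x' 1 t))"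
  proof (rule Henstock_Kurzweil_Integration.integral_add)
    show "(\<lambda>t. \<Sum>k\<in>UNIV. snd (\<gamma> t) $ k * ?x' k t) integrable_on {0..1}"
      by (intro integrable_continuous_interval continuous_on_sum continuous_on_mult cxi cx')
    show "(\<lambda>t. \<zeta> * (\<phi> (?x 1 t) * ?x' 1 t)) integrable_on {0..1}"
      by (rule has_integral_integrable[OF has_integral_mult_right[OF int]])
  qed
  also have "integral {0..1} (\<lambda>t. \<zeta> * (\<phi> (?x 1 t) * ?x' 1 t)) = 0"
    unfolding integral_unique[OF has_integral_mult_right[OF int, of \<zeta>]] by (simp add: \<gamma>(2))
  finally show ?thesis by (simp add: xi_dx_integral_def vd')
qed

lemma gaussian_holomorphic: "gaussian N b holomorphic_on UNIV"
  unfolding gaussian_def[abs_def] by (intro holomorphic_intros)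

lemma gaussian_bound:
  assumes "N \<ge> 0" "\<bar>Im w\<bar> \<le> r"
  shows "cmod (gaussian N b w) \<le> exp (N * r\<^sup>2)"
proof -
  have "Re (- of_real N * (w - of_real b)\<^sup>2) = - N * ((Re w - b)\<^sup>2 - (Im w)\<^sup>2)"
    by (simp add: power2_eq_square algebra_simps)
  also have "\<dots> \<le> N * (Im w)\<^sup>2" using assms(1) by (simp add: algebra_simps)
  also have "\<dots> \<le> N * r\<^sup>2" using assms power_mono[of "\<bar>Im w\<bar>" r 2] by (intro mult_left_mono) auto
  finally show ?thesis unfolding gaussian_def norm_exp_eq_Re by simp
qed

lemma abs_Im_component_le: "\<bar>Im (fst \<rho> $ 1)\<bar> \<le> norm (Im4 \<rho>)"
  using abs_fst_component_le[of "Im4 \<rho>"] by (simp add: Im4_def)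

lemma smooth_on_real_restriction:
  assumes "holomorphic4_on p (tube r)" "r > 0"
  shows "smooth_on (\<lambda>\<rho>. p (cplx \<rho>)) UNIV"
  by (rule smooth_on_compose[OF open_UNIV open_tube _ smooth_on_linear[OF open_UNIV bounded_linear_cplx] holomorphic4_on_smooth[OF open_tube assms(1)]])
    (use assms(2) in auto)

lemma compact_sublevel:
  assumes "continuous_on UNIV (q :: R4 \<Rightarrow> complex)" "\<And>\<rho>. cmod (q \<rho>) \<le> R \<Longrightarrow> norm \<rho> \<le> C"
  shows "compact {\<rho>. cmod (q \<rho>) \<le> R}"
proof -
  have "closed {\<rho>. cmod (q \<rho>) \<le> R}"
    by (intro closed_Collect_le continuous_on_norm assms(1) continuous_on_const)
  moreover have "{\<rho>. cmod (q \<rho>) \<le> R} \<subseteq> cball 0 C" using assms(2) by auto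
  ultimately show ?thesis using bounded_subset[OF bounded_cball] compact_eq_bounded_closed by blast
qed

text \<open>Nondegeneracy is assumed on the zero fibre only. The degenerate points in the ball of
  radius \<open>C\<close> form a compact set on which \<open>p\<close> has no zero, so
  \<open>cmod p\<close> is bounded below there; outside the ball ellipticity provides such a
  bound.\<close>

lemma regular_fibre_neighbourhood:
  assumes u: "uniform_constant C p"
  shows "\<exists>R>0. 3 * R < 1 / C \<and> (\<forall>\<rho>. cmod (p (cplx \<rho>)) \<le> 3 * R \<longrightarrow> gram (\<lambda>\<rho>. p (cplx \<rho>)) \<rho> \<noteq> 0)"
proof -
  let ?q = "\<lambda>\<rho>. p (cplx \<rho>)"
  have C: "C > 0" and p: "holomorphic4_on p (tube (1 / C))" and ell: "elliptic_at_infinity C p"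
    and nf: "\<And>\<rho>. \<rho> \<in> real_fibre p 0 \<Longrightarrow> norm_2form (wedge (differential (re_part p) \<rho>) (differential (im_part p) \<rho>)) \<ge> 1 / C"
    using u by (auto simp: uniform_constant_def)
  have smq: "smooth_on ?q UNIV" by (rule smooth_on_real_restriction[OF p]) (use C in simp)
  have gram0: "gram ?q \<rho> \<noteq> 0" if "?q \<rho> = 0" for \<rho>
  proof -
    note D = smooth_on_UNIV_has_derivative[OF smq, of \<rho>]
    have "sqrt (gram ?q \<rho>) \<ge> 1 / C"
      using nf[of \<rho>] that
      unfolding norm_2form_eq_gram[OF has_derivative_linear[OF D], symmetric] differential_re_part[OF D] differential_im_part[OF D]
      by (simp add: real_fibre_def)
    moreover have "1 / C > 0" using C by simp
    ultimately show ?thesis by auto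
  qed
  have "closed {\<rho>. gram ?q \<rho> = 0}"
    by (intro closed_Collect_eq smooth_on_continuous[OF smooth_on_gram[OF open_UNIV smq]] continuous_on_const)
  then have Z: "compact (cball 0 C \<inter> {\<rho>. gram ?q \<rho> = 0})" (is "compact ?Z") by (intro compact_Int_closed compact_cball)
  have "\<exists>m>0. \<forall>\<rho>\<in>?Z. m \<le> cmod (?q \<rho>)"
  proof (cases "?Z = {}")
    case False
    have "continuous_on ?Z (\<lambda>\<rho>. cmod (?q \<rho>))"
      by (intro continuous_on_norm continuous_on_subset[OF smooth_on_continuous[OF smq]]) auto
    then obtain \<rho>m where "\<rho>m \<in> ?Z" "\<And>\<rho>. \<rho> \<in> ?Z \<Longrightarrow> cmod (?q \<rho>m) \<le> cmod (?q \<rho>)"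
      using continuous_attains_inf[OF Z False] by blast
    moreover have "?q \<rho>m \<noteq> 0" using gram0[of \<rho>m] \<open>\<rho>m \<in> ?Z\<close> by blast
    ultimately show ?thesis by (intro exI[of _ "cmod (?q \<rho>m)"]) auto
  qed (auto intro: exI[of _ 1])
  then obtain m where m: "m > 0" "\<And>\<rho>. \<rho> \<in> ?Z \<Longrightarrow> m \<le> cmod (?q \<rho>)" by blast
  define k where "k = min m (1 / C)"
  have k: "k > 0" "k \<le> m" "k \<le> 1 / C" using m(1) C by (auto simp: k_def)
  define R where "R = k / 4"
  have R: "R > 0" "3 * R < 1 / C" "3 * R < m" using k by (simp_all add: R_def)
  have "gram ?q \<rho> \<noteq> 0" if "cmod (?q \<rho>) \<le> 3 * R" for \<rho>
  proof
    assume "gram ?q \<rho> = 0"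
    moreover have "norm \<rho> \<le> C" using elliptic_at_infinityD[OF ell, of \<rho>] that R(2) by linarith
    ultimately show False using m(2)[of \<rho>] that R(3) by auto
  qed
  with R show ?thesis by blast
qed

text \<open>The constant will be enlarged, which can lower the threshold; by continuity a strict
  inequality survives a small enlargement.\<close>

lemma threshold_eventually:
  assumes "threshold \<delta>" "C > 0" "x < \<delta> C"
  shows "\<forall>\<^sub>F C' in at_right C. x < \<delta> C'"
proof -
  have "isCont \<delta> C"
    using assms(1,2) by (simp add: threshold_def continuous_on_eq_continuous_at)
  then have "(\<delta> \<longlongrightarrow> \<delta> C) (at_right C)"
    by (simp add: isCont_def filterlim_at_split)
  then show ?thesis using assms(3) by (rule order_tendstoD(1))
qed

lemma tube_lemma_ball:
  fixes W :: "(complex \<times> 'b::metric_space) set"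
  assumes "compact K" "open W" "\<And>\<rho>. \<rho> \<in> K \<Longrightarrow> (0, \<rho>) \<in> W"
  shows "\<exists>s>0. \<forall>\<zeta> \<rho>. cmod \<zeta> < s \<longrightarrow> \<rho> \<in> K \<longrightarrow> (\<zeta>, \<rho>) \<in> W"
proof -
  have sub: "{0} \<times> K \<subseteq> W" using assms(3) by auto
  obtain X0 where X0: "0 \<in> X0" "open X0" "X0 \<times> K \<subseteq> W"
    using Elementary_Topology.tube_lemma[OF assms(1,2) sub] by blast
  obtain s where s: "s > 0" "ball 0 s \<subseteq> X0" using openE[OF X0(2,1)] .
  then show ?thesis using X0(3) by (intro exI[of _ s]) (auto simp: subset_iff)
qed

text \<open>Both quantities as functions of the derivative only, to make their continuity in the deformation parameter explicit.\<close>

definition wedge_norm :: "(R4 \<Rightarrow> complex) \<Rightarrow> real" where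
  "wedge_norm D = norm_2form (wedge (\<lambda>v. Re (D v)) (\<lambda>v. Im (D v)))"

definition bracket :: "(R4 \<Rightarrow> complex) \<Rightarrow> real" where
  "bracket D = (\<Sum>j\<in>UNIV. Re (D (0, axis j 1)) * Im (D (axis j 1, 0)) - Re (D (axis j 1, 0)) * Im (D (0, axis j 1)))"

lemma
  assumes "((\<lambda>\<rho>. p (cplx \<rho>)) has_derivative D) (at \<rho>)"
  shows norm_2form_eq_wedge_norm: "norm_2form (wedge (differential (re_part p) \<rho>) (differential (im_part p) \<rho>)) = wedge_norm D"
    and poisson_eq_bracket: "poisson (re_part p) (im_part p) \<rho> = bracket D"
  by (simp_all add: wedge_norm_def poisson_def bracket_def differential_re_part[OF assms] differential_im_part[OF assms])

lemma
  fixes D :: "'x::topological_space \<Rightarrow> R4 \<Rightarrow> complex"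
  assumes "\<And>v. continuous_on A (\<lambda>x. D x v)"
  shows continuous_on_wedge_norm: "continuous_on A (\<lambda>x. wedge_norm (D x))"
    and continuous_on_bracket: "continuous_on A (\<lambda>x. bracket (D x))"
  unfolding wedge_norm_def bracket_def norm_2form_def wedge_def
  by (intro continuous_intros assms; simp)+


text \<open>Once \<open>C\<close> is raised to \<open>C'\<close>, every condition is open in
  \<zeta>, because the points that matter lie in fixed compact sets, and the tori are carried along
  by the inverse shear. The actions stay the same as functions, so the old spectral density serves
  \<open>p'\<close> as well, while for the Weyl density only existence is claimed.\<close>

lemma shear_perturbation:
  fixes p :: "C4 \<Rightarrow> complex"
  assumes thr: "threshold \<delta>" "threshold \<eta>" "\<forall>c>0. \<eta> c \<le> 1 / c"
    and A4: "condA4 \<delta> C p" and ne: "real_fibre p 0 \<noteq> {}"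
    and R: "R > 0" "3 * R < 1 / C" "\<And>\<rho>. cmod (p (cplx \<rho>)) \<le> 3 * R \<Longrightarrow> gram (\<lambda>\<rho>. p (cplx \<rho>)) \<rho> \<noteq> 0"
    and \<phi>: "\<phi> holomorphic_on UNIV" "B > 0" "\<And>w. \<bar>Im w\<bar> < 1 / C \<Longrightarrow> cmod (\<phi> w) \<le> B"
    and V: "V \<subseteq> ball 0 R" "condA5 \<eta> C V p \<Phi>" and \<epsilon>: "\<epsilon> > 0"
  shows "\<exists>s>0. \<forall>\<zeta>. cmod \<zeta> < s \<longrightarrow> (\<exists>p' C' \<Phi>' w'. p' = (\<lambda>\<rho>. p (shear \<phi> \<zeta> \<rho>)) \<and>
     holomorphic4_on p' (tube (1 / (2 * C))) \<and> bounded (p' ` tube (1 / (2 * C))) \<and>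
     (SUP \<rho>\<in>tube (1 / (2 * C)). cmod (p' \<rho> - p \<rho>)) < \<epsilon> \<and>
     condA1 p' \<and> condA2 p' \<and> condA3 p' \<and> condA4 \<delta> C' p' \<and> condA5 \<eta> C' V p' \<Phi>' \<and>
     actions \<Phi>' = actions \<Phi> \<and> weyl_density V p' w')"
proof -
  have C: "C > 0" and p: "holomorphic4_on p (tube (1 / C))" and bdd: "\<And>\<rho>. \<rho> \<in> tube (1 / C) \<Longrightarrow> cmod (p \<rho>) \<le> C"
    and ell: "elliptic_at_infinity C p" and unif: "uniform_constant C p"
    and nf: "\<And>\<rho>. \<rho> \<in> real_fibre p 0 \<Longrightarrow> norm_2form (wedge (differential (re_part p) \<rho>) (differential (im_part p) \<rho>)) \<ge> 1 / C"
    and pb: "\<And>\<rho>. \<rho> \<in> real_fibre p 0 \<Longrightarrow> \<bar>poisson (re_part p) (im_part p) \<rho>\<bar> < \<delta> C"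
    using A4 by (auto simp: condA4_def uniform_constant_def)
  have V0: "open V" "0 \<in> V" and tf: "torus_family \<eta> C V p \<Phi>" and diffeo: "diffeomorphism_onto_image (actions \<Phi>) V"
    using V(2) by (auto simp: condA5_def)
  obtain e where e: "e < \<eta> C" "\<And>z. z \<in> V \<Longrightarrow> \<exists>\<phi> :: real^2 \<Rightarrow> R4. torus_embedding \<phi> \<and> range \<phi> = real_fibre p z \<and>
        (\<forall>\<theta>. norm (\<Phi> z \<theta> - cplx (\<phi> \<theta>)) \<le> e)"
    using tf by (auto simp: torus_family_def)
  have \<Phi>sm: "smooth_on (\<lambda>(z, \<theta>). \<Phi> z \<theta>) (V \<times> UNIV)"
    and \<Phi>: "\<And>z. z \<in> V \<Longrightarrow> torus_embedding (\<Phi> z)"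
      "\<And>z. z \<in> V \<Longrightarrow> range (\<Phi> z) \<subseteq> {\<rho> \<in> tube (1 / C). p \<rho> = z}"
      "\<And>z \<theta> u v. z \<in> V \<Longrightarrow> sigma (differential (\<Phi> z) \<theta> u) (differential (\<Phi> z) \<theta> v) = 0"
      "\<And>z j. z \<in> V \<Longrightarrow> xi_dx_integral (cycle \<Phi> j z) \<in> \<real>"
    using tf unfolding torus_family_def by blast+

  \<comment> \<open>The sheared family on real points\<close>
  define P where "P \<rho> = p (cplx \<rho>)" for \<rho>
  have smP: "smooth_on P UNIV" unfolding P_def by (rule smooth_on_real_restriction[OF p]) (use C in simp)
  have contP: "continuous_on A P" for A using smooth_on_continuous[OF smP] continuous_on_subset by blast
  have F0: "real_fibre p z = {\<rho>. P \<rho> = z}" for z by (simp add: real_fibre_def P_def)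
  have small: "norm \<rho> \<le> C" if "cmod (P \<rho>) \<le> 3 * R" for \<rho>
    using elliptic_at_infinityD[OF ell, of \<rho>] that R(2) unfolding P_def by linarith
  have cptP: "compact {\<rho>. cmod (P \<rho>) \<le> 3 * R}" by (rule compact_sublevel[OF contP small])
  have cptF: "compact {\<rho>. P \<rho> = 0}"
  proof -
    have "compact {\<rho>. cmod (P \<rho>) \<le> 0}" by (rule compact_sublevel[OF contP small]) (use R(1) in simp)
    then show ?thesis by simp
  qed
  \<comment> \<open>Keeps the displacement \<open>cmod \<zeta> * B\<close> below
    \<open>1 / (4 * C)\<close>, a quarter of the tube width, as \<open>tube_lipschitz\<close>
    demands.\<close>
  define s0 where "s0 = 1 / (4 * C * B)"
  have s0: "s0 > 0" "s0 * B = 1 / (4 * C)" using C \<phi>(2) by (auto simp: s0_def)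
  have \<phi>real: "cmod (\<phi> (of_real x)) \<le> B" for x by (rule \<phi>(3)) (use C in simp)
  define Q where "Q y = p (shear \<phi> (fst y) (cplx (snd y)))" for y :: "complex \<times> R4"
  have Q_eq: "Q (\<zeta>, \<rho>) = p (cplx \<rho> + cscale (\<zeta> * \<phi> (of_real (fst \<rho> $ 1))) dir_xi1)" for \<zeta> \<rho>
    by (simp add: Q_def shear_def cplx_def)
  have QP: "(\<lambda>\<rho>. Q (0, \<rho>)) = P" by (simp add: Q_def P_def[abs_def])
  let ?U = "ball 0 s0 \<times> (UNIV :: R4 set)"
  have openU: "open ?U" by (intro open_Times) auto
  have shift: "cmod (\<zeta> * \<phi> (of_real x)) \<le> cmod \<zeta> * B" for \<zeta> x
    unfolding norm_mult using \<phi>real by (intro mult_left_mono) auto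
  have inU: "cmod \<zeta> * B < 1 / (4 * C)" if "cmod \<zeta> < s0" for \<zeta>
    using mult_strict_right_mono[OF that \<phi>(2)] s0(2) by simp
  have quarter: "1 / (4 * C) < 1 / C" using C by (simp add: field_simps)
  have smQ: "smooth_on Q ?U"
    unfolding Q_def
  proof (rule smooth_on_compose[OF openU open_tube _ _ holomorphic4_on_smooth[OF open_tube p]])
    show "(\<lambda>y. shear \<phi> (fst y) (cplx (snd y))) ` ?U \<subseteq> tube (1 / C)"
    proof
      fix x assume "x \<in> (\<lambda>y. shear \<phi> (fst y) (cplx (snd y))) ` ?U"
      then obtain \<zeta> :: complex and \<rho> :: R4 where "\<zeta> \<in> ball 0 s0" and x: "x = shear \<phi> \<zeta> (cplx \<rho>)" by auto
      then have "cmod (\<zeta> * \<phi> (of_real (fst \<rho> $ 1))) < 1 / C"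
        using inU[of \<zeta>] shift[of \<zeta> "fst \<rho> $ 1"] quarter by simp
      then have "cplx \<rho> + cscale (\<zeta> * \<phi> (of_real (fst \<rho> $ 1))) dir_xi1 \<in> tube (1 / C)" by (intro in_tube_cscale) simp
      then show "x \<in> tube (1 / C)" unfolding x by (simp add: shear_def cplx_def)
    qed
    have cp: "smooth_on (\<lambda>y. cplx (snd y)) ?U"
      by (intro smooth_on_linear openU bounded_linear_compose[OF bounded_linear_cplx bounded_linear_snd])
    have "smooth_on (\<lambda>y. fst (cplx (snd y)) $ 1) ?U"
      by (rule smooth_on_bounded_linear[OF openU bounded_linear_compose[OF bounded_linear_vec_nth bounded_linear_fst] cp])
    from smooth_on_compose[OF openU open_UNIV _ this entire_smooth_on[OF \<phi>(1)]]
    have ph: "smooth_on (\<lambda>y. \<phi> (fst (cplx (snd y)) $ 1)) ?U" by simp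
    show "smooth_on (\<lambda>y. shear \<phi> (fst y) (cplx (snd y))) ?U"
      unfolding shear_def
      by (intro smooth_on_add cp smooth_on_bilinear[OF _ bounded_bilinear_cscale] smooth_on_mult ph smooth_on_const openU
          smooth_on_linear[OF _ bounded_linear_fst])
  qed
  define DQ where "DQ y v = frechet_derivative Q (at y) (0, v)" for y v
  have DQ: "((\<lambda>\<rho>. p (shear \<phi> \<zeta> (cplx \<rho>))) has_derivative DQ (\<zeta>, \<rho>)) (at \<rho>)" if "cmod \<zeta> < s0" for \<zeta> \<rho>
  proof -
    have "(\<zeta>, \<rho>) \<in> ?U" using that by simp
    have "((\<lambda>\<rho>. Q (\<zeta>, \<rho>)) has_derivative (\<lambda>v. frechet_derivative Q (at (\<zeta>, \<rho>)) (0, v))) (at \<rho>)"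
      by (rule has_derivative_compose[of "\<lambda>\<rho>. (\<zeta>, \<rho>)" "\<lambda>v. (0, v)" \<rho> UNIV Q, OF _ smooth_on_has_derivative[OF openU smQ \<open>(\<zeta>, \<rho>) \<in> ?U\<close>]])
        (auto intro!: derivative_eq_intros)
    then show ?thesis by (simp add: Q_def DQ_def[abs_def])
  qed
  have contDQ: "continuous_on ?U (\<lambda>y. DQ y v)" for v
    unfolding DQ_def by (intro smooth_on_continuous smooth_on_frechet_derivative openU smQ)
  have DQ0: "((\<lambda>\<rho>. p (cplx \<rho>)) has_derivative DQ (0, \<rho>)) (at \<rho>)" for \<rho>
    using DQ[of 0 \<rho>] s0(1) by simp
  have lipP: "cmod (p (shear \<phi> \<zeta> \<rho>) - p \<rho>) \<le> 8 * C * C * (cmod \<zeta> * B)"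
    if "\<rho> \<in> tube (1 / (2 * C))" "cmod \<zeta> < s0" for \<zeta> \<rho>
  proof -
    have "norm (Im4 \<rho>) < 1 / C" using that(1) C by (simp add: tube_def field_simps)
    then have "cmod (\<phi> (fst \<rho> $ 1)) \<le> B" using abs_Im_component_le[of \<rho>] by (intro \<phi>(3)) simp
    then have w: "cmod (\<zeta> * \<phi> (fst \<rho> $ 1)) \<le> cmod \<zeta> * B" unfolding norm_mult by (intro mult_left_mono) auto
    have "cmod (p (\<rho> + cscale (\<zeta> * \<phi> (fst \<rho> $ 1)) dir_xi1) - p \<rho>) \<le> 8 * C / (1 / C) * cmod (\<zeta> * \<phi> (fst \<rho> $ 1))"
    proof (rule tube_lipschitz[OF p bdd])
      show "0 < 1 / C" using C by simp
      show "\<rho> \<in> tube (1 / C / 2)" using that(1) by (simp add: mult.commute)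
      show "cmod (\<zeta> * \<phi> (fst \<rho> $ 1)) \<le> 1 / C / 4" using w inU[OF that(2)] by (simp add: mult.commute)
    qed
    also have "\<dots> \<le> 8 * C / (1 / C) * (cmod \<zeta> * B)" using w C by (intro mult_left_mono) auto
    finally show ?thesis by (simp add: shear_def)
  qed
  have lipR: "cmod (p (shear \<phi> \<zeta> (cplx \<rho>)) - P \<rho>) \<le> 8 * C * C * (cmod \<zeta> * B)" if "cmod \<zeta> < s0" for \<zeta> \<rho>
    unfolding P_def by (rule lipP) (use that C in auto)

  \<comment> \<open>Margins and the enlarged constant\<close>
  obtain m where m: "m < \<delta> C" "\<And>\<rho>. P \<rho> = 0 \<Longrightarrow> \<bar>bracket (DQ (0, \<rho>))\<bar> < m"
  proof -
    have "continuous_on {\<rho>. P \<rho> = 0} (\<lambda>\<rho>. DQ (0, \<rho>) v)" for v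
      by (rule continuous_on_compose2[OF contDQ, of _ "\<lambda>\<rho>. (0, \<rho>)"]) (use s0(1) in \<open>auto intro!: continuous_intros\<close>)
    then have "continuous_on {\<rho>. P \<rho> = 0} (\<lambda>\<rho>. \<bar>bracket (DQ (0, \<rho>))\<bar>)"
      by (intro continuous_on_rabs continuous_on_bracket)
    then obtain \<rho>m where \<rho>m: "P \<rho>m = 0" "\<And>\<rho>. P \<rho> = 0 \<Longrightarrow> \<bar>bracket (DQ (0, \<rho>))\<bar> \<le> \<bar>bracket (DQ (0, \<rho>m))\<bar>"
      using continuous_attains_sup[OF cptF] ne unfolding F0 by blast
    have "\<bar>bracket (DQ (0, \<rho>m))\<bar> < \<delta> C"
      using pb[of \<rho>m] \<rho>m(1) unfolding poisson_eq_bracket[OF DQ0] F0 by simp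
    then obtain m where "\<bar>bracket (DQ (0, \<rho>m))\<bar> < m" "m < \<delta> C" using dense by blast
    then show thesis using \<rho>m(2) by (intro that[of m]) force+
  qed
  define e' where "e' = (e + \<eta> C) / 2"
  have e': "e < e'" "e' < \<eta> C" using e(1) by (auto simp: e'_def)
  have "\<forall>\<^sub>F C' in at_right C. C' > C \<and> C' < 2 * C \<and> m < \<delta> C' \<and> e' < \<eta> C'"
    using eventually_at_right_less[of C] threshold_eventually[OF thr(1) C m(1)] threshold_eventually[OF thr(2) C e'(2)]
      eventually_at_right_field[of "\<lambda>C'. C' < 2 * C" C] C
    by (auto simp: eventually_conj_iff intro: exI[of _ "2 * C"])
  \<comment> \<open>The inequalities with \<open>C\<close> may be equalities for \<open>p\<close>,
    so room is made by \<open>C' > C\<close>. The margin \<open>m\<close> exists because the zero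
    fibre is compact, and \<open>e'\<close> leaves room for the tori to move. The bound
    \<open>C' < 2 * C\<close> keeps the tube of width \<open>1 / (2 * C)\<close>, which does not
    depend on \<epsilon>, inside the new one.\<close>
  then obtain C' where C': "C' > C" "C' < 2 * C" "m < \<delta> C'" "e' < \<eta> C'"
    using eventually_happens by fastforce
  have C'0: "C' > 0" "1 / C' < 1 / C" "1 / (2 * C) < 1 / C'" using C C' by (auto simp: field_simps)
  have \<eta>C': "\<eta> C' \<le> 1 / C'" using thr(3) C'0(1) by blast

  \<comment> \<open>The alternative \<open>Q y \<noteq> 0\<close> lets the condition hold at every
    \<rho> when \<zeta> = 0, not just on the fibre. As an open condition it persists for small
    \<zeta> over the ball of radius \<open>C'\<close>, which contains the zero fibre of every
    perturbed symbol by ellipticity.\<close>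
  define W1 where "W1 = {y \<in> ?U. wedge_norm (DQ y) > 1 / C' \<and> \<bar>bracket (DQ y)\<bar> < m} \<union> {y \<in> ?U. Q y \<noteq> 0}"
  have openpos: "open {y \<in> ?U. f y > c}" if "continuous_on ?U f" for f and c :: real
  proof -
    have "{y \<in> ?U. f y > c} = {y \<in> ?U. - f y < - c}" by auto
    then show ?thesis using open_strict_sublevel[OF openU continuous_on_minus[OF that], of "- c"] by simp
  qed
  have cW: "continuous_on ?U (\<lambda>y. wedge_norm (DQ y))" "continuous_on ?U (\<lambda>y. \<bar>bracket (DQ y)\<bar>)" "continuous_on ?U (\<lambda>y. cmod (Q y))"
    by (intro continuous_on_wedge_norm continuous_on_rabs continuous_on_bracket contDQ continuous_on_norm smooth_on_continuous[OF smQ])+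
  have W1_eq: "W1 = ({y \<in> ?U. wedge_norm (DQ y) > 1 / C'} \<inter> {y \<in> ?U. \<bar>bracket (DQ y)\<bar> < m}) \<union> {y \<in> ?U. cmod (Q y) > 0}"
    by (auto simp: W1_def)
  have openW1: "open W1"
    unfolding W1_eq by (intro open_Un open_Int openpos cW open_strict_sublevel openU)
  have "(0, \<rho>) \<in> W1" for \<rho>
  proof (cases "P \<rho> = 0")
    case True
    have "wedge_norm (DQ (0, \<rho>)) \<ge> 1 / C"
      using nf[of \<rho>] True unfolding norm_2form_eq_wedge_norm[OF DQ0] F0 by simp
    then show ?thesis using m(2)[OF True] C'0 s0(1) by (simp add: W1_def)
  next
    case False
    then show ?thesis using s0(1) by (simp add: W1_def Q_def P_def)
  qed
  then obtain s1 where s1: "s1 > 0" "\<And>\<zeta> \<rho>. cmod \<zeta> < s1 \<Longrightarrow> \<rho> \<in> cball 0 C' \<Longrightarrow> (\<zeta>, \<rho>) \<in> W1"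
    using tube_lemma_ball[OF compact_cball openW1] by blast
  \<comment> \<open>Nondegeneracy up to level \<open>3 * R\<close> of \<open>P\<close>, for the
    existence of the new Weyl density.\<close>
  define W2 where "W2 = {y \<in> ?U. wedge_norm (DQ y) > 0}"
  have openW2: "open W2" unfolding W2_def by (rule openpos[OF cW(1)])
  have wn: "wedge_norm (DQ (\<zeta>, \<rho>)) = sqrt (gram (\<lambda>\<rho>. p (shear \<phi> \<zeta> (cplx \<rho>))) \<rho>)" if "cmod \<zeta> < s0" for \<zeta> \<rho>
  proof -
    have D: "frechet_derivative (\<lambda>\<rho>. p (shear \<phi> \<zeta> (cplx \<rho>))) (at \<rho>) = DQ (\<zeta>, \<rho>)"
      using frechet_derivative_at[OF DQ[OF that]] by simp
    show ?thesis
      using norm_2form_eq_gram[of "\<lambda>\<rho>. p (shear \<phi> \<zeta> (cplx \<rho>))" \<rho>] has_derivative_linear[OF DQ[OF that, of \<rho>]]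
      unfolding D wedge_norm_def by blast
  qed
  have "(0, \<rho>) \<in> W2" if "cmod (P \<rho>) \<le> 3 * R" for \<rho>
  proof -
    have "wedge_norm (DQ (0, \<rho>)) = sqrt (gram (\<lambda>\<rho>. p (cplx \<rho>)) \<rho>)" using wn[of 0 \<rho>] s0(1) by simp
    moreover have "wedge_norm (DQ (0, \<rho>)) \<ge> 0"
      unfolding wedge_norm_def norm_2form_def by (simp add: sum_nonneg)
    ultimately show ?thesis using R(3)[of \<rho>] that s0(1) unfolding W2_def P_def by (simp add: less_le)
  qed
  then obtain s2 where s2: "s2 > 0" "\<And>\<zeta> \<rho>. cmod \<zeta> < s2 \<Longrightarrow> cmod (P \<rho>) \<le> 3 * R \<Longrightarrow> (\<zeta>, \<rho>) \<in> W2"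
    using tube_lemma_ball[OF cptP openW2] by blast

  \<comment> \<open>Size of the deformation parameter\<close>
  define \<mu> where "\<mu> = min R (min (1 / C - 1 / C') (\<epsilon> / 2))"
  have \<mu>: "\<mu> > 0" "\<mu> \<le> R" "\<mu> \<le> 1 / C - 1 / C'" "\<mu> \<le> \<epsilon> / 2"
  proof -
    show "\<mu> > 0" "\<mu> \<le> R" "\<mu> \<le> 1 / C - 1 / C'" using R(1) C'0 \<epsilon> by (auto simp: \<mu>_def)
    show "\<mu> \<le> \<epsilon> / 2" unfolding \<mu>_def by (rule order_trans[OF min.cobounded2 min.cobounded2])
  qed
  \<comment> \<open>The complex torus and the real fibre each move by at most \<tau>, so their
    distance grows from at most \<open>e\<close> to at most
    \<open>e + 2 * \<tau> = e'\<close>.\<close>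
  define \<tau> where "\<tau> = (e' - e) / 2"
  have \<tau>: "\<tau> > 0" using e' by (simp add: \<tau>_def)
  define s3 where "s3 = min s0 (min (\<mu> / (8 * C * C * B)) (min (\<tau> / B) ((1 / C - 1 / C') / B)))"
  have s3: "s3 > 0" "s3 \<le> s0"
    using s0(1) \<mu>(1) \<tau> C'0 C \<phi>(2) by (auto simp: s3_def)
  have s3': "8 * C * C * (cmod \<zeta> * B) \<le> \<mu>" "cmod \<zeta> * B \<le> \<tau>" "cmod \<zeta> * B < 1 / C - 1 / C'" if "cmod \<zeta> < s3" for \<zeta>
  proof -
    have "cmod \<zeta> \<le> \<mu> / (8 * C * C * B)" "cmod \<zeta> \<le> \<tau> / B" "cmod \<zeta> < (1 / C - 1 / C') / B" using that by (auto simp: s3_def)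
    then show "8 * C * C * (cmod \<zeta> * B) \<le> \<mu>" "cmod \<zeta> * B \<le> \<tau>" "cmod \<zeta> * B < 1 / C - 1 / C'"
    proof -
      assume le: "cmod \<zeta> \<le> \<mu> / (8 * C * C * B)" "cmod \<zeta> \<le> \<tau> / B" "cmod \<zeta> < (1 / C - 1 / C') / B"
      have "8 * C * C * B > 0" using C \<phi>(2) by simp
      then have "cmod \<zeta> * (8 * C * C * B) \<le> \<mu>" using le(1) by (simp only: pos_le_divide_eq)
      then show "8 * C * C * (cmod \<zeta> * B) \<le> \<mu>" by (simp only: ac_simps)
      show "cmod \<zeta> * B \<le> \<tau>" using le(2) \<phi>(2) by (simp only: pos_le_divide_eq)
      show "cmod \<zeta> * B < 1 / C - 1 / C'" using le(3) \<phi>(2) by (simp only: pos_less_divide_eq)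
    qed
  qed
  have "\<exists>s4>0. s4 \<le> s3 \<and> (\<forall>\<zeta>\<in>ball 0 s4. \<exists>S. smooth_on S {\<rho>. cmod (P \<rho>) < 3 * R} \<and>
     (\<forall>\<rho>. cmod (P \<rho>) < 3 * R \<longrightarrow> norm (S \<rho> - \<rho>) \<le> \<tau> \<and> inj (frechet_derivative S (at \<rho>))) \<and>
     inj_on S {\<rho>. cmod (P \<rho>) \<le> R} \<and>
     (\<forall>z\<in>cball 0 R. S ` {\<rho>. P \<rho> = z} = {\<rho>. Q (\<zeta>, \<rho>) = z}))"
    unfolding QP[symmetric]
  proof (rule fibre_stability[OF s3(1) _ R(1) _ _ _ \<tau>])
    show "smooth_on Q (ball 0 s3 \<times> UNIV)" by (rule smooth_on_subset[OF smQ]) (use s3(2) in auto)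
    show "compact {\<rho>. cmod (Q (0, \<rho>)) \<le> 3 * R}" using cptP unfolding QP[symmetric] .
    show "gram (\<lambda>\<rho>. Q (0, \<rho>)) \<rho> \<noteq> 0" if "cmod (Q (0, \<rho>)) \<le> 3 * R" for \<rho>
      using R(3)[of \<rho>] that by (simp add: Q_def)
    show "cmod (Q (\<zeta>, \<rho>) - Q (0, \<rho>)) \<le> R" if "\<zeta> \<in> ball 0 s3" for \<zeta> \<rho>
      using lipR[of \<zeta> \<rho>] s3'(1)[of \<zeta>] that s3(2) \<mu>(2) by (simp add: Q_def P_def)
  qed
  then obtain s4 where s4: "s4 > 0" "s4 \<le> s3" "\<And>\<zeta>. cmod \<zeta> < s4 \<Longrightarrow> \<exists>S. smooth_on S {\<rho>. cmod (P \<rho>) < 3 * R} \<and>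
     (\<forall>\<rho>. cmod (P \<rho>) < 3 * R \<longrightarrow> norm (S \<rho> - \<rho>) \<le> \<tau> \<and> inj (frechet_derivative S (at \<rho>))) \<and>
     inj_on S {\<rho>. cmod (P \<rho>) \<le> R} \<and>
     (\<forall>z\<in>cball 0 R. S ` {\<rho>. P \<rho> = z} = {\<rho>. Q (\<zeta>, \<rho>) = z})"
    by (auto simp: Ball_def)

  define s where "s = min s1 (min s2 s4)"
  have s: "s > 0" "s \<le> s1" "s \<le> s2" "s \<le> s4" "s \<le> s3" "s \<le> s0" using s1(1) s2(1) s4(1,2) s3 by (auto simp: s_def)
  show ?thesis
  proof (rule exI[of _ s], intro conjI allI impI)
    show "s > 0" by fact
    fix \<zeta> assume "cmod \<zeta> < s"
    then have \<zeta>: "cmod \<zeta> < s0" "cmod \<zeta> < s1" "cmod \<zeta> < s2" "cmod \<zeta> < s3" "cmod \<zeta> < s4" using s by auto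

    \<comment> \<open>The perturbed symbol and its uniform bounds\<close>
    define p' where "p' = (\<lambda>\<rho>. p (shear \<phi> \<zeta> \<rho>))"
    have p'Q: "p' (cplx \<rho>) = Q (\<zeta>, \<rho>)" for \<rho> by (simp add: p'_def Q_def)
    have F': "real_fibre p' z = {\<rho>. Q (\<zeta>, \<rho>) = z}" for z by (simp add: real_fibre_def p'Q)
    obtain S where S: "smooth_on S {\<rho>. cmod (P \<rho>) < 3 * R}"
      "\<And>\<rho>. cmod (P \<rho>) < 3 * R \<Longrightarrow> norm (S \<rho> - \<rho>) \<le> \<tau>"
      "\<And>\<rho>. cmod (P \<rho>) < 3 * R \<Longrightarrow> inj (frechet_derivative S (at \<rho>))"
      "inj_on S {\<rho>. cmod (P \<rho>) \<le> R}" "\<And>z. z \<in> cball 0 R \<Longrightarrow> S ` {\<rho>. P \<rho> = z} = {\<rho>. Q (\<zeta>, \<rho>) = z}"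
      using s4(3)[OF \<zeta>(5)] by auto
    have \<phi>B: "cmod (\<zeta>' * \<phi> (fst \<rho> $ 1)) \<le> cmod \<zeta>' * B" if "\<rho> \<in> tube (1 / C)" for \<zeta>' :: complex and \<rho> :: C4
      unfolding norm_mult using abs_Im_component_le[of \<rho>] that by (intro mult_left_mono \<phi>(3)) (auto simp: tube_def)
    have shear_tube: "shear \<phi> \<zeta> \<rho> \<in> tube (1 / C)" if "\<rho> \<in> tube (1 / C')" for \<rho>
    proof -
      have "\<rho> \<in> tube (1 / C)" using that tube_mono[of "1 / C'" "1 / C"] C'0(2) by auto
      then have "norm (Im4 \<rho>) + cmod (\<zeta> * \<phi> (fst \<rho> $ 1)) < 1 / C"
        using \<phi>B[of \<rho> \<zeta>] s3'(3)[OF \<zeta>(4)] that by (simp add: tube_def)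
      then show ?thesis unfolding shear_def by (rule in_tube_cscale)
    qed
    have half: "tube (1 / (2 * C)) \<subseteq> tube (1 / C')" using C'0(3) by (intro tube_mono) simp
    have holo': "holomorphic4_on p' (tube (1 / C'))"
      unfolding p'_def by (rule holomorphic4_on_shear[OF p \<phi>(1) shear_tube])
    have bdd': "cmod (p' \<rho>) \<le> C'" if "\<rho> \<in> tube (1 / C')" for \<rho>
      using bdd[OF shear_tube[OF that]] C'(1) by (simp add: p'_def)
    have lip': "cmod (p' \<rho> - p \<rho>) \<le> \<mu>" if "\<rho> \<in> tube (1 / (2 * C))" for \<rho>
      using lipP[OF that \<zeta>(1)] s3'(1)[OF \<zeta>(4)] by (simp add: p'_def)
    have ell': "elliptic_at_infinity C' p'"
      unfolding elliptic_at_infinity_def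
    proof (intro allI impI)
      fix \<rho> :: R4 assume "C' \<le> norm \<rho>"
      then have "cmod (p (cplx \<rho>)) \<ge> 1 / C" using C'(1) by (intro elliptic_at_infinityD[OF ell]) simp
      moreover have "cmod (p' (cplx \<rho>) - p (cplx \<rho>)) \<le> 1 / C - 1 / C'"
        using lip'[of "cplx \<rho>"] \<mu>(3) C by simp
      moreover have "cmod (p (cplx \<rho>)) - cmod (p' (cplx \<rho>)) \<le> cmod (p' (cplx \<rho>) - p (cplx \<rho>))"
        by (metis norm_minus_commute norm_triangle_ineq2)
      ultimately show "1 / C' \<le> cmod (p' (cplx \<rho>))" by linarith
    qed
    have DQ': "((\<lambda>\<rho>. p' (cplx \<rho>)) has_derivative DQ (\<zeta>, \<rho>)) (at \<rho>)" for \<rho>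
      unfolding p'_def by (rule DQ[OF \<zeta>(1)])
    have inW1: "wedge_norm (DQ (\<zeta>, \<rho>)) > 1 / C' \<and> \<bar>bracket (DQ (\<zeta>, \<rho>))\<bar> < m" if "\<rho> \<in> real_fibre p' 0" for \<rho>
    proof -
      have "norm \<rho> \<le> C'"
        using elliptic_at_infinityD[OF ell', of \<rho>] that C'0(1) by (force simp: real_fibre_def)
      then have "(\<zeta>, \<rho>) \<in> W1" using s1(2)[OF \<zeta>(2)] by simp
      moreover have "Q (\<zeta>, \<rho>) = 0" using that unfolding F' by simp
      ultimately show ?thesis by (auto simp: W1_def)
    qed
    have unif': "uniform_constant C' p'"
      unfolding uniform_constant_def
      using C'0(1) holo' bdd' ell' inW1 norm_2form_eq_wedge_norm[OF DQ'] by (auto intro: less_imp_le)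
    have A4': "condA4 \<delta> C' p'"
      unfolding condA4_def poisson_eq_bracket[OF DQ'] using unif' inW1 C'(3) by force
    have A3': "condA3 p'"
      unfolding condA3_def
    proof
      fix \<rho> assume "\<rho> \<in> real_fibre p' 0"
      then have "wedge_norm (DQ (\<zeta>, \<rho>)) > 1 / C'" using inW1 by blast
      moreover have "1 / C' > 0" using C'0(1) by simp
      ultimately have "wedge_norm (DQ (\<zeta>, \<rho>)) > 0" by linarith
      then show "lin_indep2 (differential (re_part p') \<rho>) (differential (im_part p') \<rho>)"
        unfolding norm_2form_eq_wedge_norm[OF DQ', symmetric] by (rule lin_indep2_of_norm_2form)
    qed
    have A2': "condA2 p'" unfolding condA2_def using ell' C'0(1) by blast

    \<comment> \<open>The transported tori\<close>
    define \<Phi>' where "\<Phi>' z \<theta> = (if z \<in> V then shear \<phi> (- \<zeta>) (\<Phi> z \<theta>) else \<Phi> z \<theta>)" for z \<theta>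
    have \<Phi>z: "smooth_on (\<Phi> z) UNIV" if "z \<in> V" for z using \<Phi>(1)[OF that] by (simp add: torus_embedding_def)
    \<comment> \<open>Leaving the parametrization untouched outside \<open>V\<close>, where nothing
      is known about it, makes the actions equal as functions and not only on \<open>V\<close>. No
      comparison of derivatives is then needed for the spectral density.\<close>
    have xi: "xi_dx_integral (cycle \<Phi>' j z) = xi_dx_integral (cycle \<Phi> j z)" for j z
    proof (cases "z \<in> V")
      case True
      have "cycle \<Phi>' j z = (\<lambda>t. shear \<phi> (- \<zeta>) (cycle \<Phi> j z t))" using True by (simp add: cycle_def[abs_def] \<Phi>'_def)
      moreover have "smooth_on (cycle \<Phi> j z) UNIV"
        unfolding cycle_def[abs_def]
        by (rule smooth_on_compose[OF open_UNIV open_UNIV _ _ \<Phi>z[OF True]]) (auto intro!: smooth_on_linear bounded_linear_scaleR_left)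
      moreover have "cycle \<Phi> j z 1 = cycle \<Phi> j z 0"
        using \<Phi>(1)[OF True] by (auto simp: torus_embedding_def cycle_def axis_def)
      ultimately show ?thesis using xi_dx_integral_shear[OF \<phi>(1)] by simp
    next
      case False
      then have "cycle \<Phi>' j z = cycle \<Phi> j z" by (simp add: cycle_def[abs_def] \<Phi>'_def)
      then show ?thesis by simp
    qed
    have act: "actions \<Phi>' = actions \<Phi>" by (simp add: actions_def[abs_def] xi)
    have torus': "\<exists>\<psi> :: real^2 \<Rightarrow> R4. torus_embedding \<psi> \<and> range \<psi> = real_fibre p' z \<and> (\<forall>\<theta>. norm (\<Phi>' z \<theta> - cplx (\<psi> \<theta>)) \<le> e')"
      if z: "z \<in> V" for z
    proof -
      have zR: "cmod z < R" using z V(1) by auto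
      obtain \<psi> :: "real^2 \<Rightarrow> R4" where \<psi>: "torus_embedding \<psi>" "range \<psi> = real_fibre p z" "\<And>\<theta>. norm (\<Phi> z \<theta> - cplx (\<psi> \<theta>)) \<le> e"
        using e(2)[OF z] by blast
      have P\<psi>: "P (\<psi> \<theta>) = z" for \<theta> using \<psi>(2) unfolding F0 by blast
      then have P3: "cmod (P (\<psi> \<theta>)) < 3 * R" "cmod (P (\<psi> \<theta>)) \<le> R" for \<theta> using zR R(1) by auto
      have sm\<psi>: "smooth_on \<psi> UNIV" using \<psi>(1) by (simp add: torus_embedding_def)
      have open3: "open {\<rho>. cmod (P \<rho>) < 3 * R}" by (intro open_Collect_less continuous_on_norm contP continuous_on_const)
      have "torus_embedding (\<lambda>\<theta>. S (\<psi> \<theta>))"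
        unfolding torus_embedding_def
      proof (intro conjI allI)
        show "smooth_on (\<lambda>\<theta>. S (\<psi> \<theta>)) UNIV"
          by (rule smooth_on_compose[OF open_UNIV open3 _ sm\<psi> S(1)]) (use P3 in auto)
        fix \<theta> \<theta>'
        have "S (\<psi> \<theta>) = S (\<psi> \<theta>') \<longleftrightarrow> \<psi> \<theta> = \<psi> \<theta>'"
          using inj_on_eq_iff[OF S(4)] P3(2) by simp
        then show "S (\<psi> \<theta>) = S (\<psi> \<theta>') \<longleftrightarrow> (\<forall>j. \<theta> $ j - \<theta>' $ j \<in> \<int>)"
          using \<psi>(1) by (simp add: torus_embedding_def)
        have "((\<lambda>\<theta>. S (\<psi> \<theta>)) has_derivative (\<lambda>v. frechet_derivative S (at (\<psi> \<theta>)) (frechet_derivative \<psi> (at \<theta>) v))) (at \<theta>)"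
          by (rule has_derivative_compose[OF smooth_on_UNIV_has_derivative[OF sm\<psi>] smooth_on_has_derivative[OF open3 S(1)]]) (use P3 in simp)
        from frechet_derivative_at[OF this]
        have "differential (\<lambda>\<theta>. S (\<psi> \<theta>)) \<theta> = frechet_derivative S (at (\<psi> \<theta>)) \<circ> frechet_derivative \<psi> (at \<theta>)"
          by (simp add: o_def)
        moreover have "inj (frechet_derivative \<psi> (at \<theta>))" using \<psi>(1) by (simp add: torus_embedding_def)
        ultimately show "inj (differential (\<lambda>\<theta>. S (\<psi> \<theta>)) \<theta>)" using S(3)[OF P3(1)] by (simp add: inj_compose)
      qed
      moreover have "range (\<lambda>\<theta>. S (\<psi> \<theta>)) = real_fibre p' z"
      proof -
        have "range (\<lambda>\<theta>. S (\<psi> \<theta>)) = S ` range \<psi>" by (simp only: image_image)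
        also have "\<dots> = S ` {\<rho>. P \<rho> = z}" unfolding \<psi>(2) F0 ..
        also have "\<dots> = real_fibre p' z" using S(5)[of z] zR unfolding F' by simp
        finally show ?thesis .
      qed
      moreover have "norm (\<Phi>' z \<theta> - cplx (S (\<psi> \<theta>))) \<le> e'" for \<theta>
      proof -
        have "\<Phi> z \<theta> \<in> tube (1 / C)" using \<Phi>(2)[OF z] by blast
        then have 1: "norm (\<Phi>' z \<theta> - \<Phi> z \<theta>) \<le> \<tau>"
          using \<phi>B[of "\<Phi> z \<theta>" "- \<zeta>"] s3'(2)[OF \<zeta>(4)] z norm_shear[of \<phi> "- \<zeta>" "\<Phi> z \<theta>"] by (simp add: \<Phi>'_def norm_mult)
        have 2: "norm (cplx (\<psi> \<theta>) - cplx (S (\<psi> \<theta>))) \<le> \<tau>"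
          using S(2)[OF P3(1)] norm_cplx[of "\<psi> \<theta> - S (\<psi> \<theta>)"]
          by (simp add: linear_diff[OF bounded_linear.linear[OF bounded_linear_cplx]] norm_minus_commute)
        have "\<Phi>' z \<theta> - cplx (S (\<psi> \<theta>)) = (\<Phi>' z \<theta> - \<Phi> z \<theta>) + (\<Phi> z \<theta> - cplx (\<psi> \<theta>)) + (cplx (\<psi> \<theta>) - cplx (S (\<psi> \<theta>)))" by simp
        moreover have "norm (a + b + c) \<le> norm a + norm b + norm c" for a b c :: C4
          using norm_triangle_ineq[of "a + b" c] norm_triangle_ineq[of a b] by linarith
        ultimately have "norm (\<Phi>' z \<theta> - cplx (S (\<psi> \<theta>))) \<le> norm (\<Phi>' z \<theta> - \<Phi> z \<theta>) + norm (\<Phi> z \<theta> - cplx (\<psi> \<theta>)) + norm (cplx (\<psi> \<theta>) - cplx (S (\<psi> \<theta>)))"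
          by metis
        also have "\<dots> \<le> \<tau> + e + \<tau>" using 1 2 \<psi>(3)[of \<theta>] by simp
        also have "\<dots> = e'" by (simp add: \<tau>_def field_simps)
        finally show ?thesis .
      qed
      ultimately show ?thesis by blast
    qed
    \<comment> \<open>Connectedness of the new zero fibre is read off from its parametrization by
      the plane, available since 0 lies in \<open>V\<close>.\<close>
    have A1': "condA1 p'"
    proof -
      obtain \<psi> :: "real^2 \<Rightarrow> R4" where \<psi>: "torus_embedding \<psi>" "range \<psi> = real_fibre p' 0" using torus'[OF V0(2)] by blast
      have "connected (range \<psi>)"
        using \<psi>(1) by (intro connected_continuous_image smooth_on_continuous) (auto simp: torus_embedding_def)
      then show ?thesis unfolding condA1_def \<psi>(2)[symmetric] by auto
    qed
    have tf': "torus_family \<eta> C' V p' \<Phi>'"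
      unfolding torus_family_def
    proof (intro conjI ballI)
      have openV: "open (V \<times> (UNIV :: (real^2) set))" using V0(1) by (intro open_Times) auto
      have "smooth_on (\<lambda>(z, \<theta>). \<Phi>' z \<theta>) (V \<times> UNIV) \<longleftrightarrow> smooth_on (\<lambda>y. shear \<phi> (- \<zeta>) ((\<lambda>(z, \<theta>). \<Phi> z \<theta>) y)) (V \<times> UNIV)"
        by (rule smooth_on_cong[OF openV]) (auto simp: \<Phi>'_def)
      then show "smooth_on (\<lambda>(z, \<theta>). \<Phi>' z \<theta>) (V \<times> UNIV)"
        using smooth_on_compose[OF openV open_UNIV _ \<Phi>sm smooth_on_shear[OF \<phi>(1)]] by simp
      show "\<exists>e<\<eta> C'. \<forall>z\<in>V. \<exists>\<psi> :: real^2 \<Rightarrow> R4. torus_embedding \<psi> \<and> range \<psi> = real_fibre p' z \<and> (\<forall>\<theta>. norm (\<Phi>' z \<theta> - cplx (\<psi> \<theta>)) \<le> e)"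
        using torus' C'(4) by blast
      fix z assume z: "z \<in> V"
      have \<Phi>'z: "\<Phi>' z = (\<lambda>\<theta>. shear \<phi> (- \<zeta>) (\<Phi> z \<theta>))" using z by (simp add: \<Phi>'_def[abs_def])
      have "(\<Phi>' z has_derivative (\<lambda>v. shear_deriv \<phi> (- \<zeta>) (\<Phi> z \<theta>) (differential (\<Phi> z) \<theta> v))) (at \<theta>)" for \<theta>
        unfolding \<Phi>'z by (rule has_derivative_compose[OF smooth_on_UNIV_has_derivative[OF \<Phi>z[OF z]] shear_has_derivative[OF \<phi>(1)]])
      then have D\<Phi>': "differential (\<Phi>' z) \<theta> = (\<lambda>v. shear_deriv \<phi> (- \<zeta>) (\<Phi> z \<theta>) (differential (\<Phi> z) \<theta> v))"
        and lin': "linear (differential (\<Phi>' z) \<theta>)" for \<theta>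
        using frechet_derivative_at has_derivative_linear by metis+
      show "torus_embedding (\<Phi>' z)"
        unfolding torus_embedding_def
      proof (intro conjI allI)
        show "smooth_on (\<Phi>' z) UNIV"
          unfolding \<Phi>'z by (rule smooth_on_compose[OF open_UNIV open_UNIV _ \<Phi>z[OF z] smooth_on_shear[OF \<phi>(1)]]) auto
        fix \<theta> \<theta>'
        have "\<Phi>' z \<theta> = \<Phi>' z \<theta>' \<longleftrightarrow> \<Phi> z \<theta> = \<Phi> z \<theta>'"
          unfolding \<Phi>'z using shear_shear[of \<phi> \<zeta> "- \<zeta>"] by (metis add.right_inverse shear_0)
        then show "\<Phi>' z \<theta> = \<Phi>' z \<theta>' \<longleftrightarrow> (\<forall>j. \<theta> $ j - \<theta>' $ j \<in> \<int>)"
          using \<Phi>(1)[OF z] by (simp add: torus_embedding_def)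
        have inj: "inj (differential (\<Phi> z) \<theta>)" "linear (differential (\<Phi> z) \<theta>)"
          using \<Phi>(1)[OF z] has_derivative_linear[OF smooth_on_UNIV_has_derivative[OF \<Phi>z[OF z]]] by (auto simp: torus_embedding_def)
        show "inj (differential (\<Phi>' z) \<theta>)"
          unfolding linear_injective_0[OF lin']
        proof (intro allI impI)
          fix v assume "differential (\<Phi>' z) \<theta> v = 0"
          then have "differential (\<Phi> z) \<theta> v = 0" unfolding D\<Phi>' by (rule shear_deriv_eq_0D)
          then show "v = 0" using inj linear_injective_0 by blast
        qed
      qed
      show "range (\<Phi>' z) \<subseteq> {\<rho> \<in> tube (1 / C'). p' \<rho> = z}"
      proof
        fix \<rho> assume "\<rho> \<in> range (\<Phi>' z)"
        then obtain \<theta> where \<rho>: "\<rho> = \<Phi>' z \<theta>" by blast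
        \<comment> \<open>That the tori remain in the narrower tube follows from closeness to a real
          torus: imaginary parts are at most \<open>e' < \<eta> C'\<close>, and \<eta> is bounded by
          the tube width.\<close>
        obtain \<psi> :: "real^2 \<Rightarrow> R4" where "norm (\<Phi>' z \<theta> - cplx (\<psi> \<theta>)) \<le> e'" using torus'[OF z] by blast
        moreover have "Im4 (\<Phi>' z \<theta> - cplx (\<psi> \<theta>)) = Im4 (\<Phi>' z \<theta>)"
          by (simp add: linear_diff[OF bounded_linear.linear[OF bounded_linear_Im4]])
        ultimately have "norm (Im4 \<rho>) \<le> e'" using norm_Im4_le[of "\<Phi>' z \<theta> - cplx (\<psi> \<theta>)"] \<rho> by simp
        then have "\<rho> \<in> tube (1 / C')" using C'(4) \<eta>C' by (simp add: tube_def)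
        moreover have "p' \<rho> = z" using \<Phi>(2)[OF z] by (auto simp: \<rho> \<Phi>'z p'_def shear_shear)
        ultimately show "\<rho> \<in> {\<rho> \<in> tube (1 / C'). p' \<rho> = z}" by simp
      qed
      show "\<forall>\<theta> u v. sigma (differential (\<Phi>' z) \<theta> u) (differential (\<Phi>' z) \<theta> v) = 0"
        using \<Phi>(3)[OF z] by (simp add: D\<Phi>' sigma_shear_deriv)
      show "\<forall>j. xi_dx_integral (cycle \<Phi>' j z) \<in> \<real>" using \<Phi>(4)[OF z] by (simp add: xi)
    qed
    have A5': "condA5 \<eta> C' V p' \<Phi>'"
      unfolding condA5_def act using V0 tf' diffeo by blast

    \<comment> \<open>Existence of the perturbed Weyl density\<close>
    have smp': "smooth_on (\<lambda>\<rho>. p' (cplx \<rho>)) UNIV"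
      by (rule smooth_on_real_restriction[OF holo']) (use C'0(1) in simp)
    \<comment> \<open>Sublevel sets of the new symbol are thereby contained in those of
      \<open>P\<close>, whose compactness and nondegeneracy are already secured.\<close>
    have near: "cmod (P \<rho>) \<le> 2 * R" if "cmod (p' (cplx \<rho>)) \<le> R" for \<rho>
    proof -
      have "cmod (p' (cplx \<rho>) - P \<rho>) \<le> R" using lip'[of "cplx \<rho>"] \<mu>(2) C by (simp add: P_def)
      moreover have "cmod (P \<rho>) - cmod (p' (cplx \<rho>)) \<le> cmod (p' (cplx \<rho>) - P \<rho>)"
        by (metis norm_minus_commute norm_triangle_ineq2)
      ultimately show ?thesis using that by linarith
    qed
    have "\<exists>w. weyl_density V p' w"
    proof (rule weyl_density_exists[OF smp' R(1) _ _ V(1)])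
      show "compact {\<rho>. cmod (p' (cplx \<rho>)) \<le> R}"
      proof (rule compact_sublevel[OF smooth_on_continuous[OF smp']])
        fix \<rho> assume "cmod (p' (cplx \<rho>)) \<le> R"
        then show "norm \<rho> \<le> C" using near[of \<rho>] R(1) by (intro small) linarith
      qed
      fix \<rho> assume "cmod (p' (cplx \<rho>)) \<le> R"
      then have "cmod (P \<rho>) \<le> 3 * R" using near[of \<rho>] R(1) by linarith
      then have "(\<zeta>, \<rho>) \<in> W2" by (rule s2(2)[OF \<zeta>(3)])
      then have "sqrt (gram (\<lambda>\<rho>. p' (cplx \<rho>)) \<rho>) > 0" using wn[OF \<zeta>(1), of \<rho>] by (simp add: W2_def p'_def)
      then show "gram (\<lambda>\<rho>. p' (cplx \<rho>)) \<rho> \<noteq> 0" by auto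
    qed
    then obtain w' where w': "weyl_density V p' w'" ..
    have "(SUP \<rho>\<in>tube (1 / (2 * C)). cmod (p' \<rho> - p \<rho>)) \<le> \<mu>"
    proof (rule cSUP_least)
      show "tube (1 / (2 * C)) \<noteq> {}" using cplx_in_tube[of "1 / (2 * C)" 0] C by force
    qed (erule lip')
    then have sup: "(SUP \<rho>\<in>tube (1 / (2 * C)). cmod (p' \<rho> - p \<rho>)) < \<epsilon>" using \<mu>(4) \<epsilon> by linarith
    have "bounded (p' ` tube (1 / (2 * C)))" unfolding bounded_iff using bdd' half by blast
    moreover have "holomorphic4_on p' (tube (1 / (2 * C)))" using holo' half by (auto simp: holomorphic4_on_def)
    ultimately show "\<exists>p' C' \<Phi>' w'. p' = (\<lambda>\<rho>. p (shear \<phi> \<zeta> \<rho>)) \<and>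
     holomorphic4_on p' (tube (1 / (2 * C))) \<and> bounded (p' ` tube (1 / (2 * C))) \<and>
     (SUP \<rho>\<in>tube (1 / (2 * C)). cmod (p' \<rho> - p \<rho>)) < \<epsilon> \<and>
     condA1 p' \<and> condA2 p' \<and> condA3 p' \<and> condA4 \<delta> C' p' \<and> condA5 \<eta> C' V p' \<Phi>' \<and>
     actions \<Phi>' = actions \<Phi> \<and> weyl_density V p' w'"
      using p'_def sup A1' A2' A3' A4' A5' act w' by blast
  qed
qed

theorem theorem1p2:
  fixes p :: "C4 \<Rightarrow> complex" and C :: real and \<delta> \<eta> :: "real \<Rightarrow> real"
  assumes "threshold \<delta>"
    and "threshold \<eta>" and "\<forall>c>0. \<eta> c \<le> 1 / c"
    and "condA1 p" and "condA2 p" and "condA3 p" and "condA4 \<delta> C p"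
  shows "\<exists>\<rho>0>0. \<forall>V \<Phi> \<omega> w.
           V \<subseteq> ball 0 \<rho>0 \<and> condA5 \<eta> C V p \<Phi> \<and>
           spectral_density V \<Phi> \<omega> \<and> weyl_density V p w \<and> (\<forall>z\<in>V. w z = \<omega> z)
         \<longrightarrow> (\<exists>r>0. r \<le> 1 / C \<and> (\<forall>\<epsilon>>0. \<exists>p' C' \<Phi>' \<omega>' w'.
               holomorphic4_on p' (tube r) \<and> bounded (p' ` tube r) \<and>
               (SUP \<rho>\<in>tube r. cmod (p' \<rho> - p \<rho>)) < \<epsilon> \<and>
               condA1 p' \<and> condA2 p' \<and> condA3 p' \<and> condA4 \<delta> C' p' \<and> condA5 \<eta> C' V p' \<Phi>' \<and>
               spectral_density V \<Phi>' \<omega>' \<and> weyl_density V p' w' \<and>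
               (\<exists>z\<in>V. w' z \<noteq> \<omega>' z)))"
proof -
  have unif: "uniform_constant C p" using assms(7) by (simp add: condA4_def)
  then have C: "C > 0" and p: "holomorphic4_on p (tube (1 / C))" "\<forall>\<rho>\<in>tube (1 / C). cmod (p \<rho>) \<le> C" "elliptic_at_infinity C p"
    by (auto simp: uniform_constant_def)
  have ne: "real_fibre p 0 \<noteq> {}" using assms(4) by (simp add: condA1_def)
  obtain R where R: "R > 0" "3 * R < 1 / C" "\<And>\<rho>. cmod (p (cplx \<rho>)) \<le> 3 * R \<Longrightarrow> gram (\<lambda>\<rho>. p (cplx \<rho>)) \<rho> \<noteq> 0"
    using regular_fibre_neighbourhood[OF unif] by blast
  show ?thesis
  \<comment> \<open>\<open>R\<close> is the radius over which the fibres of \<open>p\<close> are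
    regular with a margin of factor 3; the neighbourhood \<open>V\<close> has to fit into
    it.\<close>
  proof (rule exI[of _ R], intro conjI allI impI)
    show "R > 0" by fact
    fix V \<Phi> \<omega> w
    assume "V \<subseteq> ball 0 R \<and> condA5 \<eta> C V p \<Phi> \<and>
           spectral_density V \<Phi> \<omega> \<and> weyl_density V p w \<and> (\<forall>z\<in>V. w z = \<omega> z)"
    then have V: "V \<subseteq> ball 0 R" "condA5 \<eta> C V p \<Phi>" and dens: "spectral_density V \<Phi> \<omega>" "weyl_density V p w" "\<forall>z\<in>V. w z = \<omega> z"
      by blast+
    have "open V" "0 \<in> V" using V(2) by (auto simp: condA5_def)
    from ex_variation[OF C p ne this] obtain N b f where N: "N \<ge> 0" and f: "f \<in> test_functions V"
      and var: "\<And>s. s > 0 \<Longrightarrow> \<exists>\<zeta>. cmod \<zeta> < s \<and> (\<integral>\<rho>. f (p (shear (gaussian N b) \<zeta> (cplx \<rho>))) \<partial>lborel) \<noteq> (\<integral>\<rho>. f (p (cplx \<rho>)) \<partial>lborel)"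
      by blast
    \<comment> \<open>The Gaussian and the test function depend on \<open>p\<close> and
      \<open>V\<close> but not on \<epsilon>, which only restricts \<zeta>. Hence one width
      \<open>?r\<close> serves for all \<epsilon>.\<close>
    let ?\<phi> = "gaussian N b" and ?r = "1 / (2 * C)"
    show "\<exists>r>0. r \<le> 1 / C \<and> (\<forall>\<epsilon>>0. \<exists>p' C' \<Phi>' \<omega>' w'.
               holomorphic4_on p' (tube r) \<and> bounded (p' ` tube r) \<and>
               (SUP \<rho>\<in>tube r. cmod (p' \<rho> - p \<rho>)) < \<epsilon> \<and>
               condA1 p' \<and> condA2 p' \<and> condA3 p' \<and> condA4 \<delta> C' p' \<and> condA5 \<eta> C' V p' \<Phi>' \<and>
               spectral_density V \<Phi>' \<omega>' \<and> weyl_density V p' w' \<and>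
               (\<exists>z\<in>V. w' z \<noteq> \<omega>' z))"
    proof (rule exI[of _ ?r], intro conjI allI impI)
      show "?r > 0" "?r \<le> 1 / C" using C by (auto simp: field_simps)
      fix \<epsilon> :: real assume \<epsilon>: "\<epsilon> > 0"
      have bound: "cmod (?\<phi> w) \<le> exp (N * (1 / C)\<^sup>2)" if "\<bar>Im w\<bar> < 1 / C" for w
        using gaussian_bound[OF N, of w "1 / C" b] that by simp
      obtain s where s: "s > 0" and pert: "\<And>\<zeta>. cmod \<zeta> < s \<Longrightarrow> \<exists>p' C' \<Phi>' w'. p' = (\<lambda>\<rho>. p (shear ?\<phi> \<zeta> \<rho>)) \<and>
         holomorphic4_on p' (tube ?r) \<and> bounded (p' ` tube ?r) \<and> (SUP \<rho>\<in>tube ?r. cmod (p' \<rho> - p \<rho>)) < \<epsilon> \<and>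
         condA1 p' \<and> condA2 p' \<and> condA3 p' \<and> condA4 \<delta> C' p' \<and> condA5 \<eta> C' V p' \<Phi>' \<and>
         actions \<Phi>' = actions \<Phi> \<and> weyl_density V p' w'"
        using shear_perturbation[OF assms(1-3,7) ne R gaussian_holomorphic exp_gt_zero bound V \<epsilon>] by blast
      obtain \<zeta> where \<zeta>: "cmod \<zeta> < s" "(\<integral>\<rho>. f (p (shear ?\<phi> \<zeta> (cplx \<rho>))) \<partial>lborel) \<noteq> (\<integral>\<rho>. f (p (cplx \<rho>)) \<partial>lborel)"
        using var[OF s] by blast
      obtain p' C' \<Phi>' w' where p': "p' = (\<lambda>\<rho>. p (shear ?\<phi> \<zeta> \<rho>))" "holomorphic4_on p' (tube ?r)" "bounded (p' ` tube ?r)"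
         "(SUP \<rho>\<in>tube ?r. cmod (p' \<rho> - p \<rho>)) < \<epsilon>"
         "condA1 p'" "condA2 p'" "condA3 p'" "condA4 \<delta> C' p'" "condA5 \<eta> C' V p' \<Phi>'"
         "actions \<Phi>' = actions \<Phi>" "weyl_density V p' w'"
        using pert[OF \<zeta>(1)] by blast
      have dens': "spectral_density V \<Phi>' \<omega>" using dens(1) unfolding spectral_density_def p'(10) .
      \<comment> \<open>Agreement would give \<open>w' = w\<close> on \<open>V\<close>, and testing
        both with \<open>f\<close> would contradict the choice of \<zeta>.\<close>
      have "\<exists>z\<in>V. w' z \<noteq> \<omega> z"
      proof (rule ccontr)
        assume "\<not> (\<exists>z\<in>V. w' z \<noteq> \<omega> z)"
        then have eq: "w' z = w z" if "z \<in> V" for z using dens(3) that by auto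
        have fw: "f z * of_real (w' z) = f z * of_real (w z)" for z
        proof (cases "f z = 0")
          case False
          then have "z \<in> V" using f closure_subset[of "{z. f z \<noteq> 0}"] by (auto simp: test_functions_def)
          then show ?thesis using eq by simp
        qed simp
        have "(\<integral>z. f z * of_real (w' z) \<partial>lborel) = (\<integral>z. f z * of_real (w z) \<partial>lborel)" by (simp only: fw)
        then have "(\<integral>\<rho>. f (p' (cplx \<rho>)) \<partial>lborel) = (\<integral>\<rho>. f (p (cplx \<rho>)) \<partial>lborel)"
          using p'(11) dens(2) f by (simp add: weyl_density_def)
        then show False using \<zeta>(2) by (simp add: p'(1))
      qed
      then show "\<exists>p' C' \<Phi>' \<omega>' w'.
               holomorphic4_on p' (tube ?r) \<and> bounded (p' ` tube ?r) \<and>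
               (SUP \<rho>\<in>tube ?r. cmod (p' \<rho> - p \<rho>)) < \<epsilon> \<and>
               condA1 p' \<and> condA2 p' \<and> condA3 p' \<and> condA4 \<delta> C' p' \<and> condA5 \<eta> C' V p' \<Phi>' \<and>
               spectral_density V \<Phi>' \<omega>' \<and> weyl_density V p' w' \<and>
               (\<exists>z\<in>V. w' z \<noteq> \<omega>' z)"
        using p' dens' by blast
    qed
  qed
qed

end
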